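(* Assume the standing setup. There is a constant $C$ independent of $\nu$ such that for any positive function $\delta=\delta(\nu)$, $$\|\omega\|_{L^2(0,T;L^1(\Gamma_{\delta(\nu)}))}\le C\Big(\frac{\delta(\nu)}{\nu}\Big)^{1/2}.$$ Moreover, if $u\to\overline{u}$ in $L^\infty(0,T;L^2(\Omega))$ as $\nu\to0$ and $\limsup_{\nu\to0^+}\delta(\nu)/\nu<\infty$, then $$\|\omega\|_{L^2(0,T;L^1(\Gamma_{\delta(\nu)}))}\to0\quad\text{as }\nu\to0.$$
   Context: Standing setup: $\Omega\subset\mathbb{R}^d$, $d\ge2$, bounded domain with $C^2$ boundary $\Gamma$, outward normal $\mathbf{n}$. $H=\{u\in L^2(\Omega)^d:\operatorname{div}u=0,\ u\cdot\mathbf{n}=0\text{ on }\Gamma\}$. $u_0\in C^{k+\epsilon}(\Omega)\cap H$, $\epsilon>0$, $k=1$ if $d=2$, $k=2$ if $d\ge3$; $f\in C^1_{loc}(\mathbb{R};C^1(\Omega))$. $\overline{u}$ is the smooth solution on $[0,T]$ of the Euler equations with forcing $f$, $\overline{u}\cdot\mathbf{n}=0$ on $\Gamma$, $\overline{u}(0)=u_0$; $u=u_\nu$ is a (Leray–Hopf) weak solution of the Navier–Stokes equations with viscosity $\nu>0$, forcing $f$, $u=0$ on $\Gamma$, $u(0)=u_0$. $\omega=\omega(u)=\frac12(\nabla u-(\nabla u)^T)$ (scalar curl in 2D). For $\delta>0$, $\Gamma_\delta=\{x\in\Omega:\operatorname{dist}(x,\Gamma)<\delta\}$. *)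

theory Defs
  imports "HOL-Analysis.Analysis" "HOL-Probability.Essential_Supremum"
begin

definition pd :: "('a::euclidean_space \<Rightarrow> 'b::real_normed_vector) \<Rightarrow> 'a \<Rightarrow> 'a \<Rightarrow> 'b" where
  "pd g x b = frechet_derivative g (at x) b"

definition grad :: "('a::euclidean_space \<Rightarrow> real) \<Rightarrow> 'a \<Rightarrow> 'a" where
  "grad g x = (\<Sum>b\<in>Basis. pd g x b *\<^sub>R b)"

fun Ck_on :: "nat \<Rightarrow> 'a::euclidean_space set \<Rightarrow> ('a \<Rightarrow> 'b::real_normed_vector) \<Rightarrow> bool" where
  "Ck_on 0 S g = continuous_on S g"
| "Ck_on (Suc k) S g = (g differentiable_on S \<and> (\<forall>b\<in>Basis. Ck_on k S (\<lambda>x. pd g x b)))"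

definition smooth_on :: "'a::euclidean_space set \<Rightarrow> ('a \<Rightarrow> 'b::real_normed_vector) \<Rightarrow> bool" where
  "smooth_on S g \<longleftrightarrow> (\<forall>k. Ck_on k S g)"

definition tsupp :: "('a::euclidean_space \<Rightarrow> 'b::real_normed_vector) \<Rightarrow> 'a set" where
  "tsupp g = closure {x. g x \<noteq> 0}"

definition test_fun :: "'a::euclidean_space set \<Rightarrow> ('a \<Rightarrow> 'b::real_normed_vector) \<Rightarrow> bool" where
  "test_fun S g \<longleftrightarrow> smooth_on UNIV g \<and> compact (tsupp g) \<and> tsupp g \<subseteq> S"

fun iter_pd :: "'a::euclidean_space list \<Rightarrow> ('a \<Rightarrow> 'b::real_normed_vector) \<Rightarrow> 'a \<Rightarrow> 'b" where
  "iter_pd [] g = g"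
| "iter_pd (b # bs) g = iter_pd bs (\<lambda>x. pd g x b)"

definition Holder_space :: "nat \<Rightarrow> real \<Rightarrow> 'a::euclidean_space set \<Rightarrow> ('a \<Rightarrow> 'b::real_normed_vector) \<Rightarrow> bool" where
  "Holder_space k \<epsilon> \<Omega> g \<longleftrightarrow> Ck_on k \<Omega> g
     \<and> (\<forall>bs. set bs \<subseteq> Basis \<and> length bs \<le> k \<longrightarrow> bounded (iter_pd bs g ` \<Omega>))
     \<and> (\<forall>bs. set bs \<subseteq> Basis \<and> length bs = k \<longrightarrow>
          (\<exists>M. \<forall>x\<in>\<Omega>. \<forall>y\<in>\<Omega>. dist (iter_pd bs g x) (iter_pd bs g y) \<le> M * dist x y powr \<epsilon>))"

definition C1b :: "'a::euclidean_space set \<Rightarrow> ('a \<Rightarrow> 'b::real_normed_vector) \<Rightarrow> bool" where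
  "C1b \<Omega> g \<longleftrightarrow> Ck_on 1 \<Omega> g \<and> bounded (g ` \<Omega>) \<and> (\<forall>b\<in>Basis. bounded ((\<lambda>x. pd g x b) ` \<Omega>))"

definition C1nrm :: "'a::euclidean_space set \<Rightarrow> ('a \<Rightarrow> 'b::real_normed_vector) \<Rightarrow> real" where
  "C1nrm \<Omega> g = (SUP x\<in>\<Omega>. norm (g x)) + (\<Sum>b\<in>Basis. SUP x\<in>\<Omega>. norm (pd g x b))"

definition C1_time_C1 :: "'a::euclidean_space set \<Rightarrow> (real \<Rightarrow> 'a \<Rightarrow> 'b::real_normed_vector) \<Rightarrow> bool" where
  "C1_time_C1 \<Omega> f \<longleftrightarrow> (\<exists>f'. (\<forall>t. C1b \<Omega> (f t) \<and> C1b \<Omega> (f' t))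
     \<and> (\<forall>t. ((\<lambda>s. C1nrm \<Omega> (\<lambda>x. f s x - f t x - (s - t) *\<^sub>R f' t x) / \<bar>s - t\<bar>) \<longlongrightarrow> 0) (at t))
     \<and> (\<forall>t. ((\<lambda>s. C1nrm \<Omega> (\<lambda>x. f' s x - f' t x)) \<longlongrightarrow> 0) (at t)))"

text \<open>Local chart at a boundary point x0: in the ball of radius r, Omega lies strictly above
  the graph of a C^2 function gamma of the variables orthogonal to the unit vector e.\<close>
definition bdry_chart :: "'a::euclidean_space set \<Rightarrow> 'a \<Rightarrow> real \<Rightarrow> 'a \<Rightarrow> ('a \<Rightarrow> real) \<Rightarrow> bool" where
  "bdry_chart \<Omega> x0 r e \<gamma> \<longleftrightarrow> 0 < r \<and> norm e = 1 \<and> Ck_on 2 UNIV \<gamma>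
     \<and> (\<forall>x. \<gamma> x = \<gamma> (x - (x \<bullet> e) *\<^sub>R e))
     \<and> ball x0 r \<inter> \<Omega> = {x \<in> ball x0 r. x \<bullet> e > \<gamma> x}"

definition C2_domain :: "'a::euclidean_space set \<Rightarrow> bool" where
  "C2_domain \<Omega> \<longleftrightarrow> open \<Omega> \<and> connected \<Omega> \<and> bounded \<Omega> \<and> \<Omega> \<noteq> {}
     \<and> (\<forall>x0\<in>frontier \<Omega>. \<exists>r e \<gamma>. bdry_chart \<Omega> x0 r e \<gamma>)"

definition outward_normal :: "'a::euclidean_space set \<Rightarrow> 'a \<Rightarrow> 'a \<Rightarrow> bool" where
  "outward_normal \<Omega> x n \<longleftrightarrow> x \<in> frontier \<Omega> \<and>
     (\<exists>r e \<gamma>. bdry_chart \<Omega> x r e \<gamma> \<and> n = (1 / norm (grad \<gamma> x - e)) *\<^sub>R (grad \<gamma> x - e))"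

definition L2sq_enn :: "'a::euclidean_space set \<Rightarrow> ('a \<Rightarrow> 'b::real_normed_vector) \<Rightarrow> ennreal" where
  "L2sq_enn S g = (\<integral>\<^sup>+x\<in>S. ennreal ((norm (g x))\<^sup>2) \<partial>lebesgue)"

definition in_L2 :: "'a::euclidean_space set \<Rightarrow> ('a \<Rightarrow> 'b::{real_normed_vector,second_countable_topology}) \<Rightarrow> bool" where
  "in_L2 S g \<longleftrightarrow> g \<in> borel_measurable lebesgue \<and> L2sq_enn S g < \<infinity>"

definition L2sq :: "'a::euclidean_space set \<Rightarrow> ('a \<Rightarrow> 'b::real_normed_vector) \<Rightarrow> real" where
  "L2sq S g = enn2real (L2sq_enn S g)"

definition L2nrm :: "'a::euclidean_space set \<Rightarrow> ('a \<Rightarrow> 'b::real_normed_vector) \<Rightarrow> ereal" where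
  "L2nrm S g = (if L2sq_enn S g = \<infinity> then \<infinity> else ereal (sqrt (L2sq S g)))"

text \<open>The space H: L^2 fields with div = 0 and zero normal trace, both in the weak
  (Green's formula) sense: the integral of g . grad phi over Omega vanishes for all
  test functions phi on the whole space.\<close>
definition H_space :: "'a::euclidean_space set \<Rightarrow> ('a \<Rightarrow> 'a) \<Rightarrow> bool" where
  "H_space \<Omega> g \<longleftrightarrow> in_L2 \<Omega> g \<and>
     (\<forall>\<phi>::'a \<Rightarrow> real. test_fun UNIV \<phi> \<longrightarrow> (LINT x:\<Omega>|lebesgue. g x \<bullet> grad \<phi> x) = 0)"

definition weak_grad :: "'a::euclidean_space set \<Rightarrow> ('a \<Rightarrow> 'a) \<Rightarrow> ('a \<Rightarrow> 'a \<Rightarrow> 'a) \<Rightarrow> bool" where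
  "weak_grad \<Omega> g G \<longleftrightarrow> in_L2 \<Omega> g \<and> (\<forall>b\<in>Basis. in_L2 \<Omega> (\<lambda>x. G x b)) \<and>
     (\<forall>(\<phi>::'a \<Rightarrow> real) b. test_fun \<Omega> \<phi> \<and> b \<in> Basis \<longrightarrow>
        (\<integral>x\<in>\<Omega>. \<phi> x *\<^sub>R G x b \<partial>lebesgue) = - (\<integral>x\<in>\<Omega>. pd \<phi> x b *\<^sub>R g x \<partial>lebesgue))"

definition H1_0 :: "'a::euclidean_space set \<Rightarrow> ('a \<Rightarrow> 'a) \<Rightarrow> ('a \<Rightarrow> 'a \<Rightarrow> 'a) \<Rightarrow> bool" where
  "H1_0 \<Omega> g G \<longleftrightarrow> weak_grad \<Omega> g G \<and>
     (\<exists>\<phi>s::nat \<Rightarrow> 'a \<Rightarrow> 'a. (\<forall>n. test_fun \<Omega> (\<phi>s n))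
        \<and> (\<lambda>n. L2sq \<Omega> (\<lambda>x. \<phi>s n x - g x)) \<longlonglongrightarrow> 0
        \<and> (\<forall>b\<in>Basis. (\<lambda>n. L2sq \<Omega> (\<lambda>x. pd (\<phi>s n) x b - G x b)) \<longlonglongrightarrow> 0))"

text \<open>Leray--Hopf weak solution u of Navier--Stokes on [0,T] with viscosity nu, forcing f,
  initial data u0, no-slip boundary condition; Du t x b is the (weak) partial derivative
  of u t in direction b at x.\<close>
definition NS_weak :: "'d::euclidean_space set \<Rightarrow> real \<Rightarrow> real \<Rightarrow> (real \<Rightarrow> 'd \<Rightarrow> 'd) \<Rightarrow> ('d \<Rightarrow> 'd)
    \<Rightarrow> (real \<Rightarrow> 'd \<Rightarrow> 'd) \<Rightarrow> (real \<Rightarrow> 'd \<Rightarrow> 'd \<Rightarrow> 'd) \<Rightarrow> bool" where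
  "NS_weak \<Omega> T \<nu> f u0 u Du \<longleftrightarrow>
     (\<lambda>z::real \<times> 'd. u (fst z) (snd z)) \<in> borel_measurable lebesgue
   \<and> (\<forall>b\<in>Basis. (\<lambda>z::real \<times> 'd. Du (fst z) (snd z) b) \<in> borel_measurable lebesgue)
   \<and> (\<forall>t\<in>{0..T}. H_space \<Omega> (u t))
   \<and> (\<exists>M. \<forall>t\<in>{0..T}. L2sq \<Omega> (u t) \<le> M)
   \<and> (AE t in lebesgue. t \<in> {0..T} \<longrightarrow> H1_0 \<Omega> (u t) (Du t))
   \<and> (\<integral>\<^sup>+t\<in>{0..T}. (\<Sum>b\<in>Basis. L2sq_enn \<Omega> (\<lambda>x. Du t x b)) \<partial>lebesgue) < \<infinity>
   \<and> (\<forall>\<phi>::real \<times> 'd \<Rightarrow> 'd. test_fun ({..<T} \<times> \<Omega>) \<phi> \<and> (\<forall>z. (\<Sum>b\<in>Basis. pd \<phi> z (0, b) \<bullet> b) = 0) \<longrightarrow>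
        - (LINT z:({0..T} \<times> \<Omega>)|lebesgue. u (fst z) (snd z) \<bullet> pd \<phi> z (1, 0))
        + \<nu> * (LINT z:({0..T} \<times> \<Omega>)|lebesgue. \<Sum>b\<in>Basis. Du (fst z) (snd z) b \<bullet> pd \<phi> z (0, b))
        + (LINT z:({0..T} \<times> \<Omega>)|lebesgue.
             \<Sum>b\<in>Basis. (u (fst z) (snd z) \<bullet> b) * (Du (fst z) (snd z) b \<bullet> \<phi> z))
        = (LINT x:\<Omega>|lebesgue. u0 x \<bullet> \<phi> (0, x))
          + (LINT z:({0..T} \<times> \<Omega>)|lebesgue. f (fst z) (snd z) \<bullet> \<phi> z))
   \<and> (\<forall>t\<in>{0..T}. L2sq \<Omega> (u t)
          + 2 * \<nu> * enn2real (\<integral>\<^sup>+s\<in>{0..t}. (\<Sum>b\<in>Basis. L2sq_enn \<Omega> (\<lambda>x. Du s x b)) \<partial>lebesgue)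
        \<le> L2sq \<Omega> u0 + 2 * (LINT z:({0..t} \<times> \<Omega>)|lebesgue. f (fst z) (snd z) \<bullet> u (fst z) (snd z)))"

text \<open>Classical (C^1 up to the boundary on [0,T] x closure Omega) solution of the Euler
  equations with forcing f, impermeability boundary condition and initial data u0.\<close>
definition Euler_sol :: "'d::euclidean_space set \<Rightarrow> real \<Rightarrow> (real \<Rightarrow> 'd \<Rightarrow> 'd) \<Rightarrow> ('d \<Rightarrow> 'd)
    \<Rightarrow> (real \<Rightarrow> 'd \<Rightarrow> 'd) \<Rightarrow> bool" where
  "Euler_sol \<Omega> T f u0 ub \<longleftrightarrow>
     (\<exists>U (v :: real \<times> 'd \<Rightarrow> 'd). open U \<and> {0..T} \<times> closure \<Omega> \<subseteq> U \<and> Ck_on 1 U v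
        \<and> (\<forall>t\<in>{0..T}. \<forall>x\<in>closure \<Omega>. v (t, x) = ub t x)
        \<and> (\<exists>p :: real \<Rightarrow> 'd \<Rightarrow> real. (\<forall>t\<in>{0..T}. Ck_on 1 \<Omega> (p t)) \<and>
             (\<forall>t\<in>{0..T}. \<forall>x\<in>\<Omega>. pd v (t, x) (1, 0)
                 + (\<Sum>b\<in>Basis. (ub t x \<bullet> b) *\<^sub>R pd v (t, x) (0, b)) + grad (p t) x = f t x))
        \<and> (\<forall>t\<in>{0..T}. \<forall>x\<in>\<Omega>. (\<Sum>b\<in>Basis. pd v (t, x) (0, b) \<bullet> b) = 0))
   \<and> (\<forall>t\<in>{0..T}. \<forall>x\<in>frontier \<Omega>. \<forall>n. outward_normal \<Omega> x n \<longrightarrow> ub t x \<bullet> n = 0)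
   \<and> (\<forall>x\<in>\<Omega>. ub 0 x = u0 x)"

text \<open>Pointwise (Frobenius) norm of omega = (grad u - (grad u)^T)/2.\<close>
definition vort_abs :: "(real \<Rightarrow> 'd::euclidean_space \<Rightarrow> 'd \<Rightarrow> 'd) \<Rightarrow> real \<Rightarrow> 'd \<Rightarrow> real" where
  "vort_abs Du t x = sqrt (\<Sum>i\<in>Basis. \<Sum>j\<in>Basis. ((Du t x j \<bullet> i - Du t x i \<bullet> j) / 2)\<^sup>2)"

definition bl :: "'d::euclidean_space set \<Rightarrow> real \<Rightarrow> 'd set" where
  "bl \<Omega> \<delta> = {x \<in> \<Omega>. infdist x (frontier \<Omega>) < \<delta>}"

definition ennsqrt :: "ennreal \<Rightarrow> ennreal" where
  "ennsqrt x = (if x = \<infinity> then \<infinity> else ennreal (sqrt (enn2real x)))"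

definition L2L1_norm :: "real \<Rightarrow> 'd::euclidean_space set \<Rightarrow> (real \<Rightarrow> 'd \<Rightarrow> real) \<Rightarrow> ennreal" where
  "L2L1_norm T S w = ennsqrt (\<integral>\<^sup>+t\<in>{0..T}. (\<integral>\<^sup>+x\<in>S. ennreal (w t x) \<partial>lebesgue)\<^sup>2 \<partial>lebesgue)"

end

theory Submission
  imports Defs
begin

text \<open>
  By Cauchy--Schwarz the norm of the vorticity is at most the square root of the volume of the
  boundary layer, which is \<open>O(\<delta>)\<close>, times the square root of the total dissipation
  \<open>\<integral> |\<nabla>u|\<^sup>2\<close>. The energy inequality bounds \<open>\<nu>\<close> times the
  latter uniformly in \<open>\<nu>\<close>, and it tends to 0 under convergence to the Euler solution, because
  that solution conserves energy up to the work of the force.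

  Energy conservation needs \<open>\<integral> ub \<bullet> \<nabla>q = 0\<close> for the total head
  \<open>q = p + |ub|\<^sup>2/2\<close>. No divergence theorem up to the boundary is used for this: the
  Navier--Stokes velocities are limits of test functions in \<open>H\<^sup>1\<close> and divergence free, hence
  orthogonal to gradients, and they converge to \<open>ub\<close> in \<open>L\<^sup>2\<close> at almost every time.
\<close>

section \<open>Volume of the boundary layer\<close>

text \<open>Both halves bound \<open>K * \<delta> * D\<close>, with \<open>D\<close> the total
  dissipation, through the regrouping \<open>K * (\<delta> / \<nu>) * (\<nu> * D)\<close>. A bound
  on \<open>\<nu> * D\<close> that is merely uniform gives the rate; one that is linear in the
  distance to the Euler solution gives the limit. Three features of the hypotheses shape the second
  bound. Closeness in the essential supremum holds only at almost every time and may fail at the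
  final one, so the energy comparison is carried to \<open>T\<close> by monotone convergence. The
  pressure is given at each fixed time and inside \<Omega>, with no regularity in time and no bound
  near the boundary; hence it is eliminated on each time slice before integrating in time, and its
  gradient is controlled through the momentum equation. The approximating velocities are drawn from
  the given family, one viscosity for each tolerance \<open>1 / (n + 1)\<close>, so that countably
  many exceptional sets of times form a single null set.\<close>

lemma Ck_on_imp_continuous_on: "Ck_on k S g \<Longrightarrow> continuous_on S g"
  by (cases k) (auto intro: differentiable_imp_continuous_on)

lemma frechet_derivative_eq_sum_pd:
  assumes "g differentiable (at x)"
  shows "frechet_derivative g (at x) h = (\<Sum>b\<in>Basis. (h \<bullet> b) *\<^sub>R pd g x b)"
proof -
  interpret linear "frechet_derivative g (at x)"
    using assms by (rule linear_frechet_derivative)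
  have "frechet_derivative g (at x) h = frechet_derivative g (at x) (\<Sum>b\<in>Basis. (h \<bullet> b) *\<^sub>R b)"
    by (simp add: euclidean_representation)
  then show ?thesis by (simp add: sum scale pd_def)
qed

text \<open>Each coordinate of the increment is bounded by its norm, which costs the factor
  \<open>DIM('a)\<close>; later uses only ask for some Lipschitz constant, on a chart ball or on the
  whole space.\<close>

lemma norm_diff_le_pd_bound:
  fixes g :: "'a::euclidean_space \<Rightarrow> 'b::real_normed_vector" and B :: real
  assumes "convex S" and d: "\<And>x. x \<in> S \<Longrightarrow> g differentiable (at x)"
    and B: "\<And>x b. x \<in> S \<Longrightarrow> b \<in> Basis \<Longrightarrow> norm (pd g x b) \<le> B"
    and "x \<in> S" "y \<in> S"
  shows "norm (g x - g y) \<le> (DIM('a) * B) * norm (x - y)"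
proof (rule differentiable_bound[OF \<open>convex S\<close> _ _ \<open>x \<in> S\<close> \<open>y \<in> S\<close>])
  fix z assume z: "z \<in> S"
  show "(g has_derivative frechet_derivative g (at z)) (at z within S)"
    using d[OF z] by (simp add: frechet_derivative_works has_derivative_at_withinI)
  show "onorm (frechet_derivative g (at z)) \<le> DIM('a) * B"
  proof (rule onorm_le)
    fix h :: 'a
    have "norm (frechet_derivative g (at z) h) \<le> (\<Sum>b\<in>Basis. \<bar>h \<bullet> b\<bar> * norm (pd g z b))"
      unfolding frechet_derivative_eq_sum_pd[OF d[OF z]] by (rule order_trans[OF norm_sum]) simp
    also have "\<dots> \<le> (\<Sum>b\<in>(Basis::'a set). norm h * B)"
      by (intro sum_mono mult_mono B z Basis_le_norm) auto
    finally show "norm (frechet_derivative g (at z) h) \<le> DIM('a) * B * norm h"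
      by (simp add: mult_ac)
  qed
qed

text \<open>A chart describes \<Omega> but not its frontier. A point above the graph lies in the
  open set \<Omega>, and a point below it has, by continuity of \<open>\<gamma>\<close>, a whole
  neighbourhood that avoids \<Omega>. Neither can be a frontier point.\<close>

lemma bdry_chart_frontier_graph:
  assumes "open \<Omega>" "bdry_chart \<Omega> x0 r e \<gamma>" "y \<in> frontier \<Omega>" "y \<in> ball x0 r"
  shows "y \<bullet> e = \<gamma> y"
proof (rule ccontr)
  have c: "continuous_on UNIV \<gamma>"
    using assms(2) Ck_on_imp_continuous_on unfolding bdry_chart_def by blast
  have eq: "ball x0 r \<inter> \<Omega> = {x \<in> ball x0 r. x \<bullet> e > \<gamma> x}"
    using assms(2) unfolding bdry_chart_def by blast
  assume "y \<bullet> e \<noteq> \<gamma> y"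
  then consider "y \<bullet> e > \<gamma> y" | "y \<bullet> e < \<gamma> y" by linarith
  then show False
  proof cases
    case 1
    then have "y \<in> \<Omega>" using eq assms(4) by blast
    then show False using assms(1,3) by (simp add: frontier_def interior_open)
  next
    case 2
    let ?V = "ball x0 r \<inter> {x. x \<bullet> e < \<gamma> x}"
    have "open ?V" by (intro open_Int open_Collect_less continuous_intros c) auto
    moreover have "y \<in> ?V" using 2 assms(4) by auto
    moreover have "y \<in> closure \<Omega>" using assms(3) by (simp add: frontier_def)
    ultimately have "?V \<inter> \<Omega> \<noteq> {}" by (meson open_Int_closure_eq_empty disjoint_iff)
    then obtain z where "z \<in> ball x0 r" "z \<in> \<Omega>" "z \<bullet> e < \<gamma> z" by auto
    then have "z \<in> {x \<in> ball x0 r. x \<bullet> e > \<gamma> x}" using eq by blast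
    with \<open>z \<bullet> e < \<gamma> z\<close> show False by simp
  qed
qed

text \<open>The translates of the strip by multiples of \<open>\<eta> e\<close> are disjoint, and about \<open>1/\<eta>\<close> of them
  fit into a slightly larger ball.\<close>
lemma measure_graph_strip_le:
  fixes e x0 :: "'a::euclidean_space" and \<psi> :: "'a \<Rightarrow> real"
  assumes e: "norm e = 1" and c: "continuous_on UNIV \<psi>"
    and tr: "\<And>x s. \<psi> (x + s *\<^sub>R e) = \<psi> x + s" and \<eta>: "0 < \<eta>" "\<eta> \<le> 1"
  shows "measure lebesgue {x \<in> ball x0 r. 0 < \<psi> x \<and> \<psi> x < \<eta>} \<le> 2 * \<eta> * measure lebesgue (ball x0 (r + 1))"
proof -
  define A where "A = {x \<in> ball x0 r. 0 < \<psi> x \<and> \<psi> x < \<eta>}"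
  define N where "N = nat \<lfloor>1 / \<eta>\<rfloor>"
  define F where "F k = (+) ((real k * \<eta>) *\<^sub>R e) ` A" for k :: nat
  have "open (ball x0 r \<inter> {x. 0 < \<psi> x} \<inter> {x. \<psi> x < \<eta>})"
    by (intro open_Int open_Collect_less continuous_intros c) auto
  moreover have "A = ball x0 r \<inter> {x. 0 < \<psi> x} \<inter> {x. \<psi> x < \<eta>}" by (auto simp: A_def)
  ultimately have oA: "open A" by simp
  have "bounded A" by (rule bounded_subset[of "ball x0 r"]) (auto simp: A_def)
  then have mA: "A \<in> lmeasurable" using oA by (simp add: lmeasurable_open)
  have mF: "F k \<in> lmeasurable" for k
    unfolding F_def using mA by (rule measurable_translation)
  have Fpsi: "real k * \<eta> < \<psi> x \<and> \<psi> x < real (k + 1) * \<eta>" if "x \<in> F k" for x k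
  proof -
    obtain a where a: "a \<in> A" "x = a + (real k * \<eta>) *\<^sub>R e" using \<open>x \<in> F k\<close> by (auto simp: F_def)
    then show ?thesis using tr[of a "real k * \<eta>"] by (auto simp: A_def algebra_simps)
  qed
  have disj: "disjoint_family_on F {..<N}"
  proof (unfold disjoint_family_on_def, intro ballI impI)
    fix m n :: nat assume "m \<noteq> n"
    have "False" if x: "x \<in> F i" "x \<in> F j" and "i < j" for x i j
    proof -
      have "real (i + 1) * \<eta> \<le> real j * \<eta>" using \<open>i < j\<close> \<eta> by (intro mult_right_mono) auto
      then show False using Fpsi[OF x(1)] Fpsi[OF x(2)] by linarith
    qed
    then show "F m \<inter> F n = {}" using \<open>m \<noteq> n\<close> by (metis disjoint_iff linorder_neqE_nat)
  qed
  have Nle: "real N \<le> 1 / \<eta>" using \<eta> by (simp add: N_def)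
  \<comment> \<open>Because \<open>1 / \<eta>\<close> is at least 1, rounding it down loses at most
    a factor 2, which is the 2 in the estimate. Shifts stay below \<open>N * \<eta> \<le> 1\<close>,
    whence the radius \<open>r + 1\<close>.\<close>
  have "1 / \<eta> \<ge> 1" using \<eta> by simp
  then have "1 \<le> \<lfloor>1 / \<eta>\<rfloor>" by simp
  then have "real N = of_int \<lfloor>1 / \<eta>\<rfloor>" "1 \<le> real N"
    unfolding N_def by linarith+
  then have "1 / \<eta> \<le> 2 * real N" using real_of_int_floor_add_one_gt[of "1 / \<eta>"] by linarith
  then have Nge: "real N \<ge> 1 / (2 * \<eta>)" by simp
  have sub: "(\<Union>k<N. F k) \<subseteq> ball x0 (r + 1)"
  proof clarify
    fix x k assume k: "k < N" "x \<in> F k"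
    then obtain a where a: "a \<in> A" "x = (real k * \<eta>) *\<^sub>R e + a" by (auto simp: F_def)
    have "real k * \<eta> \<le> real N * \<eta>" using k \<eta> by simp
    also have "\<dots> \<le> 1" using Nle \<eta> by (simp add: field_simps)
    finally have "norm ((real k * \<eta>) *\<^sub>R e) \<le> 1" using e \<eta> by simp
    moreover have "dist x0 a < r" using a by (auto simp: A_def)
    moreover have "dist x0 x \<le> dist x0 a + norm ((real k * \<eta>) *\<^sub>R e)"
      using a dist_triangle[of x0 x a] by (simp add: dist_norm)
    ultimately show "x \<in> ball x0 (r + 1)" by simp
  qed
  have "real N * measure lebesgue A = (\<Sum>k<N. measure lebesgue (F k))"
    by (simp add: F_def measure_translation)
  also have "\<dots> = measure lebesgue (\<Union>k<N. F k)"
    using mF disj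
    by (intro measure_finite_Union[symmetric]) (auto simp: fmeasurable_def less_top simp del: emeasure_completion)
  also have "\<dots> \<le> measure lebesgue (ball x0 (r + 1))"
    using sub mF by (intro measure_mono_fmeasurable) auto
  finally have "real N * measure lebesgue A \<le> measure lebesgue (ball x0 (r + 1))" .
  moreover have "1 / (2 * \<eta>) * measure lebesgue A \<le> real N * measure lebesgue A"
    using Nge by (intro mult_right_mono) auto
  ultimately have "1 / (2 * \<eta>) * measure lebesgue A \<le> measure lebesgue (ball x0 (r + 1))" by linarith
  then show ?thesis unfolding A_def[symmetric] using \<eta> by (simp add: field_simps)
qed

text \<open>The height \<open>\<psi>\<close> above the graph vanishes at frontier points and is
  Lipschitz with constant \<open>1 + L\<close> on the chart ball. A point of \<Omega> closer than
  \<delta> to such a frontier point therefore lies in the strip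
  \<open>0 < \<psi> < (1 + L) * \<delta>\<close>, whose volume is linear in its thickness. Frontier
  points are taken from the ball of half radius so that their neighbours stay inside the
  chart.\<close>

lemma bdry_chart_layer_measure_le:
  fixes \<Omega> :: "'a::euclidean_space set"
  assumes "open \<Omega>" and ch: "bdry_chart \<Omega> x0 r e \<gamma>"
  shows "\<exists>K d. 0 < d \<and> 0 \<le> K \<and> (\<forall>\<delta>. 0 < \<delta> \<and> \<delta> \<le> d \<longrightarrow>
    {x \<in> \<Omega>. \<exists>y \<in> frontier \<Omega> \<inter> ball x0 (r/2). dist x y < \<delta>} \<in> lmeasurable \<and>
    measure lebesgue {x \<in> \<Omega>. \<exists>y \<in> frontier \<Omega> \<inter> ball x0 (r/2). dist x y < \<delta>} \<le> K * \<delta>)"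
proof -
  have r: "0 < r" and e: "norm e = 1" and C2: "Ck_on 2 UNIV \<gamma>"
    and ind: "\<And>x. \<gamma> x = \<gamma> (x - (x \<bullet> e) *\<^sub>R e)"
    and eq: "ball x0 r \<inter> \<Omega> = {x \<in> ball x0 r. x \<bullet> e > \<gamma> x}"
    using ch unfolding bdry_chart_def by blast+
  have c: "continuous_on UNIV \<gamma>" using C2 by (rule Ck_on_imp_continuous_on)
  have C1: "\<gamma> differentiable_on UNIV" "\<And>b. b \<in> Basis \<Longrightarrow> Ck_on 1 UNIV (\<lambda>x. pd \<gamma> x b)"
    using C2 by (auto simp: numeral_2_eq_2)
  define h where "h x = (\<Sum>b\<in>Basis. \<bar>pd \<gamma> x b\<bar>)" for x
  have "continuous_on (cball x0 r) h" unfolding h_def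
    by (intro continuous_intros) (rule continuous_on_subset[OF Ck_on_imp_continuous_on[OF C1(2)]], auto)
  then have "bounded (h ` cball x0 r)"
    by (intro compact_imp_bounded compact_continuous_image) auto
  then obtain B where B: "\<And>x. x \<in> cball x0 r \<Longrightarrow> \<bar>h x\<bar> \<le> B"
    unfolding bounded_iff by (metis image_eqI real_norm_def)
  have pdB: "norm (pd \<gamma> x b) \<le> B" if "x \<in> cball x0 r" "b \<in> Basis" for x b
  proof -
    have "\<bar>pd \<gamma> x b\<bar> \<le> h x" unfolding h_def using that(2) by (intro member_le_sum) auto
    then show ?thesis using B[OF that(1)] by simp
  qed
  define L where "L = DIM('a) * B"
  have "0 \<le> B" using B[of x0] r by fastforce
  then have L0: "L \<ge> 0" by (simp add: L_def)
  have lip: "\<bar>\<gamma> x - \<gamma> y\<bar> \<le> L * norm (x - y)" if "x \<in> cball x0 r" "y \<in> cball x0 r" for x y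
    using norm_diff_le_pd_bound[of "cball x0 r" \<gamma> B x y] that C1(1) pdB
    by (simp add: L_def differentiable_on_eq_differentiable_at)
  define \<psi> where "\<psi> x = x \<bullet> e - \<gamma> x" for x
  have c\<psi>: "continuous_on UNIV \<psi>" unfolding \<psi>_def by (intro continuous_intros c)
  have ee: "e \<bullet> e = 1" using e by (simp add: norm_eq_1)
  \<comment> \<open>\<open>\<gamma>\<close> ignores the component along \<open>e\<close>, so a shift
    by \<open>s\<close> along \<open>e\<close> changes the height by exactly
    \<open>s\<close>.\<close>
  have tr: "\<psi> (x + s *\<^sub>R e) = \<psi> x + s" for x s
  proof -
    have "x + s *\<^sub>R e - ((x + s *\<^sub>R e) \<bullet> e) *\<^sub>R e = x - (x \<bullet> e) *\<^sub>R e"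
      by (simp add: inner_add_left ee algebra_simps)
    then have "\<gamma> (x + s *\<^sub>R e) = \<gamma> x" using ind[of "x + s *\<^sub>R e"] ind[of x] by metis
    then show ?thesis by (simp add: \<psi>_def inner_add_left ee)
  qed
  define K where "K = 2 * (1 + L) * measure lebesgue (ball x0 (r + 1))"
  \<comment> \<open>The first bound keeps all points within \<delta> of the half ball inside the
    chart ball; the second gives \<open>(1 + L) * \<delta> \<le> 1\<close>, as the strip estimate
    requires.\<close>
  define d where "d = min (r/2) (1 / (1 + L))"
  show ?thesis
  proof (rule exI[of _ K], rule exI[of _ d], intro conjI allI impI)
    show "0 < d" using r L0 by (simp add: d_def)
    show "0 \<le> K" using L0 by (simp add: K_def)
    fix \<delta> assume "0 < \<delta> \<and> \<delta> \<le> d"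
    then have \<delta>: "0 < \<delta>" "\<delta> \<le> r/2" "\<delta> \<le> 1 / (1 + L)" by (auto simp: d_def)
    define \<eta> where "\<eta> = (1 + L) * \<delta>"
    have "0 < 1 + L" using L0 by simp
    then have \<eta>: "0 < \<eta>" "\<eta> \<le> 1" using \<delta> unfolding \<eta>_def
      by (auto simp: pos_le_divide_eq mult.commute)
    let ?S = "{x \<in> \<Omega>. \<exists>y \<in> frontier \<Omega> \<inter> ball x0 (r/2). dist x y < \<delta>}"
    let ?A = "{x \<in> ball x0 r. 0 < \<psi> x \<and> \<psi> x < \<eta>}"
    have "?S = \<Omega> \<inter> (\<Union>y \<in> frontier \<Omega> \<inter> ball x0 (r/2). ball y \<delta>)" by (auto simp: dist_commute)
    then have oS: "open ?S" using \<open>open \<Omega>\<close> by auto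
    have sub: "?S \<subseteq> ?A"
    proof clarify
      fix x y assume x: "x \<in> \<Omega>" and y: "y \<in> frontier \<Omega>" "y \<in> ball x0 (r/2)" "dist x y < \<delta>"
      have xb: "x \<in> ball x0 r"
        using y \<delta> dist_triangle[of x0 x y] by (simp add: dist_commute)
      have yb: "y \<in> ball x0 r" using y r by auto
      have "x \<bullet> e > \<gamma> x" using x xb eq by blast
      then have p: "0 < \<psi> x" by (simp add: \<psi>_def)
      have y0: "y \<bullet> e = \<gamma> y" using bdry_chart_frontier_graph[OF \<open>open \<Omega>\<close> ch y(1) yb] .
      have "\<psi> x = (x - y) \<bullet> e + (\<gamma> y - \<gamma> x)" using y0 by (simp add: \<psi>_def inner_diff_left)
      moreover have "(x - y) \<bullet> e \<le> norm (x - y)" using norm_cauchy_schwarz[of "x - y" e] e by simp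
      moreover have "\<bar>\<gamma> y - \<gamma> x\<bar> \<le> L * norm (x - y)"
        using lip[of y x] xb yb by (auto simp: norm_minus_commute)
      ultimately have "\<psi> x \<le> (1 + L) * norm (x - y)" by (simp add: algebra_simps)
      also have "\<dots> < \<eta>" unfolding \<eta>_def using y(3) L0 by (intro mult_strict_left_mono) (auto simp: dist_norm)
      finally show "x \<in> ball x0 r \<and> 0 < \<psi> x \<and> \<psi> x < \<eta>" using p xb by simp
    qed
    have "open (ball x0 r \<inter> {x. 0 < \<psi> x} \<inter> {x. \<psi> x < \<eta>})"
      by (intro open_Int open_Collect_less continuous_intros c\<psi>) auto
    moreover have "?A = ball x0 r \<inter> {x. 0 < \<psi> x} \<inter> {x. \<psi> x < \<eta>}" by auto
    ultimately have oA: "open ?A" by simp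
    have bA: "bounded ?A" by (rule bounded_subset[of "ball x0 r"]) auto
    have mA: "?A \<in> lmeasurable" using lmeasurable_open[OF bA oA] .
    show mS: "?S \<in> lmeasurable" using lmeasurable_open[OF bounded_subset[OF bA sub] oS] .
    have "measure lebesgue ?S \<le> measure lebesgue ?A"
      using sub mS mA by (intro measure_mono_fmeasurable) auto
    also have "\<dots> \<le> 2 * \<eta> * measure lebesgue (ball x0 (r + 1))"
      by (rule measure_graph_strip_le[OF e c\<psi> tr \<eta>])
    finally show "measure lebesgue ?S \<le> K * \<delta>" by (simp add: K_def \<eta>_def mult_ac)
  qed
qed

lemma open_bl: "open \<Omega> \<Longrightarrow> open (bl \<Omega> \<delta>)"
proof -
  assume "open \<Omega>"
  moreover have "open {x. infdist x (frontier \<Omega>) < \<delta>}"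
    by (intro open_Collect_less continuous_intros)
  moreover have "bl \<Omega> \<delta> = \<Omega> \<inter> {x. infdist x (frontier \<Omega>) < \<delta>}" by (auto simp: bl_def)
  ultimately show ?thesis by auto
qed

text \<open>Compactness of the frontier reduces thin layers to finitely many charts, since each
  point of the layer has a nearest frontier point and that point lies in one of them. The width is
  arbitrary, so wide layers must be covered as well; for them the volume of \<Omega> itself is
  used.\<close>

lemma C2_domain_layer_measure_le:
  assumes "C2_domain \<Omega>"
  shows "\<exists>K\<ge>0. \<forall>\<delta>>0. emeasure lebesgue (bl \<Omega> \<delta>) \<le> ennreal (K * \<delta>)"
proof -
  have \<Omega>: "open \<Omega>" "bounded \<Omega>" "\<Omega> \<noteq> {}"
    and "\<forall>x0\<in>frontier \<Omega>. \<exists>r e \<gamma>. bdry_chart \<Omega> x0 r e \<gamma>"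
    using assms unfolding C2_domain_def by auto
  then obtain r where r: "\<And>x0. x0 \<in> frontier \<Omega> \<Longrightarrow> \<exists>e \<gamma>. bdry_chart \<Omega> x0 (r x0) e \<gamma>"
    by metis
  have rpos: "r x0 > 0" if "x0 \<in> frontier \<Omega>" for x0 using r[OF that] by (auto simp: bdry_chart_def)
  have cF: "compact (frontier \<Omega>)" using \<Omega>(2) by (rule compact_frontier_bounded)
  \<comment> \<open>A nearest frontier point exists only if there is a frontier;
    \<open>infdist\<close> to the empty set is 0 by convention.\<close>
  have neF: "frontier \<Omega> \<noteq> {}"
    using \<Omega> by (metis frontier_eq_empty not_bounded_UNIV)
  define S where "S x0 \<delta> = {x \<in> \<Omega>. \<exists>y \<in> frontier \<Omega> \<inter> ball x0 (r x0/2). dist x y < \<delta>}" for x0 \<delta>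
  have "\<exists>K d. 0 < d \<and> 0 \<le> K \<and> (\<forall>\<delta>. 0 < \<delta> \<and> \<delta> \<le> d \<longrightarrow> S x0 \<delta> \<in> lmeasurable \<and> measure lebesgue (S x0 \<delta>) \<le> K * \<delta>)"
    if "x0 \<in> frontier \<Omega>" for x0
    using r[OF that] bdry_chart_layer_measure_le[OF \<Omega>(1)] unfolding S_def by blast
  then obtain K d where Kd: "\<And>x0. x0 \<in> frontier \<Omega> \<Longrightarrow> 0 < d x0 \<and> 0 \<le> K x0 \<and>
     (\<forall>\<delta>. 0 < \<delta> \<and> \<delta> \<le> d x0 \<longrightarrow> S x0 \<delta> \<in> lmeasurable \<and> measure lebesgue (S x0 \<delta>) \<le> K x0 * \<delta>)"
    by metis
  have "frontier \<Omega> \<subseteq> (\<Union>x0\<in>frontier \<Omega>. ball x0 (r x0/2))" using rpos by force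
  then obtain I where I: "I \<subseteq> frontier \<Omega>" "finite I" "frontier \<Omega> \<subseteq> (\<Union>x0\<in>I. ball x0 (r x0/2))"
    using compactE_image[OF cF, of "frontier \<Omega>" "\<lambda>x0. ball x0 (r x0/2)"] by auto
  have Ine: "I \<noteq> {}" using I neF by auto
  define d0 where "d0 = Min (d ` I)"
  have d0: "d0 > 0" "\<And>i. i \<in> I \<Longrightarrow> d0 \<le> d i"
    using I Ine Kd by (auto simp: d0_def)
  \<comment> \<open>The second entry serves widths above \<open>d0\<close>: there the volume of
    \<Omega> is \<open>(measure lebesgue \<Omega> / d0) * d0\<close>, at most that quotient times
    \<delta>.\<close>
  define K0 where "K0 = max (\<Sum>i\<in>I. K i) (measure lebesgue \<Omega> / d0)"
  have m\<Omega>: "\<Omega> \<in> lmeasurable" using \<Omega> by (simp add: lmeasurable_open)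
  have bl\<Omega>: "bl \<Omega> \<delta> \<subseteq> \<Omega>" for \<delta> by (auto simp: bl_def)
  have mbl: "bl \<Omega> \<delta> \<in> lmeasurable" for \<delta>
    using lmeasurable_open[OF bounded_subset[OF \<Omega>(2) bl\<Omega>] open_bl[OF \<Omega>(1)]] .
  show ?thesis
  proof (intro exI[of _ K0] conjI allI impI)
    show "0 \<le> K0" unfolding K0_def using Kd I by (intro max.coboundedI1 sum_nonneg) auto
    fix \<delta> :: real assume \<delta>: "\<delta> > 0"
    have "measure lebesgue (bl \<Omega> \<delta>) \<le> K0 * \<delta>"
    proof (cases "\<delta> \<le> d0")
      case True
      have mS: "S i \<delta> \<in> lmeasurable" "measure lebesgue (S i \<delta>) \<le> K i * \<delta>" if "i \<in> I" for i
      proof -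
        have "\<delta> \<le> d i" using d0(2)[OF that] True by linarith
        then show "S i \<delta> \<in> lmeasurable" "measure lebesgue (S i \<delta>) \<le> K i * \<delta>"
          using Kd[of i] I(1) that \<delta> by auto
      qed
      have "bl \<Omega> \<delta> \<subseteq> (\<Union>i\<in>I. S i \<delta>)"
      proof
        fix x assume "x \<in> bl \<Omega> \<delta>"
        then have x: "x \<in> \<Omega>" "infdist x (frontier \<Omega>) < \<delta>" by (auto simp: bl_def)
        obtain y where y: "y \<in> frontier \<Omega>" "infdist x (frontier \<Omega>) = dist x y"
          using infdist_attains_inf[OF frontier_closed neF] by blast
        then obtain i where "i \<in> I" "y \<in> ball i (r i/2)" using I(3) by blast
        then have "x \<in> S i \<delta>" unfolding S_def using x y by auto
        then show "x \<in> (\<Union>i\<in>I. S i \<delta>)" using \<open>i \<in> I\<close> by blast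
      qed
      then have "measure lebesgue (bl \<Omega> \<delta>) \<le> measure lebesgue (\<Union>i\<in>I. S i \<delta>)"
        using mbl mS I(2) by (intro measure_mono_fmeasurable fmeasurable.finite_UN) auto
      also have "\<dots> \<le> (\<Sum>i\<in>I. measure lebesgue (S i \<delta>))"
        using mS I(2) by (intro measure_UNION_le) auto
      also have "\<dots> \<le> (\<Sum>i\<in>I. K i * \<delta>)" using mS by (intro sum_mono) auto
      also have "\<dots> \<le> K0 * \<delta>" unfolding sum_distrib_right[symmetric] K0_def
        using \<delta> by (intro mult_right_mono) auto
      finally show ?thesis .
    next
      case False
      have "measure lebesgue (bl \<Omega> \<delta>) \<le> measure lebesgue \<Omega>"
        using bl\<Omega> mbl m\<Omega> by (intro measure_mono_fmeasurable) auto
      also have "\<dots> = (measure lebesgue \<Omega> / d0) * d0" using d0 by simp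
      also have "\<dots> \<le> K0 * \<delta>" unfolding K0_def using False d0 \<delta>
        by (intro mult_mono) (auto simp: le_max_iff_disj)
      finally show ?thesis .
    qed
    then show "emeasure lebesgue (bl \<Omega> \<delta>) \<le> ennreal (K0 * \<delta>)"
      using mbl by (simp add: emeasure_eq_measure2 ennreal_leI)
  qed
qed

section \<open>Square integrability and Tonelli's theorem for Lebesgue measure\<close>

text \<open>Unlike in \<open>in_L2\<close>, measurability is asked on \<open>S\<close> only: the
  Euler velocity and the pressure gradient are controlled on \<Omega>, and their values elsewhere
  are arbitrary.\<close>

definition L2_on :: "'a::euclidean_space set \<Rightarrow> ('a \<Rightarrow> 'b::euclidean_space) \<Rightarrow> bool" where
  "L2_on S g \<longleftrightarrow> set_borel_measurable lebesgue S g \<and> L2sq_enn S g < \<infinity>"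

lemma in_L2_imp_L2_on:
  "in_L2 S g \<Longrightarrow> S \<in> sets lebesgue \<Longrightarrow> L2_on S g"
  unfolding L2_on_def in_L2_def set_borel_measurable_def by auto

lemma L2sq_enn_alt:
  "L2sq_enn S g = (\<integral>\<^sup>+x. ennreal ((norm (indicat_real S x *\<^sub>R g x))\<^sup>2) \<partial>lebesgue)"
  unfolding L2sq_enn_def by (intro nn_integral_cong) (auto simp: indicator_def)

lemma L2sq_nonneg: "0 \<le> L2sq S g"
  by (simp add: L2sq_def)

lemma L2_on_enn: "L2_on S g \<Longrightarrow> L2sq_enn S g = ennreal (L2sq S g)"
  unfolding L2_on_def L2sq_def by simp

lemma L2_on_integrable:
  assumes "L2_on S g"
  shows "set_integrable lebesgue S (\<lambda>x. (norm (g x))\<^sup>2)"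
    and "L2sq S g = (LINT x:S|lebesgue. (norm (g x))\<^sup>2)"
proof -
  have m: "(\<lambda>x. indicat_real S x *\<^sub>R g x) \<in> borel_measurable lebesgue"
    and fin: "L2sq_enn S g < \<infinity>" using assms by (auto simp: L2_on_def set_borel_measurable_def)
  have eq: "(\<lambda>x. indicat_real S x *\<^sub>R (norm (g x))\<^sup>2) = (\<lambda>x. (norm (indicat_real S x *\<^sub>R g x))\<^sup>2)"
    by (auto simp: indicator_def)
  show "set_integrable lebesgue S (\<lambda>x. (norm (g x))\<^sup>2)"
    unfolding set_integrable_def eq
  proof (rule integrableI_nonneg)
    show "(\<lambda>x. (norm (indicat_real S x *\<^sub>R g x))\<^sup>2) \<in> borel_measurable lebesgue"
      by (intro borel_measurable_power measurable_compose[OF m borel_measurable_norm])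
    show "(\<integral>\<^sup>+x. ennreal ((norm (indicat_real S x *\<^sub>R g x))\<^sup>2) \<partial>lebesgue) < \<infinity>"
      using fin unfolding L2sq_enn_alt .
  qed auto
  show "L2sq S g = (LINT x:S|lebesgue. (norm (g x))\<^sup>2)"
    unfolding set_lebesgue_integral_def eq L2sq_def L2sq_enn_alt
    by (intro integral_eq_nn_integral[symmetric] borel_measurable_power
        measurable_compose[OF m borel_measurable_norm]) auto
qed

lemma L2_onI:
  assumes "set_borel_measurable lebesgue S g" "set_integrable lebesgue S h"
    and le: "\<And>x. x \<in> S \<Longrightarrow> (norm (g x))\<^sup>2 \<le> h x"
  shows "L2_on S g"
proof -
  have m: "(\<lambda>x. indicat_real S x *\<^sub>R g x) \<in> borel_measurable lebesgue"
    using assms by (auto simp: set_borel_measurable_def)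
  have "integrable lebesgue (\<lambda>x. (norm (indicat_real S x *\<^sub>R g x))\<^sup>2)"
  proof (rule Bochner_Integration.integrable_bound[OF assms(2)[unfolded set_integrable_def]])
    show "(\<lambda>x. (norm (indicat_real S x *\<^sub>R g x))\<^sup>2) \<in> borel_measurable lebesgue"
      by (intro borel_measurable_power measurable_compose[OF m borel_measurable_norm])
  qed (auto simp: indicator_def order_trans[OF le abs_ge_self])
  then have "L2sq_enn S g < \<infinity>" unfolding L2sq_enn_alt
    by (simp add: integrable_iff_bounded)
  then show ?thesis using assms(1) by (simp add: L2_on_def)
qed

lemma L2_on_diff:
  assumes "L2_on S f" "L2_on S g"
  shows "L2_on S (\<lambda>x. f x - g x)"
proof (rule L2_onI)
  show "set_borel_measurable lebesgue S (\<lambda>x. f x - g x)"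
    using assms unfolding L2_on_def set_borel_measurable_def by (auto simp: scaleR_diff_right)
  show "set_integrable lebesgue S (\<lambda>x. 2 * (norm (f x))\<^sup>2 + 2 * (norm (g x))\<^sup>2)"
    using L2_on_integrable(1)[OF assms(1)] L2_on_integrable(1)[OF assms(2)] by (intro set_integral_add) auto
  fix x
  have "(norm (f x - g x))\<^sup>2 \<le> (norm (f x) + norm (g x))\<^sup>2"
    by (intro power_mono norm_triangle_ineq4) auto
  also have "\<dots> \<le> 2 * (norm (f x))\<^sup>2 + 2 * (norm (g x))\<^sup>2"
    using sum_squares_ge_zero[of "norm (f x) - norm (g x)" 0] by (simp add: power2_eq_square algebra_simps)
  finally show "(norm (f x - g x))\<^sup>2 \<le> 2 * (norm (f x))\<^sup>2 + 2 * (norm (g x))\<^sup>2" .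
qed

lemma L2_on_bounded:
  assumes "set_borel_measurable lebesgue S g" "S \<in> lmeasurable"
    and "\<And>x. x \<in> S \<Longrightarrow> norm (g x) \<le> B"
  shows "L2_on S g"
proof (rule L2_onI[OF assms(1)])
  show "set_integrable lebesgue S (\<lambda>x. B\<^sup>2)"
    using assms(2) unfolding set_integrable_def real_scaleR_def
    by (intro integrable_mult_left integrable_real_indicator) (auto simp: fmeasurable_def)
qed (use assms(3) in \<open>auto intro: power_mono\<close>)

lemma L2_on_inner_integrable:
  assumes "L2_on S f" "L2_on S g"
  shows "set_integrable lebesgue S (\<lambda>x. f x \<bullet> g x)"
proof -
  have m: "(\<lambda>x. indicat_real S x *\<^sub>R f x) \<in> borel_measurable lebesgue"
     "(\<lambda>x. indicat_real S x *\<^sub>R g x) \<in> borel_measurable lebesgue"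
    using assms by (auto simp: L2_on_def set_borel_measurable_def)
  have eq: "(\<lambda>x. indicat_real S x *\<^sub>R (f x \<bullet> g x)) = (\<lambda>x. (indicat_real S x *\<^sub>R f x) \<bullet> (indicat_real S x *\<^sub>R g x))"
    by (auto simp: indicator_def)
  have int: "set_integrable lebesgue S (\<lambda>x. (norm (f x))\<^sup>2 + (norm (g x))\<^sup>2)"
    using L2_on_integrable(1)[OF assms(1)] L2_on_integrable(1)[OF assms(2)] by (intro set_integral_add) auto
  have le: "\<bar>f x \<bullet> g x\<bar> \<le> (norm (f x))\<^sup>2 + (norm (g x))\<^sup>2" for x
  proof -
    have "\<bar>f x \<bullet> g x\<bar> \<le> norm (f x) * norm (g x)" by (rule Cauchy_Schwarz_ineq2)
    also have "2 * \<dots> \<le> (norm (f x))\<^sup>2 + (norm (g x))\<^sup>2"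
      using sum_squares_ge_zero[of "norm (f x) - norm (g x)" 0] by (simp add: power2_eq_square algebra_simps)
    finally show ?thesis
      by (smt (verit) mult_nonneg_nonneg norm_ge_zero)
  qed
  show ?thesis
    unfolding set_integrable_def
  proof (rule Bochner_Integration.integrable_bound[OF int[unfolded set_integrable_def]])
    show "(\<lambda>x. indicat_real S x *\<^sub>R (f x \<bullet> g x)) \<in> borel_measurable lebesgue"
      unfolding eq using m by (rule borel_measurable_inner)
  qed (use le in \<open>auto simp: indicator_def\<close>)
qed

lemma L2_Cauchy_Schwarz:
  assumes "L2_on S f" "L2_on S g"
  shows "\<bar>LINT x:S|lebesgue. f x \<bullet> g x\<bar> \<le> sqrt (L2sq S f) * sqrt (L2sq S g)"
proof -
  let ?F = "\<lambda>x. indicat_real S x *\<^sub>R f x" and ?G = "\<lambda>x. indicat_real S x *\<^sub>R g x"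
  have m: "?F \<in> borel_measurable lebesgue" "?G \<in> borel_measurable lebesgue"
    using assms by (auto simp: L2_on_def set_borel_measurable_def)
  have "ennreal \<bar>LINT x:S|lebesgue. f x \<bullet> g x\<bar> = ennreal (norm (LINT x:S|lebesgue. f x \<bullet> g x))" by simp
  also have "\<dots> \<le> (\<integral>\<^sup>+x. ennreal (norm (indicat_real S x *\<^sub>R (f x \<bullet> g x))) \<partial>lebesgue)"
    unfolding set_lebesgue_integral_def
    using L2_on_inner_integrable[OF assms] unfolding set_integrable_def
    by (rule integral_norm_bound_ennreal)
  also have "\<dots> \<le> (\<integral>\<^sup>+x. ennreal (norm (?F x)) * ennreal (norm (?G x)) \<partial>lebesgue)"
    by (intro nn_integral_mono)
      (auto simp: indicator_def Cauchy_Schwarz_ineq2 simp flip: ennreal_mult)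
  finally have "(ennreal \<bar>LINT x:S|lebesgue. f x \<bullet> g x\<bar>)\<^sup>2 \<le> (\<integral>\<^sup>+x. ennreal (norm (?F x)) * ennreal (norm (?G x)) \<partial>lebesgue)\<^sup>2"
    by (rule power_mono) simp
  also have "\<dots> \<le> (\<integral>\<^sup>+x. (ennreal (norm (?F x)))\<^sup>2 \<partial>lebesgue) * (\<integral>\<^sup>+x. (ennreal (norm (?G x)))\<^sup>2 \<partial>lebesgue)"
    using m by (intro Cauchy_Schwarz_nn_integral measurable_compose[OF _ measurable_ennreal]
        measurable_compose[OF _ borel_measurable_norm])
  also have "\<dots> = L2sq_enn S f * L2sq_enn S g"
    unfolding L2sq_enn_alt by (simp only: ennreal_power norm_ge_zero)
  also have "\<dots> = ennreal (L2sq S f * L2sq S g)"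
    by (simp add: L2_on_enn assms ennreal_mult L2sq_nonneg)
  finally have "\<bar>LINT x:S|lebesgue. f x \<bullet> g x\<bar>\<^sup>2 \<le> L2sq S f * L2sq S g"
    by (simp add: ennreal_power L2sq_nonneg)
  then show ?thesis
    by (metis real_le_rsqrt real_sqrt_mult)
qed

lemma L2_tendsto_inner:
  assumes f: "\<And>n. L2_on S (f n)" and g: "L2_on S g" and h: "L2_on S h"
    and lim: "(\<lambda>n::nat. L2sq S (\<lambda>x. f n x - g x)) \<longlonglongrightarrow> 0"
  shows "(\<lambda>n. LINT x:S|lebesgue. f n x \<bullet> h x) \<longlonglongrightarrow> (LINT x:S|lebesgue. g x \<bullet> h x)"
proof -
  have "(\<lambda>n. (LINT x:S|lebesgue. f n x \<bullet> h x) - (LINT x:S|lebesgue. g x \<bullet> h x)) \<longlonglongrightarrow> 0"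
  proof (rule Lim_null_comparison)
    show "(\<lambda>n. sqrt (L2sq S (\<lambda>x. f n x - g x)) * sqrt (L2sq S h)) \<longlonglongrightarrow> 0"
      using tendsto_mult_left_zero[OF tendsto_real_sqrt[OF lim, simplified]] by simp
    have "(LINT x:S|lebesgue. f n x \<bullet> h x) - (LINT x:S|lebesgue. g x \<bullet> h x)
        = (LINT x:S|lebesgue. (f n x - g x) \<bullet> h x)" for n
      unfolding inner_diff_left using f g h by (subst set_integral_diff) (auto intro: L2_on_inner_integrable)
    then show "\<forall>\<^sub>F n in sequentially. norm ((LINT x:S|lebesgue. f n x \<bullet> h x) - (LINT x:S|lebesgue. g x \<bullet> h x))
      \<le> sqrt (L2sq S (\<lambda>x. f n x - g x)) * sqrt (L2sq S h)"
      using L2_Cauchy_Schwarz[OF L2_on_diff[OF f g] h] by simp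
  qed
  then show ?thesis by (rule LIM_zero_cancel)
qed

lemma ennreal_le_of_power2_le: "X\<^sup>2 \<le> ennreal (c\<^sup>2) \<Longrightarrow> 0 \<le> c \<Longrightarrow> X \<le> ennreal c"
  by (cases X) (auto simp: ennreal_power power2_le_iff_abs_le top_unique)

text \<open>This is Cauchy-Schwarz against the indicator of \<open>S\<close>. The factor
  \<open>emeasure M S\<close> is what brings the volume of the layer, and with it the power of
  \<delta>, into the vorticity estimate.\<close>

lemma nn_integral_power2_le:
  assumes "w \<in> borel_measurable M" "S \<in> sets M"
  shows "(\<integral>\<^sup>+x\<in>S. w x \<partial>M)\<^sup>2 \<le> emeasure M S * (\<integral>\<^sup>+x\<in>S. (w x)\<^sup>2 \<partial>M)"
proof -
  have "(\<integral>\<^sup>+x\<in>S. w x \<partial>M)\<^sup>2 = (\<integral>\<^sup>+x. indicator S x * (w x * indicator S x) \<partial>M)\<^sup>2"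
    by (intro arg_cong[where f="\<lambda>z. z\<^sup>2"] nn_integral_cong) (auto simp: indicator_def)
  also have "\<dots> \<le> (\<integral>\<^sup>+x. (indicator S x)\<^sup>2 \<partial>M) * (\<integral>\<^sup>+x. (w x * indicator S x)\<^sup>2 \<partial>M)"
    using assms by (intro Cauchy_Schwarz_nn_integral) auto
  also have "(\<integral>\<^sup>+x. (indicator S x)\<^sup>2 \<partial>M) = (\<integral>\<^sup>+x. indicator S x \<partial>M)"
    by (intro nn_integral_cong) (auto simp: indicator_def)
  also have "\<dots> = emeasure M S" using assms by simp
  also have "(\<integral>\<^sup>+x. (w x * indicator S x)\<^sup>2 \<partial>M) = (\<integral>\<^sup>+x\<in>S. (w x)\<^sup>2 \<partial>M)"
    by (intro nn_integral_cong) (auto simp: indicator_def)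
  finally show ?thesis .
qed

section \<open>Lebesgue measure on a product, and integrals over space-time cylinders\<close>

lemma borel_measurable_lebesgue_cong_AE:
  assumes f: "f \<in> borel_measurable lebesgue" and ae: "AE x in lebesgue. f x = g x"
  shows "g \<in> borel_measurable lebesgue"
proof (rule measurableI)
  fix A :: "'b set" assume "A \<in> sets borel"
  then have "f -` A \<inter> space lebesgue \<in> sets lebesgue" using f by (rule measurable_sets[rotated])
  moreover have "AE x in lebesgue. x \<in> f -` A \<inter> space lebesgue \<longleftrightarrow> x \<in> g -` A \<inter> space lebesgue"
    using ae by eventually_elim auto
  ultimately show "g -` A \<inter> space lebesgue \<in> sets lebesgue"
    using completion.in_sets_AE by blast
qed simp

text \<open>Lebesgue measure is the completion of the product of the Borel-Lebesgue measures, so sections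
  of a measurable function are only almost everywhere measurable.\<close>
lemma lebesgue_prod_Tonelli:
  fixes h :: "'a::euclidean_space \<times> 'b::euclidean_space \<Rightarrow> ennreal"
  assumes "h \<in> borel_measurable lebesgue"
  shows "AE t in lebesgue. (\<lambda>x. h (t, x)) \<in> borel_measurable lebesgue"
    and "(\<lambda>t. \<integral>\<^sup>+x. h (t, x) \<partial>lebesgue) \<in> borel_measurable lebesgue"
    and "(\<integral>\<^sup>+z. h z \<partial>lebesgue) = (\<integral>\<^sup>+t. \<integral>\<^sup>+x. h (t, x) \<partial>lebesgue \<partial>lebesgue)"
proof -
  \<comment> \<open>A Borel representative is measurable for the product sigma-algebra, where
    Tonelli's theorem applies, and on almost every section it agrees with \<open>h\<close> almost
    everywhere.\<close>
  obtain h' where h': "h' \<in> borel_measurable lborel" and ae: "AE z in lborel. h z = h' z"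
    using completion_ex_borel_measurable[OF assms] by auto
  have m2: "h' \<in> borel_measurable (lborel \<Otimes>\<^sub>M lborel)" using h' by (simp add: lborel_prod)
  have "AE z in lborel \<Otimes>\<^sub>M lborel. h z = h' z" using ae unfolding lborel_prod .
  then have ae2: "AE t in lborel. AE x in lborel. h (t, x) = h' (t, x)" by (rule lborel_pair.AE_pair)
  have sec: "(\<lambda>x. h (t, x)) \<in> borel_measurable lebesgue"
    if "AE x in lborel. h (t, x) = h' (t, x)" for t
  proof -
    have "(\<lambda>x. h' (t, x)) \<in> borel_measurable lborel" using m2 by measurable
    then have m: "(\<lambda>x. h' (t, x)) \<in> borel_measurable lebesgue" by (rule measurable_completion)
    have "AE x in lebesgue. h' (t, x) = h (t, x)"
      using AE_completion[OF that] by eventually_elim simp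
    then show ?thesis by (rule borel_measurable_lebesgue_cong_AE[OF m])
  qed
  show "AE t in lebesgue. (\<lambda>x. h (t, x)) \<in> borel_measurable lebesgue"
    using AE_completion[OF ae2] by eventually_elim (rule sec)
  have eqi: "AE t in lborel. (\<integral>\<^sup>+x. h (t, x) \<partial>lebesgue) = (\<integral>\<^sup>+x. h' (t, x) \<partial>lborel)"
    using ae2 by eventually_elim (simp add: nn_integral_completion cong: nn_integral_cong_AE)
  have mi: "(\<lambda>t. \<integral>\<^sup>+x. h' (t, x) \<partial>lborel) \<in> borel_measurable lborel" using m2 by measurable
  show "(\<lambda>t. \<integral>\<^sup>+x. h (t, x) \<partial>lebesgue) \<in> borel_measurable lebesgue"
  proof (rule borel_measurable_lebesgue_cong_AE[OF measurable_completion[OF mi]])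
    show "AE t in lebesgue. (\<integral>\<^sup>+x. h' (t, x) \<partial>lborel) = (\<integral>\<^sup>+x. h (t, x) \<partial>lebesgue)"
      using AE_completion[OF eqi] by eventually_elim simp
  qed
  have "(\<integral>\<^sup>+z. h z \<partial>lebesgue) = (\<integral>\<^sup>+z. h' z \<partial>lborel)"
    unfolding nn_integral_completion using ae by (rule nn_integral_cong_AE)
  also have "\<dots> = (\<integral>\<^sup>+z. h' z \<partial>(lborel \<Otimes>\<^sub>M lborel))" by (simp add: lborel_prod)
  also have "\<dots> = (\<integral>\<^sup>+t. \<integral>\<^sup>+x. h' (t, x) \<partial>lborel \<partial>lborel)"
    by (rule lborel.nn_integral_fst[OF m2, symmetric])
  also have "\<dots> = (\<integral>\<^sup>+t. \<integral>\<^sup>+x. h (t, x) \<partial>lebesgue \<partial>lborel)"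
    using eqi by (intro nn_integral_cong_AE) auto
  finally show "(\<integral>\<^sup>+z. h z \<partial>lebesgue) = (\<integral>\<^sup>+t. \<integral>\<^sup>+x. h (t, x) \<partial>lebesgue \<partial>lebesgue)"
    by (simp add: nn_integral_completion)
qed

text \<open>Cauchy-Schwarz on each time slice turns a uniform L2 bound into an L1 bound over the
  cylinder. The slice bound is asked at almost every time, which is all that closeness in the
  essential supremum provides. Measurability is asked of the product with the indicator because the
  Euler velocity is controlled only inside the cylinder.\<close>

lemma nn_integral_time_space_le:
  fixes g :: "real \<Rightarrow> 'a::euclidean_space \<Rightarrow> 'b::euclidean_space"
  assumes m: "(\<lambda>z. indicator ({0..t} \<times> S) z * ennreal (norm (g (fst z) (snd z)))) \<in> borel_measurable lebesgue"
    and S: "S \<in> lmeasurable" and t: "0 \<le> t" and K: "0 \<le> K"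
    and ae: "AE s in lebesgue. s \<in> {0..t} \<longrightarrow> L2sq_enn S (g s) \<le> ennreal (K\<^sup>2)"
  shows "(\<integral>\<^sup>+z. indicator ({0..t} \<times> S) z * ennreal (norm (g (fst z) (snd z))) \<partial>lebesgue)
    \<le> ennreal (K * sqrt (measure lebesgue S) * t)"
proof -
  let ?G = "\<lambda>z. indicator ({0..t} \<times> S) z * ennreal (norm (g (fst z) (snd z)))"
  let ?c = "sqrt (measure lebesgue S)"
  have inner: "(\<integral>\<^sup>+x. ?G (s, x) \<partial>lebesgue) \<le> ennreal (K * ?c) * indicator {0..t} s"
    if ms: "(\<lambda>x. ?G (s, x)) \<in> borel_measurable lebesgue"
      and l2: "s \<in> {0..t} \<longrightarrow> L2sq_enn S (g s) \<le> ennreal (K\<^sup>2)" for s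
  proof (cases "s \<in> {0..t}")
    case True
    have "(\<integral>\<^sup>+x. ?G (s, x) \<partial>lebesgue)\<^sup>2 = (\<integral>\<^sup>+x\<in>S. ?G (s, x) \<partial>lebesgue)\<^sup>2"
      by (intro arg_cong[where f="\<lambda>z. z\<^sup>2"] nn_integral_cong) (auto simp: indicator_def)
    also have "\<dots> \<le> emeasure lebesgue S * (\<integral>\<^sup>+x\<in>S. (?G (s, x))\<^sup>2 \<partial>lebesgue)"
      using S by (intro nn_integral_power2_le ms) auto
    also have "(\<integral>\<^sup>+x\<in>S. (?G (s, x))\<^sup>2 \<partial>lebesgue) = L2sq_enn S (g s)"
      unfolding L2sq_enn_def using True by (intro nn_integral_cong) (auto simp: indicator_def ennreal_power)
    also have "\<dots> \<le> ennreal (K\<^sup>2)" using l2 True by simp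
    also have "emeasure lebesgue S = ennreal (measure lebesgue S)" using S by (simp add: emeasure_eq_measure2)
    also have "ennreal (measure lebesgue S) * ennreal (K\<^sup>2) = ennreal ((K * ?c)\<^sup>2)"
      by (simp add: power_mult_distrib mult.commute flip: ennreal_mult)
    finally have "(\<integral>\<^sup>+x. ?G (s, x) \<partial>lebesgue)\<^sup>2 \<le> ennreal ((K * ?c)\<^sup>2)" by (simp add: mult_left_mono)
    then show ?thesis using True K by (simp add: ennreal_le_of_power2_le)
  next
    case False
    then have "(\<integral>\<^sup>+x. ?G (s, x) \<partial>lebesgue) = (\<integral>\<^sup>+(x::'a). 0 \<partial>lebesgue)"
      by (intro nn_integral_cong) auto
    then show ?thesis by simp
  qed
  have inner_AE: "AE s in lebesgue. (\<integral>\<^sup>+x. ?G (s, x) \<partial>lebesgue) \<le> ennreal (K * ?c) * indicator {0..t} s"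
    using lebesgue_prod_Tonelli(1)[OF m] ae by eventually_elim (rule inner)
  have "(\<integral>\<^sup>+z. ?G z \<partial>lebesgue) = (\<integral>\<^sup>+s. \<integral>\<^sup>+x. ?G (s, x) \<partial>lebesgue \<partial>lebesgue)"
    using m by (rule lebesgue_prod_Tonelli)
  also have "\<dots> \<le> (\<integral>\<^sup>+s. ennreal (K * ?c) * indicator {0..t} s \<partial>lebesgue)"
    by (rule nn_integral_mono_AE[OF inner_AE])
  also have "\<dots> = ennreal (K * ?c) * ennreal t"
    using t by (subst nn_integral_cmult_indicator) auto
  also have "\<dots> = ennreal (K * ?c * t)"
    using K t by (simp flip: ennreal_mult)
  finally show ?thesis .
qed

lemma time_space_work_le:
  fixes g :: "real \<Rightarrow> 'a::euclidean_space \<Rightarrow> 'b::euclidean_space"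
  assumes m: "(\<lambda>z. indicator ({0..t} \<times> S) z * ennreal (norm (g (fst z) (snd z)))) \<in> borel_measurable lebesgue"
    and S: "S \<in> lmeasurable" and t: "0 \<le> t" and F: "0 \<le> F" and K: "0 \<le> K"
    and le: "\<And>s x. s \<in> {0..t} \<Longrightarrow> x \<in> S \<Longrightarrow> \<bar>h (s, x)\<bar> \<le> F * norm (g s x)"
    and ae: "AE s in lebesgue. s \<in> {0..t} \<longrightarrow> L2sq_enn S (g s) \<le> ennreal (K\<^sup>2)"
  shows abs_LINT_time_space_le: "\<bar>LINT z:({0..t} \<times> S)|lebesgue. h z\<bar> \<le> F * K * sqrt (measure lebesgue S) * t"
    and set_integrable_time_space: "set_borel_measurable lebesgue ({0..t} \<times> S) h \<Longrightarrow> set_integrable lebesgue ({0..t} \<times> S) h"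
proof -
  let ?G = "\<lambda>z. indicator ({0..t} \<times> S) z * ennreal (norm (g (fst z) (snd z)))"
  let ?c = "sqrt (measure lebesgue S)"
  have "(\<integral>\<^sup>+z. ennreal (norm (indicat_real ({0..t} \<times> S) z *\<^sub>R h z)) \<partial>lebesgue) \<le> (\<integral>\<^sup>+z. ennreal F * ?G z \<partial>lebesgue)"
    using F by (intro nn_integral_mono) (auto simp: indicator_def le simp flip: ennreal_mult)
  also have "\<dots> = ennreal F * (\<integral>\<^sup>+z. ?G z \<partial>lebesgue)" using m by (rule nn_integral_cmult)
  also have "\<dots> \<le> ennreal F * ennreal (K * ?c * t)"
    by (rule mult_left_mono[OF nn_integral_time_space_le[OF m S t K ae]]) simp
  also have "\<dots> = ennreal (F * K * ?c * t)"
    using F K t by (simp add: mult.assoc flip: ennreal_mult)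
  finally have nn: "(\<integral>\<^sup>+z. ennreal (norm (indicat_real ({0..t} \<times> S) z *\<^sub>R h z)) \<partial>lebesgue) \<le> ennreal (F * K * ?c * t)" .
  show "set_integrable lebesgue ({0..t} \<times> S) h" if "set_borel_measurable lebesgue ({0..t} \<times> S) h"
    using that nn unfolding set_integrable_def set_borel_measurable_def integrable_iff_bounded
    by (auto intro: order_le_less_trans)
  show "\<bar>LINT z:({0..t} \<times> S)|lebesgue. h z\<bar> \<le> F * K * ?c * t"
  proof (cases "set_integrable lebesgue ({0..t} \<times> S) h")
    \<comment> \<open>A function that is not integrable has Bochner integral 0, so the bound is
      trivial here. The estimate thus covers every \<open>h\<close> with the pointwise bound, and
      the Navier-Stokes energy bound can work from a pointwise bound on the force alone.\<close>
    case False
    then show ?thesis unfolding set_integrable_def set_lebesgue_integral_def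
      using t F K by (simp add: not_integrable_integral_eq)
  next
    case True
    then have "ennreal (norm (LINT z:({0..t} \<times> S)|lebesgue. h z)) \<le> ennreal (F * K * ?c * t)"
      unfolding set_lebesgue_integral_def set_integrable_def
      by (intro order_trans[OF integral_norm_bound_ennreal nn])
    then show ?thesis using F K t by simp
  qed
qed

section \<open>Derivatives of compactly supported functions\<close>

lemma pd_bounded_linear:
  assumes "bounded_linear L" "f differentiable (at x)"
  shows "pd (\<lambda>x. L (f x)) x b = L (pd f x b)"
proof -
  have "((\<lambda>x. L (f x)) has_derivative (\<lambda>h. L (frechet_derivative f (at x) h))) (at x)"
    by (rule bounded_linear.has_derivative[OF assms(1)]) (use assms(2) in \<open>simp add: frechet_derivative_works\<close>)
  from frechet_derivative_at[OF this, symmetric] show ?thesis by (simp add: pd_def)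
qed

lemma pd_add:
  assumes "f differentiable (at x)" "g differentiable (at x)"
  shows "pd (\<lambda>x. f x + g x) x b = pd f x b + pd g x b"
proof -
  have "((\<lambda>x. f x + g x) has_derivative (\<lambda>h. frechet_derivative f (at x) h + frechet_derivative g (at x) h)) (at x)"
    using assms by (intro has_derivative_add) (auto simp: frechet_derivative_works)
  from frechet_derivative_at[OF this, symmetric] show ?thesis by (simp add: pd_def)
qed

lemma pd_mult:
  fixes f g :: "'a::euclidean_space \<Rightarrow> real"
  assumes "f differentiable (at x)" "g differentiable (at x)"
  shows "pd (\<lambda>x. f x * g x) x b = f x * pd g x b + pd f x b * g x"
proof -
  have "((\<lambda>x. f x * g x) has_derivative (\<lambda>h. f x * frechet_derivative g (at x) h + frechet_derivative f (at x) h * g x)) (at x)"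
    using assms by (intro has_derivative_mult) (auto simp: frechet_derivative_works)
  from frechet_derivative_at[OF this, symmetric] show ?thesis by (simp add: pd_def)
qed

lemma pd_cong_open:
  assumes "open S" "x \<in> S" "\<And>y. y \<in> S \<Longrightarrow> f y = g y"
  shows "pd f x b = pd g x b"
proof -
  have "(f has_derivative D) (at x) \<longleftrightarrow> (g has_derivative D) (at x)" for D
    using has_derivative_transform_within_open[OF _ assms(1,2), of f D UNIV g]
      has_derivative_transform_within_open[OF _ assms(1,2), of g D UNIV f] assms(3) by auto
  then show ?thesis by (simp add: pd_def frechet_derivative_def)
qed

lemma Ck_on_UNIV_bounded_linear:
  assumes "bounded_linear L" "Ck_on k UNIV f"
  shows "Ck_on k UNIV (\<lambda>x. L (f x))"
  using assms(2)
proof (induction k arbitrary: f)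
  case 0
  then show ?case using assms(1) by (auto intro: bounded_linear.continuous_on)
next
  case (Suc k)
  have d: "f differentiable (at x)" for x using Suc.prems by (simp add: differentiable_on_eq_differentiable_at)
  have "(\<lambda>x. L (f x)) differentiable (at x)" for x
    using d[of x] assms(1) bounded_linear.has_derivative unfolding differentiable_def by blast
  then show ?case using Suc
    by (auto simp: differentiable_on_eq_differentiable_at pd_bounded_linear[OF assms(1) d])
qed

lemma Ck_on_UNIV_add:
  assumes "Ck_on k UNIV f" "Ck_on k UNIV g"
  shows "Ck_on k UNIV (\<lambda>x. f x + g x)"
  using assms
proof (induction k arbitrary: f g)
  case 0
  then show ?case by (auto intro: continuous_on_add)
next
  case (Suc k)
  have d: "f differentiable (at x)" "g differentiable (at x)" for x
    using Suc.prems by (auto simp: differentiable_on_eq_differentiable_at)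
  then show ?case using Suc
    by (auto simp: differentiable_on_eq_differentiable_at pd_add[OF d])
qed

lemma Ck_on_UNIV_0: "Ck_on k UNIV (\<lambda>x::'a::euclidean_space. 0::'b::real_normed_vector)"
proof (induction k)
  case (Suc k)
  have "pd (\<lambda>x::'a. 0::'b) x b = 0" for x b by (simp add: pd_def)
  then show ?case using Suc by simp
qed simp

lemma Ck_on_UNIV_sum:
  "finite I \<Longrightarrow> (\<And>i. i \<in> I \<Longrightarrow> Ck_on k UNIV (f i)) \<Longrightarrow> Ck_on k UNIV (\<lambda>x. \<Sum>i\<in>I. f i x)"
  by (induction I rule: finite_induct) (simp_all add: Ck_on_UNIV_0 Ck_on_UNIV_add)

section \<open>Supports and regularity of test functions\<close>

lemma eq_0_outside_tsupp: "x \<notin> tsupp f \<Longrightarrow> f x = 0"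
  unfolding tsupp_def using closure_subset[of "{x. f x \<noteq> 0}"] by blast

lemma pd_eq_0_outside_tsupp: "x \<notin> tsupp f \<Longrightarrow> pd f x b = 0"
proof -
  assume "x \<notin> tsupp f"
  then have "pd f x b = pd (\<lambda>x. 0) x b"
    by (intro pd_cong_open[of "- tsupp f"]) (auto simp: tsupp_def intro: eq_0_outside_tsupp[unfolded tsupp_def])
  then show ?thesis by (simp add: pd_def)
qed

lemma tsupp_subsetI:
  assumes "\<And>x. x \<notin> tsupp f \<Longrightarrow> g x = 0"
  shows "tsupp g \<subseteq> tsupp f"
proof -
  have "{x. g x \<noteq> 0} \<subseteq> tsupp f" using assms by auto
  then show ?thesis unfolding tsupp_def by (metis closure_minimal closed_closure)
qed

lemma test_fun_Ck: "test_fun S f \<Longrightarrow> Ck_on k UNIV f"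
  by (simp add: test_fun_def smooth_on_def)

lemma test_fun_differentiable: "test_fun S f \<Longrightarrow> f differentiable (at x)"
  using test_fun_Ck[of S f "Suc 0"] by (simp add: differentiable_on_eq_differentiable_at)

lemma test_fun_continuous: "test_fun S f \<Longrightarrow> continuous_on A f"
  using test_fun_Ck[of S f 0] by (auto intro: continuous_on_subset)

lemma test_fun_continuous_pd: "test_fun S f \<Longrightarrow> b \<in> Basis \<Longrightarrow> continuous_on A (\<lambda>x. pd f x b)"
  using test_fun_Ck[of S f "Suc 0"] by (auto intro: continuous_on_subset)

lemma test_fun_divergence:
  fixes f :: "'a::euclidean_space \<Rightarrow> 'a"
  assumes "test_fun S f"
  shows "test_fun S (\<lambda>x. \<Sum>b\<in>Basis. pd f x b \<bullet> b)"
proof -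
  have s: "Ck_on k UNIV f" for k using assms by (simp add: test_fun_def smooth_on_def)
  have "Ck_on k UNIV (\<lambda>x. \<Sum>b\<in>Basis. pd f x b \<bullet> b)" for k
    using s[of "Suc k"] by (intro Ck_on_UNIV_sum Ck_on_UNIV_bounded_linear[OF bounded_linear_inner_left]) auto
  moreover have sub: "tsupp (\<lambda>x. \<Sum>b\<in>Basis. pd f x b \<bullet> b) \<subseteq> tsupp f"
    by (rule tsupp_subsetI) (simp add: pd_eq_0_outside_tsupp)
  moreover have "compact (tsupp (\<lambda>x. \<Sum>b\<in>Basis. pd f x b \<bullet> b))"
    using assms sub closed_Int_compact[of "tsupp (\<lambda>x. \<Sum>b\<in>Basis. pd f x b \<bullet> b)" "tsupp f"]
    by (simp add: test_fun_def tsupp_def Int_absorb2)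
  ultimately show ?thesis using assms by (auto simp: test_fun_def smooth_on_def)
qed

section \<open>Integrals of compactly supported functions\<close>

lemma bounded_range_compact_support:
  fixes g :: "'a::euclidean_space \<Rightarrow> 'b::real_normed_vector"
  assumes "compact K" "continuous_on K g" "\<And>x. x \<notin> K \<Longrightarrow> g x = 0"
  obtains B where "0 \<le> B" "\<And>x. norm (g x) \<le> B"
proof -
  have "bounded (g ` K)" using assms by (intro compact_imp_bounded compact_continuous_image)
  then obtain B where "B > 0" "\<forall>x\<in>K. norm (g x) \<le> B" by (auto simp: bounded_pos)
  then have "norm (g x) \<le> B" for x using assms(3)[of x] by (cases "x \<in> K") auto
  then show ?thesis using that[of B] \<open>B > 0\<close> by simp
qed

lemma integrable_compact_support:
  fixes g :: "'a::euclidean_space \<Rightarrow> 'b::{banach, second_countable_topology}"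
  assumes "compact K" "continuous_on K g" "\<And>x. x \<notin> K \<Longrightarrow> g x = 0"
  shows "integrable lborel g"
proof -
  have "(\<lambda>x. indicator K x *\<^sub>R g x) = g" using assms(3) by (auto simp: indicator_def)
  then show ?thesis using borel_integrable_compact[OF assms(1,2)] by simp
qed

text \<open>Difference quotients have integral zero by translation invariance.\<close>
lemma integral_pd_compact_support:
  fixes g :: "'a::euclidean_space \<Rightarrow> real"
  assumes d: "\<And>x. g differentiable (at x)"
    and c: "\<And>b. b \<in> Basis \<Longrightarrow> continuous_on UNIV (\<lambda>x. pd g x b)"
    and K: "compact K" and z: "\<And>x. x \<notin> K \<Longrightarrow> g x = 0" and b: "b \<in> Basis"
  shows "(\<integral>x. pd g x b \<partial>lborel) = 0"
proof -
  have cg: "continuous_on UNIV g"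
    using d by (simp add: differentiable_imp_continuous_on differentiable_on_eq_differentiable_at)
  have zp: "pd g x b' = 0" if "x \<notin> K" for x b'
  proof -
    have "pd g x b' = pd (\<lambda>x. 0) x b'"
      using that z K by (intro pd_cong_open[of "- K"]) (auto simp: compact_imp_closed)
    then show ?thesis by (simp add: pd_def)
  qed
  have "continuous_on K (\<lambda>x. \<Sum>b'\<in>Basis. \<bar>pd g x b'\<bar>)"
    by (intro continuous_intros continuous_on_subset[OF c subset_UNIV])
  moreover have "(\<Sum>b'\<in>Basis. \<bar>pd g x b'\<bar>) = 0" if "x \<notin> K" for x using zp[OF that] by simp
  ultimately obtain B0 where "0 \<le> B0" and B0n: "\<And>x. norm (\<Sum>b'\<in>Basis. \<bar>pd g x b'\<bar>) \<le> B0"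
    using bounded_range_compact_support[OF K] by blast
  have B0s: "(\<Sum>b'\<in>Basis. \<bar>pd g x b'\<bar>) \<le> B0" for x
    using B0n[of x] by simp
  have B0: "norm (pd g x b') \<le> B0" if "b' \<in> Basis" for x b'
  proof -
    have "norm (pd g x b') \<le> (\<Sum>b'\<in>Basis. \<bar>pd g x b'\<bar>)"
      unfolding real_norm_def using that by (intro member_le_sum) auto
    then show ?thesis using B0s[of x] by linarith
  qed
  define L where "L = DIM('a) * B0"
  have lip: "norm (g x - g y) \<le> L * norm (x - y)" for x y
    unfolding L_def using norm_diff_le_pd_bound[of UNIV g B0 x y] d B0 by simp
  define f where "f n x = (g (x + (1 / real (Suc n)) *\<^sub>R b) - g x) / (1 / real (Suc n))" for n x
  have ig: "integrable lborel g" using K continuous_on_subset[OF cg] z by (intro integrable_compact_support[of K]) auto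
  have distr: "distr lborel borel ((+) c) = lborel" for c :: 'a by (rule lborel_distr_plus)
  have igt: "integrable lborel (\<lambda>x. g (c + x))" and egt: "(\<integral>x. g (c + x) \<partial>lborel) = (\<integral>x. g x \<partial>lborel)" for c
  proof -
    have mg: "g \<in> borel_measurable borel" using cg by (rule borel_measurable_continuous_onI)
    show "integrable lborel (\<lambda>x. g (c + x))"
      using ig integrable_distr_eq[of "(+) c" lborel borel g] mg distr[of c] by simp
    show "(\<integral>x. g (c + x) \<partial>lborel) = (\<integral>x. g x \<partial>lborel)"
      using integral_distr[of "(+) c" lborel borel g] mg distr[of c] by simp
  qed
  have f0: "(\<integral>x. f n x \<partial>lborel) = 0" for n
    unfolding f_def using igt[of "(1 / real (Suc n)) *\<^sub>R b"] egt[of "(1 / real (Suc n)) *\<^sub>R b"] ig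
    by (simp add: add.commute)
  \<comment> \<open>The increments have length at most 1, so every difference quotient is supported
    in the unit neighbourhood of \<open>K\<close>, and there the Lipschitz constant bounds it. This
    gives one integrable majorant for all \<open>n\<close>.\<close>
  define K' where "K' = {x + y | x y. x \<in> K \<and> y \<in> cball (0::'a) 1}"
  have K': "compact K'" unfolding K'_def using K by (intro compact_sums) auto
  have inK': "y + v \<in> K'" if "y \<in> K" "norm v \<le> 1" for y v
    using that unfolding K'_def by auto
  have nb: "norm b = 1" using b by simp
  have fb: "norm (f n x) \<le> indicator K' x * L" for n x
  proof (cases "x \<in> K'")
    case True
    have "norm (g (x + (1 / real (Suc n)) *\<^sub>R b) - g x) \<le> L * (1 / real (Suc n))"
      using lip[of "x + (1 / real (Suc n)) *\<^sub>R b" x] nb by simp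
    then have "norm (f n x) \<le> (L * (1 / real (Suc n))) / (1 / real (Suc n))"
      unfolding f_def by (subst norm_divide) (simp add: pos_le_divide_eq)
    then show ?thesis using True by simp
  next
    case False
    have "x \<notin> K"
    proof
      assume "x \<in> K"
      then have "x + 0 \<in> K'" by (intro inK') auto
      then show False using False by simp
    qed
    moreover have "x + (1 / real (Suc n)) *\<^sub>R b \<notin> K"
    proof
      assume "x + (1 / real (Suc n)) *\<^sub>R b \<in> K"
      then have "(x + (1 / real (Suc n)) *\<^sub>R b) + (- ((1 / real (Suc n)) *\<^sub>R b)) \<in> K'"
        using nb by (intro inK') (auto simp: divide_le_eq)
      then show False using False by simp
    qed
    ultimately show ?thesis using False z by (simp add: f_def)
  qed
  have "(\<lambda>n. \<integral>x. f n x \<partial>lborel) \<longlonglongrightarrow> (\<integral>x. pd g x b \<partial>lborel)"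
  proof (rule integral_dominated_convergence)
    show "(\<lambda>x. pd g x b) \<in> borel_measurable lborel"
      using borel_measurable_continuous_onI[OF c[OF b]] by simp
    show "f n \<in> borel_measurable lborel" for n
    proof -
      have "continuous_on UNIV (f n)" unfolding f_def
        by (intro continuous_intros continuous_on_compose2[OF cg]) auto
      then show ?thesis using borel_measurable_continuous_onI by simp
    qed
    show "integrable lborel (\<lambda>x. indicator K' x * L)"
      using borel_integrable_compact[OF K', of "\<lambda>_. L"] by simp
    show "AE x in lborel. norm (f n x) \<le> indicator K' x * L" for n using fb by simp
    show "AE x in lborel. (\<lambda>n. f n x) \<longlonglongrightarrow> pd g x b"
    proof (rule AE_I2)
      fix x
      have hd: "(g has_derivative frechet_derivative g (at x)) (at x)" using d by (simp add: frechet_derivative_works)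
      have "((\<lambda>t::real. x + t *\<^sub>R b) has_derivative (\<lambda>t. t *\<^sub>R b)) (at 0)"
        by (auto intro!: derivative_eq_intros)
      then have "((\<lambda>t::real. g (x + t *\<^sub>R b)) has_derivative (\<lambda>t. frechet_derivative g (at x) (t *\<^sub>R b))) (at 0)"
        using has_derivative_compose[of "\<lambda>t. x + t *\<^sub>R b" "\<lambda>t. t *\<^sub>R b" 0 UNIV g "frechet_derivative g (at x)"] hd by simp
      moreover have "frechet_derivative g (at x) (t *\<^sub>R b) = t * pd g x b" for t
        using linear_frechet_derivative[OF d[of x]] by (simp add: pd_def linear_cmul)
      ultimately have "((\<lambda>t::real. g (x + t *\<^sub>R b)) has_field_derivative pd g x b) (at 0)"
        by (simp add: has_field_derivative_def mult.commute[of _ "pd g x b"] mult_commute_abs)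
      then have "((\<lambda>t. (g (x + t *\<^sub>R b) - g x) / t) \<longlongrightarrow> pd g x b) (at 0)"
        by (simp add: DERIV_def)
      moreover have "filterlim (\<lambda>n. 1 / real (Suc n)) (at 0) sequentially"
        by (intro filterlim_atI LIMSEQ_Suc[OF lim_1_over_n]) auto
      ultimately show "(\<lambda>n. f n x) \<longlonglongrightarrow> pd g x b"
        unfolding f_def by (rule filterlim_compose)
    qed
  qed
  then show ?thesis using f0 by (simp add: LIMSEQ_const_iff)
qed

lemma inner_grad: "v \<bullet> grad q x = (\<Sum>b\<in>Basis. (v \<bullet> b) * pd q x b)"
  by (simp add: grad_def inner_sum_right mult.commute)

lemma Ck_on_1D:
  assumes "Ck_on 1 S q" "open S"
  shows "x \<in> S \<Longrightarrow> q differentiable (at x)" "b \<in> Basis \<Longrightarrow> continuous_on S (\<lambda>x. pd q x b)"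
  using assms by (auto simp: differentiable_on_eq_differentiable_at)

lemma set_integrable_lebesgue_compact_support:
  fixes g :: "'a::euclidean_space \<Rightarrow> 'b::euclidean_space"
  assumes "compact K" "continuous_on K g" "\<And>x. x \<notin> K \<Longrightarrow> g x = 0" "K \<subseteq> S"
  shows "set_integrable lebesgue S g" "(LINT x:S|lebesgue. g x) = (\<integral>x. g x \<partial>lborel)"
proof -
  have eq: "(\<lambda>x. indicat_real S x *\<^sub>R g x) = g"
  proof
    show "indicat_real S x *\<^sub>R g x = g x" for x using assms(3)[of x] assms(4) by (cases "x \<in> K") auto
  qed
  have i: "integrable lborel g" using assms by (intro integrable_compact_support)
  then have m: "g \<in> borel_measurable lborel" by auto
  show "set_integrable lebesgue S g" unfolding set_integrable_def eq using i m by (simp add: integrable_completion)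
  show "(LINT x:S|lebesgue. g x) = (\<integral>x. g x \<partial>lborel)"
    unfolding set_lebesgue_integral_def eq using m by (rule integral_completion)
qed

text \<open>\<open>q\<close> is controlled only in \<Omega>; extending it by 0 is harmless because
  \<open>\<phi>\<close> vanishes off a compact subset of \<Omega>. The set \<Omega> and the
  complement of that compact set form an open cover, and on each of them the product of
  \<open>q\<close> with a component of \<open>\<phi>\<close> is continuously differentiable. Its
  partial derivatives then integrate to 0 over the whole space, and their sum over the directions is
  the integrand.\<close>

lemma divergence_integration_by_parts:
  fixes \<Omega> :: "'a::euclidean_space set" and \<phi> :: "'a \<Rightarrow> 'a" and q :: "'a \<Rightarrow> real"
  assumes "open \<Omega>" and \<phi>: "test_fun \<Omega> \<phi>" and q: "Ck_on 1 \<Omega> q"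
  shows "(LINT x:\<Omega>|lebesgue. (\<Sum>b\<in>Basis. pd \<phi> x b \<bullet> b) * q x + \<phi> x \<bullet> grad q x) = 0"
proof -
  define K where "K = tsupp \<phi>"
  have K: "compact K" "K \<subseteq> \<Omega>" using \<phi> by (auto simp: test_fun_def K_def)
  have z\<phi>: "\<phi> x = 0" "pd \<phi> x b = 0" if "x \<notin> K" for x b
    using that by (auto simp: K_def eq_0_outside_tsupp pd_eq_0_outside_tsupp)
  define g where "g b x = (\<phi> x \<bullet> b) * (if x \<in> \<Omega> then q x else 0)" for b x
  define g' where "g' b x = (pd \<phi> x b \<bullet> b) * q x + (\<phi> x \<bullet> b) * pd q x b" for b x
  have cover: "UNIV = \<Omega> \<union> - K" using K by auto
  have oK: "open (- K)" using K by (simp add: compact_imp_closed open_Compl)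
  have main: "g b differentiable (at x) \<and> pd (g b) x b' = (if x \<in> \<Omega> then (pd \<phi> x b' \<bullet> b) * q x + (\<phi> x \<bullet> b) * pd q x b' else 0)" for x b b'
  proof (cases "x \<in> \<Omega>")
    case True
    have d\<phi>: "(\<lambda>x. \<phi> x \<bullet> b) differentiable (at x)"
      using test_fun_differentiable[OF \<phi>, of x] by simp
    have dq: "q differentiable (at x)" using Ck_on_1D(1)[OF q \<open>open \<Omega>\<close> True] .
    have dg: "(\<lambda>x. (\<phi> x \<bullet> b) * q x) differentiable (at x)" using d\<phi> dq by (rule differentiable_mult)
    have "g b differentiable (at x)"
      using has_derivative_transform_within_open[OF _ \<open>open \<Omega>\<close> True, of "\<lambda>x. (\<phi> x \<bullet> b) * q x" _ UNIV "g b"] dg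
      unfolding differentiable_def g_def by fastforce
    moreover have "pd (g b) x b' = pd (\<lambda>x. (\<phi> x \<bullet> b) * q x) x b'"
      by (rule pd_cong_open[OF \<open>open \<Omega>\<close> True]) (simp add: g_def)
    moreover have "pd (\<lambda>x. \<phi> x \<bullet> b) x b' = pd \<phi> x b' \<bullet> b"
      using pd_bounded_linear[OF bounded_linear_inner_left test_fun_differentiable[OF \<phi>]] .
    ultimately show ?thesis using True by (simp add: pd_mult[OF d\<phi> dq])
  next
    case False
    then have x: "x \<in> - K" using K by auto
    have eq: "g b y = 0" if "y \<in> - K" for y using that z\<phi> by (simp add: g_def)
    have "(g b has_derivative (\<lambda>h. 0)) (at x)"
      by (rule has_derivative_transform_within_open[OF has_derivative_const[of 0] oK x]) (simp add: eq)
    moreover have "pd (g b) x b' = pd (\<lambda>x. 0) x b'" by (rule pd_cong_open[OF oK x]) (simp add: eq)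
    ultimately show ?thesis using False by (auto simp: differentiable_def pd_def)
  qed
  then have g_diff: "g b differentiable (at x)" and pdg: "pd (g b) x b' = (if x \<in> \<Omega> then (pd \<phi> x b' \<bullet> b) * q x + (\<phi> x \<bullet> b) * pd q x b' else 0)" for x b b'
    by blast+
  have pdg0: "pd (g b) x b' = 0" if "x \<notin> K" for x b b' using z\<phi>[OF that] by (simp add: pdg)
  have cg: "continuous_on UNIV (\<lambda>x. pd (g b) x b')" if "b' \<in> Basis" for b b'
  proof (subst cover, rule continuous_on_open_Un[OF \<open>open \<Omega>\<close> oK])
    have "continuous_on \<Omega> (\<lambda>x. (pd \<phi> x b' \<bullet> b) * q x + (\<phi> x \<bullet> b) * pd q x b')"
      using test_fun_continuous_pd[OF \<phi> that] test_fun_continuous[OF \<phi>] Ck_on_imp_continuous_on[OF q]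
        Ck_on_1D(2)[OF q \<open>open \<Omega>\<close> that] by (intro continuous_intros) auto
    then show "continuous_on \<Omega> (\<lambda>x. pd (g b) x b')"
      by (rule continuous_on_eq) (simp add: pdg)
    show "continuous_on (- K) (\<lambda>x. pd (g b) x b')"
      by (rule continuous_on_eq[OF continuous_on_const[of _ 0]]) (simp add: pdg0)
  qed
  have cgK: "continuous_on K (\<lambda>x. pd (g b) x b)" if "b \<in> Basis" for b
    using cg[OF that] by (rule continuous_on_subset) simp
  have i0: "(\<integral>x. pd (g b) x b \<partial>lborel) = 0" if "b \<in> Basis" for b
    by (rule integral_pd_compact_support[OF g_diff cg K(1) _ that]) (simp_all add: g_def z\<phi>)
  have "(LINT x:\<Omega>|lebesgue. (\<Sum>b\<in>Basis. pd \<phi> x b \<bullet> b) * q x + \<phi> x \<bullet> grad q x)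
      = (LINT x:\<Omega>|lebesgue. \<Sum>b\<in>Basis. pd (g b) x b)"
    using \<open>open \<Omega>\<close> by (intro set_lebesgue_integral_cong) (auto simp: pdg inner_grad sum_distrib_right sum.distrib)
  also have "\<dots> = (\<integral>x. (\<Sum>b\<in>Basis. pd (g b) x b) \<partial>lborel)"
    using K pdg0 by (intro set_integrable_lebesgue_compact_support(2)[of K] continuous_on_sum cgK) auto
  also have "\<dots> = (\<Sum>b\<in>Basis. \<integral>x. pd (g b) x b \<partial>lborel)"
    using K pdg0 by (intro Bochner_Integration.integral_sum integrable_compact_support[of K] cgK) auto
  finally show ?thesis using i0 by simp
qed

section \<open>Orthogonality to gradients\<close>

lemma set_borel_measurable_lebesgue_continuous_on:
  fixes f :: "'a::euclidean_space \<Rightarrow> 'b::real_normed_vector"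
  assumes "S \<in> sets borel" "continuous_on S f"
  shows "set_borel_measurable lebesgue S f"
  unfolding set_borel_measurable_def
  by (rule measurable_completion) (use borel_measurable_continuous_on_indicator[OF assms] in simp)

lemma test_fun_bounded:
  assumes "test_fun S f"
  shows "\<exists>B. \<forall>x. norm (f x) \<le> B" and "b \<in> Basis \<Longrightarrow> \<exists>B. \<forall>x. norm (pd f x b) \<le> B"
proof -
  have K: "compact (tsupp f)" using assms by (simp add: test_fun_def)
  show "\<exists>B. \<forall>x. norm (f x) \<le> B"
    by (rule bounded_range_compact_support[OF K test_fun_continuous[OF assms]]) (auto simp: eq_0_outside_tsupp)
  show "\<exists>B. \<forall>x. norm (pd f x b) \<le> B" if "b \<in> Basis"
    by (rule bounded_range_compact_support[OF K test_fun_continuous_pd[OF assms that]]) (auto simp: pd_eq_0_outside_tsupp)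
qed

lemma L2_on_test_fun:
  fixes f :: "'a::euclidean_space \<Rightarrow> 'b::euclidean_space"
  assumes "open S" "S \<in> lmeasurable" "test_fun S f"
  shows "L2_on S f"
proof -
  obtain B where "\<And>x. norm (f x) \<le> B" using test_fun_bounded(1)[OF assms(3)] by blast
  then show ?thesis using assms
    by (intro L2_on_bounded[of _ _ B] set_borel_measurable_lebesgue_continuous_on test_fun_continuous[of S]) auto
qed

text \<open>On a set of finite measure the inequality
  \<open>norm (w x) \<le> 1 + (norm (w x))\<^sup>2\<close> turns square integrability into
  integrability, and the bounded factor only scales the majorant.\<close>

lemma L2_on_scaleR_integrable:
  assumes w: "L2_on S w" and S: "S \<in> lmeasurable" and \<phi>: "continuous_on UNIV \<phi>" and B: "\<And>x. \<bar>\<phi> x\<bar> \<le> B"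
  shows "set_integrable lebesgue S (\<lambda>x. \<phi> x *\<^sub>R w x)"
  unfolding set_integrable_def
proof (rule Bochner_Integration.integrable_bound)
  have "set_integrable lebesgue S (\<lambda>x. 1::real)"
    using S unfolding set_integrable_def real_scaleR_def
    by (intro integrable_mult_left integrable_real_indicator) (auto simp: fmeasurable_def)
  then have "set_integrable lebesgue S (\<lambda>x. B * (1 + (norm (w x))\<^sup>2))"
    using L2_on_integrable(1)[OF w] by (intro set_integrable_mult_right set_integral_add)
  then show "integrable lebesgue (\<lambda>x. indicat_real S x *\<^sub>R (B * (1 + (norm (w x))\<^sup>2)))"
    by (simp add: set_integrable_def)
  have eq: "(\<lambda>x. indicat_real S x *\<^sub>R (\<phi> x *\<^sub>R w x)) = (\<lambda>x. \<phi> x *\<^sub>R (indicat_real S x *\<^sub>R w x))"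
    by (auto simp: mult.commute)
  have "\<phi> \<in> borel_measurable lebesgue"
    by (rule measurable_completion) (use borel_measurable_continuous_onI[OF \<phi>] in simp)
  then show "(\<lambda>x. indicat_real S x *\<^sub>R (\<phi> x *\<^sub>R w x)) \<in> borel_measurable lebesgue"
    unfolding eq by (rule borel_measurable_scaleR) (use w in \<open>simp add: L2_on_def set_borel_measurable_def\<close>)
  have "norm (\<phi> x *\<^sub>R w x) \<le> B * (1 + (norm (w x))\<^sup>2)" for x
  proof -
    have "norm (w x) \<le> 1 + (norm (w x))\<^sup>2"
      using sum_squares_ge_zero[of "norm (w x) - 1" 0] by (simp add: power2_eq_square algebra_simps) (smt (verit) mult_nonneg_nonneg norm_ge_zero)
    then show ?thesis using B[of x] unfolding norm_scaleR real_norm_def by (intro mult_mono) auto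
  qed
  then show "AE x in lebesgue. norm (indicat_real S x *\<^sub>R \<phi> x *\<^sub>R w x) \<le> norm (indicat_real S x *\<^sub>R (B * (1 + (norm (w x))\<^sup>2)))"
    by (intro AE_I2) (simp add: indicator_def order_trans[OF _ abs_ge_self])
qed

lemma set_integral_inner_left:
  fixes f :: "'a \<Rightarrow> 'b::euclidean_space"
  assumes "set_integrable M S f"
  shows "(LINT x:S|M. f x \<bullet> c) = (LINT x:S|M. f x) \<bullet> c" "set_integrable M S (\<lambda>x. f x \<bullet> c)"
  using assms unfolding set_integrable_def set_lebesgue_integral_def
  by (simp_all flip: inner_scaleR_left)

text \<open>Summing the defining identities of the weak derivatives over the directions moves the
  derivatives onto \<open>\<phi>\<close> and leaves \<open>g x \<bullet> grad \<phi> x\<close>,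
  whose integral vanishes by membership in \<open>H\<close>. So the trace of the weak gradient is
  orthogonal to every test function.\<close>

lemma H_space_weak_divergence:
  fixes \<Omega> :: "'a::euclidean_space set"
  assumes \<Omega>: "open \<Omega>" "\<Omega> \<in> lmeasurable" and H: "H_space \<Omega> g" and G: "weak_grad \<Omega> g G" and \<phi>: "test_fun \<Omega> \<phi>"
  shows "(LINT x:\<Omega>|lebesgue. (\<Sum>b\<in>Basis. G x b \<bullet> b) * \<phi> x) = 0"
proof -
  have m\<Omega>: "\<Omega> \<in> sets lebesgue" using \<Omega> by auto
  have g: "L2_on \<Omega> g" and Gb: "\<And>b. b \<in> Basis \<Longrightarrow> L2_on \<Omega> (\<lambda>x. G x b)"
    using G m\<Omega> by (auto simp: weak_grad_def intro: in_L2_imp_L2_on)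
  obtain B where B: "\<And>x. \<bar>\<phi> x\<bar> \<le> B"
    using test_fun_bounded(1)[OF \<phi>] unfolding real_norm_def by blast
  have i1: "set_integrable lebesgue \<Omega> (\<lambda>x. \<phi> x *\<^sub>R G x b)" if "b \<in> Basis" for b
    by (rule L2_on_scaleR_integrable[OF Gb[OF that] \<Omega>(2) test_fun_continuous[OF \<phi>] B])
  have i2: "set_integrable lebesgue \<Omega> (\<lambda>x. pd \<phi> x b *\<^sub>R g x)" if b: "b \<in> Basis" for b
  proof -
    obtain B where B: "\<And>x. \<bar>pd \<phi> x b\<bar> \<le> B"
      using test_fun_bounded(2)[OF \<phi> b] unfolding real_norm_def by blast
    show ?thesis by (rule L2_on_scaleR_integrable[OF g \<Omega>(2) test_fun_continuous_pd[OF \<phi> that] B])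
  qed
  have eqb: "(LINT x:\<Omega>|lebesgue. (\<phi> x *\<^sub>R G x b) \<bullet> b) = - (LINT x:\<Omega>|lebesgue. (pd \<phi> x b *\<^sub>R g x) \<bullet> b)"
    if "b \<in> Basis" for b
  proof -
    have "(LINT x:\<Omega>|lebesgue. \<phi> x *\<^sub>R G x b) = - (LINT x:\<Omega>|lebesgue. pd \<phi> x b *\<^sub>R g x)"
      using G \<phi> that unfolding weak_grad_def by blast
    then show ?thesis by (simp add: set_integral_inner_left(1)[OF i1[OF that]] set_integral_inner_left(1)[OF i2[OF that]]
      del: inner_scaleR_left)
  qed
  have "test_fun UNIV \<phi>" using \<phi> by (simp add: test_fun_def)
  then have "0 = (LINT x:\<Omega>|lebesgue. g x \<bullet> grad \<phi> x)" using H by (simp add: H_space_def)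
  also have "\<dots> = (LINT x:\<Omega>|lebesgue. \<Sum>b\<in>Basis. (pd \<phi> x b *\<^sub>R g x) \<bullet> b)"
    by (simp add: inner_grad mult.commute)
  also have "\<dots> = (\<Sum>b\<in>Basis. LINT x:\<Omega>|lebesgue. (pd \<phi> x b *\<^sub>R g x) \<bullet> b)"
    using set_integral_inner_left(2)[OF i2] unfolding set_integrable_def set_lebesgue_integral_def scaleR_sum_right
    by (intro Bochner_Integration.integral_sum) blast
  also have "\<dots> = - (\<Sum>b\<in>Basis. LINT x:\<Omega>|lebesgue. (\<phi> x *\<^sub>R G x b) \<bullet> b)"
    by (simp add: eqb sum_negf del: inner_scaleR_left)
  also have "(\<Sum>b\<in>Basis. LINT x:\<Omega>|lebesgue. (\<phi> x *\<^sub>R G x b) \<bullet> b)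
      = (LINT x:\<Omega>|lebesgue. \<Sum>b\<in>Basis. (\<phi> x *\<^sub>R G x b) \<bullet> b)"
    using set_integral_inner_left(2)[OF i1] unfolding set_integrable_def set_lebesgue_integral_def scaleR_sum_right
    by (intro Bochner_Integration.integral_sum[symmetric]) blast
  also have "\<dots> = (LINT x:\<Omega>|lebesgue. (\<Sum>b\<in>Basis. G x b \<bullet> b) * \<phi> x)"
    by (simp add: sum_distrib_left mult.commute)
  finally show ?thesis by simp
qed

text \<open>Applied to the difference between the derivatives of the approximating test functions
  and the weak gradient, the estimate turns convergence in H1 into convergence of the divergences in
  L2.\<close>

lemma L2_on_divergence:
  fixes V :: "'a::euclidean_space \<Rightarrow> 'a \<Rightarrow> 'a"
  assumes "\<And>b. b \<in> Basis \<Longrightarrow> L2_on S (\<lambda>x. V x b)"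
  shows "L2_on S (\<lambda>x. \<Sum>b\<in>Basis. V x b \<bullet> b)"
    and "L2sq S (\<lambda>x. \<Sum>b\<in>Basis. V x b \<bullet> b) \<le> DIM('a) * (\<Sum>b\<in>Basis. L2sq S (\<lambda>x. V x b))"
proof -
  have le: "(\<Sum>b\<in>Basis. V x b \<bullet> b)\<^sup>2 \<le> DIM('a) * (\<Sum>b\<in>Basis. (norm (V x b))\<^sup>2)" for x
  proof -
    have "(\<Sum>b\<in>Basis. V x b \<bullet> b)\<^sup>2 \<le> DIM('a) * (\<Sum>b\<in>Basis. (V x b \<bullet> b)\<^sup>2)"
      using sum_squared_le_sum_of_squares[of "\<lambda>b. V x b \<bullet> b" Basis] by (simp add: mult.commute)
    also have "\<dots> \<le> DIM('a) * (\<Sum>b\<in>Basis. (norm (V x b))\<^sup>2)"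
      by (intro mult_left_mono sum_mono) (auto simp: Basis_le_norm abs_le_square_iff[symmetric])
    finally show ?thesis .
  qed
  have "set_integrable lebesgue S (\<lambda>x. \<Sum>b\<in>Basis. (norm (V x b))\<^sup>2)"
    using L2_on_integrable(1)[OF assms] unfolding set_integrable_def scaleR_sum_right
    by (intro Bochner_Integration.integrable_sum) blast
  then have int: "set_integrable lebesgue S (\<lambda>x. DIM('a) * (\<Sum>b\<in>Basis. (norm (V x b))\<^sup>2))"
    by (rule set_integrable_mult_right)
  show L: "L2_on S (\<lambda>x. \<Sum>b\<in>Basis. V x b \<bullet> b)"
  proof (rule L2_onI[OF _ int])
    have "(\<lambda>x. indicat_real S x *\<^sub>R (\<Sum>b\<in>Basis. V x b \<bullet> b)) = (\<lambda>x. \<Sum>b\<in>Basis. (indicat_real S x *\<^sub>R V x b) \<bullet> b)"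
      by (simp add: sum_distrib_left)
    moreover have "(\<lambda>x. \<Sum>b\<in>Basis. (indicat_real S x *\<^sub>R V x b) \<bullet> b) \<in> borel_measurable lebesgue"
      using assms unfolding L2_on_def set_borel_measurable_def by (intro borel_measurable_sum borel_measurable_inner) auto
    ultimately show "set_borel_measurable lebesgue S (\<lambda>x. \<Sum>b\<in>Basis. V x b \<bullet> b)" 
      unfolding set_borel_measurable_def by metis
  qed (use le in simp)
  have "L2sq S (\<lambda>x. \<Sum>b\<in>Basis. V x b \<bullet> b) = (LINT x:S|lebesgue. (\<Sum>b\<in>Basis. V x b \<bullet> b)\<^sup>2)"
    by (simp add: L2_on_integrable(2)[OF L])
  also have "\<dots> \<le> (LINT x:S|lebesgue. DIM('a) * (\<Sum>b\<in>Basis. (norm (V x b))\<^sup>2))"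
    using L2_on_integrable(1)[OF L] int le by (intro set_integral_mono) auto
  also have "\<dots> = DIM('a) * (LINT x:S|lebesgue. \<Sum>b\<in>Basis. (norm (V x b))\<^sup>2)"
    by (rule set_integral_mult_right)
  also have "(LINT x:S|lebesgue. \<Sum>b\<in>Basis. (norm (V x b))\<^sup>2) = (\<Sum>b\<in>Basis. LINT x:S|lebesgue. (norm (V x b))\<^sup>2)"
    using L2_on_integrable(1)[OF assms] unfolding set_integrable_def set_lebesgue_integral_def scaleR_sum_right
    by (intro Bochner_Integration.integral_sum) blast
  finally show "L2sq S (\<lambda>x. \<Sum>b\<in>Basis. V x b \<bullet> b) \<le> DIM('a) * (\<Sum>b\<in>Basis. L2sq S (\<lambda>x. V x b))"
    by (simp add: L2_on_integrable(2)[OF assms])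
qed

lemma L2_on_pd_test_fun:
  fixes f :: "'a::euclidean_space \<Rightarrow> 'b::euclidean_space"
  assumes "open S" "S \<in> lmeasurable" "test_fun S f" "b \<in> Basis"
  shows "L2_on S (\<lambda>x. pd f x b)"
proof -
  obtain B where "\<And>x. norm (pd f x b) \<le> B" using test_fun_bounded(2)[OF assms(3,4)] by blast
  then show ?thesis using assms
    by (intro L2_on_bounded[of _ _ B] set_borel_measurable_lebesgue_continuous_on test_fun_continuous_pd[of S]) auto
qed

lemma continuous_on_grad:
  assumes "open S" "Ck_on 1 S q"
  shows "continuous_on S (grad q)"
  unfolding grad_def using Ck_on_1D(2)[OF assms(2,1)] by (intro continuous_intros) auto

text \<open>Testing the weak divergence of \<open>g\<close> against the divergences of the approximating test functions,
  which are test functions themselves, shows that it vanishes in \<open>L\<^sup>2\<close>.\<close>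
lemma H1_0_orthogonal_bounded_gradient:
  fixes \<Omega> :: "'a::euclidean_space set"
  assumes \<Omega>: "open \<Omega>" "\<Omega> \<in> lmeasurable" and H: "H_space \<Omega> g" and H1: "H1_0 \<Omega> g G"
    and q: "Ck_on 1 \<Omega> q" and Bq: "\<And>x. x \<in> \<Omega> \<Longrightarrow> \<bar>q x\<bar> \<le> B" and Bg: "\<And>x. x \<in> \<Omega> \<Longrightarrow> norm (grad q x) \<le> B'"
  shows "(LINT x:\<Omega>|lebesgue. g x \<bullet> grad q x) = 0"
proof -
  have m\<Omega>: "\<Omega> \<in> sets lebesgue" "\<Omega> \<in> sets borel" using \<Omega> by auto
  have G: "weak_grad \<Omega> g G" using H1 by (simp add: H1_0_def)
  obtain \<phi> where \<phi>: "\<And>n. test_fun \<Omega> (\<phi> n)" and lim0: "(\<lambda>n. L2sq \<Omega> (\<lambda>x. \<phi> n x - g x)) \<longlonglongrightarrow> 0"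
    and lim1: "\<And>b. b \<in> Basis \<Longrightarrow> (\<lambda>n. L2sq \<Omega> (\<lambda>x. pd (\<phi> n) x b - G x b)) \<longlonglongrightarrow> 0"
    using H1 unfolding H1_0_def by blast
  have g: "L2_on \<Omega> g" and Gb: "\<And>b. b \<in> Basis \<Longrightarrow> L2_on \<Omega> (\<lambda>x. G x b)"
    using G m\<Omega> by (auto simp: weak_grad_def intro: in_L2_imp_L2_on)
  define D where "D x = (\<Sum>b\<in>Basis. G x b \<bullet> b)" for x
  define d where "d n x = (\<Sum>b\<in>Basis. pd (\<phi> n) x b \<bullet> b)" for n x
  have dtest: "test_fun \<Omega> (d n)" for n unfolding d_def by (rule test_fun_divergence[OF \<phi>])
  have LD: "L2_on \<Omega> D" unfolding D_def by (rule L2_on_divergence(1)[OF Gb])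
  have Ld: "L2_on \<Omega> (d n)" for n by (rule L2_on_test_fun[OF \<Omega> dtest])
  have limd: "(\<lambda>n. L2sq \<Omega> (\<lambda>x. d n x - D x)) \<longlonglongrightarrow> 0"
  proof (rule tendsto_sandwich[OF _ _ tendsto_const])
    have "L2sq \<Omega> (\<lambda>x. d n x - D x) \<le> DIM('a) * (\<Sum>b\<in>Basis. L2sq \<Omega> (\<lambda>x. pd (\<phi> n) x b - G x b))" for n
      using L2_on_divergence(2)[of \<Omega> "\<lambda>x b. pd (\<phi> n) x b - G x b", OF L2_on_diff[OF L2_on_pd_test_fun[OF \<Omega> \<phi>] Gb]]
      by (simp add: d_def D_def inner_diff_left sum_subtractf)
    then show "\<forall>\<^sub>F n in sequentially. L2sq \<Omega> (\<lambda>x. d n x - D x) \<le> DIM('a) * (\<Sum>b\<in>Basis. L2sq \<Omega> (\<lambda>x. pd (\<phi> n) x b - G x b))"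
      by simp
    have "(\<lambda>n. DIM('a) * (\<Sum>b\<in>Basis. L2sq \<Omega> (\<lambda>x. pd (\<phi> n) x b - G x b))) \<longlonglongrightarrow> DIM('a) * (\<Sum>b\<in>(Basis::'a set). (0::real))"
      by (intro tendsto_intros lim1)
    then show "(\<lambda>n. DIM('a) * (\<Sum>b\<in>Basis. L2sq \<Omega> (\<lambda>x. pd (\<phi> n) x b - G x b))) \<longlonglongrightarrow> 0" by simp
  qed (simp add: L2sq_nonneg)
  have "(LINT x:\<Omega>|lebesgue. d n x \<bullet> D x) = 0" for n
    using H_space_weak_divergence[OF \<Omega> H G dtest[of n]] by (simp add: D_def mult.commute)
  then have "(LINT x:\<Omega>|lebesgue. D x \<bullet> D x) = 0"
    using L2_tendsto_inner[OF Ld LD LD limd] by (simp add: LIMSEQ_const_iff)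
  then have D0: "L2sq \<Omega> D = 0" by (simp add: L2_on_integrable(2)[OF LD] power2_eq_square)
  have Lq: "L2_on \<Omega> q"
    using Ck_on_imp_continuous_on[OF q] m\<Omega> \<Omega> Bq by (intro L2_on_bounded[of _ _ B] set_borel_measurable_lebesgue_continuous_on) auto
  have Lgq: "L2_on \<Omega> (grad q)"
    using continuous_on_grad[OF \<Omega>(1) q] m\<Omega> \<Omega> Bg by (intro L2_on_bounded[of _ _ B'] set_borel_measurable_lebesgue_continuous_on) auto
  \<comment> \<open>Since \<open>D\<close> vanishes in L2, the integrals of \<open>d n\<close>
    against \<open>q\<close> tend to 0. Integration by parts identifies them, up to sign, with those
    of \<open>\<phi> n\<close> against \<open>grad q\<close>, and these tend to the integral
    sought.\<close>
  have "\<bar>LINT x:\<Omega>|lebesgue. D x \<bullet> q x\<bar> \<le> 0" using L2_Cauchy_Schwarz[OF LD Lq] by (simp add: D0)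
  then have "(\<lambda>n. LINT x:\<Omega>|lebesgue. d n x \<bullet> q x) \<longlonglongrightarrow> 0"
    using L2_tendsto_inner[OF Ld LD Lq limd] by simp
  moreover have "(LINT x:\<Omega>|lebesgue. \<phi> n x \<bullet> grad q x) = - (LINT x:\<Omega>|lebesgue. d n x \<bullet> q x)" for n
  proof -
    have "(LINT x:\<Omega>|lebesgue. d n x \<bullet> q x) + (LINT x:\<Omega>|lebesgue. \<phi> n x \<bullet> grad q x)
        = (LINT x:\<Omega>|lebesgue. d n x \<bullet> q x + \<phi> n x \<bullet> grad q x)"
      using L2_on_inner_integrable[OF Ld Lq] L2_on_inner_integrable[OF L2_on_test_fun[OF \<Omega> \<phi>] Lgq]
      by (intro set_integral_add(2)[symmetric])
    then show ?thesis using divergence_integration_by_parts[OF \<Omega>(1) \<phi>[of n] q] by (simp add: d_def)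
  qed
  ultimately have "(\<lambda>n. LINT x:\<Omega>|lebesgue. \<phi> n x \<bullet> grad q x) \<longlonglongrightarrow> 0"
    using tendsto_minus by fastforce
  then show ?thesis
    using L2_tendsto_inner[OF L2_on_test_fun[OF \<Omega> \<phi>] g Lgq lim0] LIMSEQ_unique by blast
qed

text \<open>The pressure need not be bounded up to the boundary, so \<open>q\<close> is replaced by the bounded
  functions \<open>k arctan (q / k)\<close>, whose gradients are dominated by that of \<open>q\<close>.\<close>
lemma L2_limit_orthogonal_gradient:
  fixes \<Omega> :: "'a::euclidean_space set"
  assumes \<Omega>: "open \<Omega>" "\<Omega> \<in> lmeasurable" and H: "\<And>n. H_space \<Omega> (g n)" and H1: "\<And>n. H1_0 \<Omega> (g n) (G n)"
    and w: "L2_on \<Omega> w" and lim: "(\<lambda>n::nat. L2sq \<Omega> (\<lambda>x. g n x - w x)) \<longlonglongrightarrow> 0"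
    and q: "Ck_on 1 \<Omega> q" and Bg: "\<And>x. x \<in> \<Omega> \<Longrightarrow> norm (grad q x) \<le> B"
  shows "(LINT x:\<Omega>|lebesgue. w x \<bullet> grad q x) = 0"
proof -
  have m\<Omega>: "\<Omega> \<in> sets lebesgue" "\<Omega> \<in> sets borel" using \<Omega> by auto
  define k where "k m = real (Suc m)" for m
  define Q where "Q m x = k m * arctan (q x / k m)" for m x
  \<comment> \<open>\<open>c m x\<close> is the derivative of
    \<open>y \<mapsto> k m * arctan (y / k m)\<close> at \<open>q x\<close>. It lies between 0 and
    1, which preserves the gradient bound, and tends to 1 with \<open>m\<close>, which recovers
    \<open>grad q\<close>.\<close>
  define c where "c m x = 1 / (1 + (q x / k m)\<^sup>2)" for m x
  have kpos: "k m > 0" for m by (simp add: k_def)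
  have cpos: "0 < 1 + (q x / k m)\<^sup>2" for m x by (rule add_pos_nonneg) auto
  have c01: "0 \<le> c m x" "c m x \<le> 1" for m x unfolding c_def using cpos[of x m] by auto
  have Qd: "(Q m has_derivative (\<lambda>h. c m x * frechet_derivative q (at x) h)) (at x)" if "x \<in> \<Omega>" for m x
  proof -
    have qd: "(q has_derivative frechet_derivative q (at x)) (at x)"
      using Ck_on_1D(1)[OF q \<Omega>(1) that] by (simp add: frechet_derivative_works)
    have "((\<lambda>y. k m * arctan (y / k m)) has_field_derivative c m x) (at (q x))"
      unfolding c_def using kpos[of m] cpos[of x m]
      by (auto intro!: derivative_eq_intros simp: inverse_eq_divide)
    then have "((\<lambda>y. k m * arctan (y / k m)) has_derivative (*) (c m x)) (at (q x))"
      by (simp add: has_field_derivative_def)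
    from has_derivative_compose[OF qd this] show ?thesis unfolding Q_def .
  qed
  have pdQ: "pd (Q m) x b = c m x * pd q x b" if "x \<in> \<Omega>" for m x b
    using frechet_derivative_at[OF Qd[OF that], symmetric] by (simp add: pd_def)
  have gradQ: "grad (Q m) x = c m x *\<^sub>R grad q x" if "x \<in> \<Omega>" for m x
    by (simp add: grad_def pdQ[OF that] scaleR_sum_right)
  have cq: "continuous_on \<Omega> q" using Ck_on_imp_continuous_on[OF q] .
  have cc: "continuous_on \<Omega> (c m)" for m unfolding c_def using cpos kpos
    by (intro continuous_intros cq) (auto simp: less_imp_neq[symmetric])
  have QC1: "Ck_on 1 \<Omega> (Q m)" for m
  proof -
    have "Q m differentiable_on \<Omega>"
      using Qd \<Omega>(1) by (auto simp: differentiable_on_eq_differentiable_at differentiable_def)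
    moreover have "continuous_on \<Omega> (\<lambda>x. pd (Q m) x b)" if "b \<in> Basis" for b
      by (rule continuous_on_eq[of _ "\<lambda>x. c m x * pd q x b"])
        (auto simp: pdQ intro!: continuous_on_mult cc Ck_on_1D(2)[OF q \<Omega>(1) that])
    ultimately show ?thesis by simp
  qed
  have Qb: "\<bar>Q m x\<bar> \<le> k m * (pi/2)" for m x
  proof -
    have "\<bar>arctan (q x / k m)\<bar> \<le> pi/2" using arctan_bounded[of "q x / k m"] by auto
    then show ?thesis unfolding Q_def abs_mult using kpos[of m] by simp
  qed
  have Qg: "norm (grad (Q m) x) \<le> B" if "x \<in> \<Omega>" for m x
  proof -
    have "norm (grad (Q m) x) \<le> 1 * norm (grad q x)"
      unfolding gradQ[OF that] norm_scaleR using c01[of m x] by (intro mult_right_mono) auto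
    then show ?thesis using Bg[OF that] by simp
  qed
  have LQ: "L2_on \<Omega> (grad (Q m))" for m
    using continuous_on_grad[OF \<Omega>(1) QC1] m\<Omega> \<Omega> Qg by (intro L2_on_bounded[of _ _ B] set_borel_measurable_lebesgue_continuous_on) auto
  have Lgq: "L2_on \<Omega> (grad q)"
    using continuous_on_grad[OF \<Omega>(1) q] m\<Omega> \<Omega> Bg by (intro L2_on_bounded[of _ _ B] set_borel_measurable_lebesgue_continuous_on) auto
  have Lg: "L2_on \<Omega> (g n)" for n
    using H m\<Omega> by (intro in_L2_imp_L2_on) (auto simp: H_space_def)
  \<comment> \<open>The limit in \<open>n\<close> is taken first, with \<open>m\<close> fixed,
    because orthogonality of the \<open>g n\<close> is known for the bounded \<open>Q m\<close>. The
    limit in \<open>m\<close> follows by dominated convergence, with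
    \<open>\<bar>w x \<bullet> grad q x\<bar>\<close> as majorant.\<close>
  have wQ: "(LINT x:\<Omega>|lebesgue. w x \<bullet> grad (Q m) x) = 0" for m
  proof -
    have "(LINT x:\<Omega>|lebesgue. g n x \<bullet> grad (Q m) x) = 0" for n
      by (rule H1_0_orthogonal_bounded_gradient[OF \<Omega> H H1 QC1 Qb Qg])
    then show ?thesis using L2_tendsto_inner[OF Lg w LQ[of m] lim] by (simp add: LIMSEQ_const_iff)
  qed
  have int: "set_integrable lebesgue \<Omega> (\<lambda>x. w x \<bullet> grad q x)" by (rule L2_on_inner_integrable[OF w Lgq])
  have "(\<lambda>m. LINT x:\<Omega>|lebesgue. w x \<bullet> grad (Q m) x) \<longlonglongrightarrow> (LINT x:\<Omega>|lebesgue. w x \<bullet> grad q x)"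
    unfolding set_lebesgue_integral_def
  proof (rule integral_dominated_convergence)
    show "(\<lambda>x. indicat_real \<Omega> x *\<^sub>R (w x \<bullet> grad q x)) \<in> borel_measurable lebesgue"
      using int unfolding set_integrable_def by auto
    show "(\<lambda>x. indicat_real \<Omega> x *\<^sub>R (w x \<bullet> grad (Q m) x)) \<in> borel_measurable lebesgue" for m
      using L2_on_inner_integrable[OF w LQ] unfolding set_integrable_def by auto
    show "integrable lebesgue (\<lambda>x. \<bar>indicat_real \<Omega> x *\<^sub>R (w x \<bullet> grad q x)\<bar>)"
      using int unfolding set_integrable_def by (rule integrable_abs)
    show "AE x in lebesgue. norm (indicat_real \<Omega> x *\<^sub>R (w x \<bullet> grad (Q m) x)) \<le> \<bar>indicat_real \<Omega> x *\<^sub>R (w x \<bullet> grad q x)\<bar>" for m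
    proof (rule AE_I2)
      fix x
      show "norm (indicat_real \<Omega> x *\<^sub>R (w x \<bullet> grad (Q m) x)) \<le> \<bar>indicat_real \<Omega> x *\<^sub>R (w x \<bullet> grad q x)\<bar>"
        using c01[of m x] by (cases "x \<in> \<Omega>") (auto simp: gradQ abs_mult mult_left_le_one_le)
    qed
    have "(\<lambda>m. indicat_real \<Omega> x *\<^sub>R (w x \<bullet> grad (Q m) x)) \<longlonglongrightarrow> indicat_real \<Omega> x *\<^sub>R (w x \<bullet> grad q x)" for x
    proof (cases "x \<in> \<Omega>")
      case True
      have "(\<lambda>m. q x / k m) \<longlonglongrightarrow> 0" unfolding k_def
        by (rule LIMSEQ_Suc[OF lim_const_over_n])
      then have "(\<lambda>m. 1 / (1 + (q x / k m)\<^sup>2)) \<longlonglongrightarrow> 1 / (1 + 0\<^sup>2)" by (intro tendsto_intros) auto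
      then have "(\<lambda>m. c m x) \<longlonglongrightarrow> 1" by (simp add: c_def)
      then have "(\<lambda>m. c m x * (w x \<bullet> grad q x)) \<longlonglongrightarrow> 1 * (w x \<bullet> grad q x)" by (intro tendsto_intros)
      then show ?thesis using True by (simp add: gradQ)
    qed simp
    then show "AE x in lebesgue. (\<lambda>m. indicat_real \<Omega> x *\<^sub>R (w x \<bullet> grad (Q m) x)) \<longlonglongrightarrow> indicat_real \<Omega> x *\<^sub>R (w x \<bullet> grad q x)"
      by simp
  qed
  then show ?thesis by (simp add: wQ LIMSEQ_const_iff)
qed

section \<open>Forcing, vorticity and dissipation\<close>

text \<open>A real supremum is informative only over a set bounded above. Boundedness of the values
  and of the derivatives makes both parts of \<open>C1nrm\<close> genuine suprema, and the
  derivative part is then nonnegative.\<close>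

lemma norm_le_C1nrm:
  fixes g :: "'a::euclidean_space \<Rightarrow> 'b::real_normed_vector"
  assumes "bounded (g ` \<Omega>)" "\<And>b. b \<in> Basis \<Longrightarrow> bounded ((\<lambda>x. pd g x b) ` \<Omega>)" "x \<in> \<Omega>"
  shows "norm (g x) \<le> C1nrm \<Omega> g"
proof -
  have bdd: "bdd_above ((\<lambda>x. norm (h x)) ` \<Omega>)" if "bounded (h ` \<Omega>)" for h :: "'a \<Rightarrow> 'b"
    using that unfolding bounded_iff bdd_above_def by auto
  have "norm (g x) \<le> (SUP x\<in>\<Omega>. norm (g x))" using bdd[OF assms(1)] assms(3) by (intro cSUP_upper) auto
  moreover have "0 \<le> (\<Sum>b\<in>Basis. SUP x\<in>\<Omega>. norm (pd g x b))"
  proof (rule sum_nonneg)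
    fix b :: 'a assume "b \<in> Basis"
    then have "norm (pd g x b) \<le> (SUP x\<in>\<Omega>. norm (pd g x b))"
      using bdd[OF assms(2)] assms(3) by (intro cSUP_upper) auto
    then show "0 \<le> (SUP x\<in>\<Omega>. norm (pd g x b))" using norm_ge_zero order_trans by blast
  qed
  ultimately show ?thesis by (simp add: C1nrm_def)
qed

lemma bounded_diff_scaleR_image:
  fixes f g h :: "'a \<Rightarrow> 'b::real_normed_vector"
  assumes "bounded (f ` S)" "bounded (g ` S)" "bounded (h ` S)"
  shows "bounded ((\<lambda>x. f x - g x - c *\<^sub>R h x) ` S)"
  using assms by (intro bounded_minus_comp bounded_scaleR_comp)

text \<open>Differentiability in time holds in the C1 norm and is therefore uniform in the space
  variable. This Lipschitz consequence yields both the joint continuity of the force and its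
  boundedness over compact time intervals.\<close>

lemma C1_time_C1_locally_uniform:
  assumes "open \<Omega>" "C1_time_C1 \<Omega> f"
  shows "\<exists>d>0. \<exists>L>0. \<forall>s. \<bar>s - t\<bar> < d \<longrightarrow> (\<forall>x\<in>\<Omega>. norm (f s x - f t x) \<le> L * \<bar>s - t\<bar>)"
proof -
  obtain f' where C1: "\<And>t. C1b \<Omega> (f t)" "\<And>t. C1b \<Omega> (f' t)"
    and lim: "((\<lambda>s. C1nrm \<Omega> (\<lambda>x. f s x - f t x - (s - t) *\<^sub>R f' t x) / \<bar>s - t\<bar>) \<longlongrightarrow> 0) (at t)"
    using assms(2) unfolding C1_time_C1_def by blast
  have diff: "g differentiable (at x)" if "C1b \<Omega> g" "x \<in> \<Omega>" for g :: "'a \<Rightarrow> 'b" and x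
    using that Ck_on_1D(1)[OF _ assms(1)] by (auto simp: C1b_def)
  have pdc: "pd (\<lambda>x. f s x - f t x - (s - t) *\<^sub>R f' t x) x b = pd (f s) x b - pd (f t) x b - (s - t) *\<^sub>R pd (f' t) x b"
    if "x \<in> \<Omega>" for s x b
  proof -
    have "((\<lambda>x. f s x - f t x - (s - t) *\<^sub>R f' t x) has_derivative (\<lambda>h. frechet_derivative (f s) (at x) h
        - frechet_derivative (f t) (at x) h - (s - t) *\<^sub>R frechet_derivative (f' t) (at x) h)) (at x)"
      using diff[OF C1(1) that] diff[OF C1(2) that]
      by (intro has_derivative_diff has_derivative_scaleR_right) (auto simp: frechet_derivative_works)
    from frechet_derivative_at[OF this, symmetric] show ?thesis by (simp add: pd_def)
  qed
  have key: "norm (f s x - f t x - (s - t) *\<^sub>R f' t x) \<le> C1nrm \<Omega> (\<lambda>x. f s x - f t x - (s - t) *\<^sub>R f' t x)"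
    if "x \<in> \<Omega>" for s x
  proof (rule norm_le_C1nrm[OF _ _ that])
    show "bounded ((\<lambda>x. f s x - f t x - (s - t) *\<^sub>R f' t x) ` \<Omega>)"
      using C1 by (intro bounded_diff_scaleR_image) (auto simp: C1b_def)
    fix b :: 'a assume "b \<in> Basis"
    then have "bounded ((\<lambda>x. pd (f s) x b - pd (f t) x b - (s - t) *\<^sub>R pd (f' t) x b) ` \<Omega>)"
      using C1 by (intro bounded_diff_scaleR_image) (auto simp: C1b_def)
    then show "bounded ((\<lambda>x. pd (\<lambda>x. f s x - f t x - (s - t) *\<^sub>R f' t x) x b) ` \<Omega>)"
      by (simp add: pdc cong: image_cong)
  qed
  obtain B where B: "B > 0" "\<And>x. x \<in> \<Omega> \<Longrightarrow> norm (f' t x) \<le> B"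
    using C1(2)[of t] unfolding C1b_def bounded_pos by auto
  obtain d where d: "d > 0" "\<And>s. s \<noteq> t \<Longrightarrow> \<bar>s - t\<bar> < d \<Longrightarrow>
      C1nrm \<Omega> (\<lambda>x. f s x - f t x - (s - t) *\<^sub>R f' t x) / \<bar>s - t\<bar> < 1"
    using order_tendstoD(2)[OF lim, of 1] unfolding eventually_at dist_real_def by auto
  \<comment> \<open>The 1 comes from the remainder, whose quotient by
    \<open>\<bar>s - t\<bar>\<close> is below 1 for \<open>s\<close> near \<open>t\<close>;
    \<open>B\<close> bounds the time derivative at \<open>t\<close>.\<close>
  have "norm (f s x - f t x) \<le> (1 + B) * \<bar>s - t\<bar>" if s: "\<bar>s - t\<bar> < d" and x: "x \<in> \<Omega>" for s x
  proof (cases "s = t")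
    case False
    have "C1nrm \<Omega> (\<lambda>x. f s x - f t x - (s - t) *\<^sub>R f' t x) \<le> \<bar>s - t\<bar>"
      using d(2)[OF False s] False by (simp add: divide_less_eq)
    then have "norm (f s x - f t x - (s - t) *\<^sub>R f' t x) \<le> \<bar>s - t\<bar>" using key[OF x, of s] by linarith
    moreover have "norm ((s - t) *\<^sub>R f' t x) \<le> \<bar>s - t\<bar> * B" using B(2)[OF x] by (simp add: mult_left_mono)
    moreover have "norm (f s x - f t x) \<le> norm (f s x - f t x - (s - t) *\<^sub>R f' t x) + norm ((s - t) *\<^sub>R f' t x)"
      using norm_triangle_ineq[of "f s x - f t x - (s - t) *\<^sub>R f' t x" "(s - t) *\<^sub>R f' t x"] by simp
    ultimately show ?thesis by (simp add: algebra_simps)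
  qed simp
  moreover have "1 + B > 0" using B(1) by simp
  ultimately show ?thesis using d(1) by blast
qed

lemma C1_time_C1_continuous_on:
  fixes f :: "real \<Rightarrow> 'a::euclidean_space \<Rightarrow> 'b::real_normed_vector"
  assumes "open \<Omega>" "C1_time_C1 \<Omega> f"
  shows "continuous_on (UNIV \<times> \<Omega>) (\<lambda>z. f (fst z) (snd z))"
  unfolding continuous_on_iff
proof (intro ballI allI impI)
  fix z :: "real \<times> 'a" and e :: real assume z: "z \<in> UNIV \<times> \<Omega>" and e: "0 < e"
  obtain t x where tx: "z = (t, x)" and x: "x \<in> \<Omega>" using z by auto
  obtain d L where d: "d > 0" "L > 0" "\<And>s y. \<bar>s - t\<bar> < d \<Longrightarrow> y \<in> \<Omega> \<Longrightarrow> norm (f s y - f t y) \<le> L * \<bar>s - t\<bar>"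
    using C1_time_C1_locally_uniform[OF assms, of t] by blast
  have "continuous_on \<Omega> (f t)"
    using assms(2) Ck_on_imp_continuous_on unfolding C1_time_C1_def C1b_def by blast
  then obtain d' where d': "d' > 0" "\<And>y. y \<in> \<Omega> \<Longrightarrow> dist y x < d' \<Longrightarrow> dist (f t y) (f t x) < e/2"
    using x half_gt_zero[OF e] unfolding continuous_on_iff by blast
  define r where "r = min (min d d') (e / (2 * L))"
  have "dist (f s y) (f t x) < e" if y: "y \<in> \<Omega>" "dist (s, y) (t, x) < r" for s y
  proof -
    have "\<bar>s - t\<bar> < r" "dist y x < r"
      using y(2) dist_fst_le[of "(s, y)" "(t, x)"] dist_snd_le[of "(s, y)" "(t, x)"] by (auto simp: dist_real_def)
    then have sy: "\<bar>s - t\<bar> < d" "dist y x < d'" "\<bar>s - t\<bar> < e / (2 * L)" by (auto simp: r_def)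
    have "norm (f s y - f t y) \<le> L * \<bar>s - t\<bar>" using d(3)[OF sy(1) y(1)] .
    also have "\<dots> < e/2" using sy(3) d(2) by (simp add: field_simps)
    finally have "dist (f s y) (f t y) < e/2" by (simp add: dist_norm)
    then show ?thesis using d'(2)[OF y(1) sy(2)] dist_triangle[of "f s y" "f t x" "f t y"] by linarith
  qed
  moreover have "r > 0" using d d' e by (simp add: r_def)
  ultimately show "\<exists>d>0. \<forall>z'\<in>UNIV \<times> \<Omega>. dist z' z < d \<longrightarrow> dist (f (fst z') (snd z')) (f (fst z) (snd z)) < e"
    by (intro exI[of _ r]) (simp add: tx)
qed

text \<open>The bounds near single times are glued by compactness of \<open>{0..T}\<close>; the sum
  of the absolute values over a finite cover dominates each of them.\<close>

lemma C1_time_C1_bounded: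
  assumes "open \<Omega>" "C1_time_C1 \<Omega> f"
  shows "\<exists>F\<ge>0. \<forall>t\<in>{0..T}. \<forall>x\<in>\<Omega>. norm (f t x) \<le> F"
proof -
  have "\<exists>d>0. \<exists>B. \<forall>s\<in>ball t d. \<forall>x\<in>\<Omega>. norm (f s x) \<le> B" for t
  proof -
    obtain d L where d: "d > 0" "L > 0" "\<And>s y. \<bar>s - t\<bar> < d \<Longrightarrow> y \<in> \<Omega> \<Longrightarrow> norm (f s y - f t y) \<le> L * \<bar>s - t\<bar>"
      using C1_time_C1_locally_uniform[OF assms, of t] by blast
    have fb: "bounded (f t ` \<Omega>)" using assms(2) by (auto simp: C1_time_C1_def C1b_def)
    obtain B where B: "\<And>x. x \<in> \<Omega> \<Longrightarrow> norm (f t x) \<le> B"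
      using fb unfolding bounded_iff by blast
    have "norm (f s x) \<le> L * d + B" if "s \<in> ball t d" "x \<in> \<Omega>" for s x
    proof -
      have s: "\<bar>s - t\<bar> < d" using that(1) by (simp add: dist_real_def abs_minus_commute)
      have "L * \<bar>s - t\<bar> \<le> L * d" using s d(2) by simp
      then have "norm (f s x - f t x) \<le> L * d" using d(3)[OF s that(2)] by linarith
      then show ?thesis using B[OF that(2)] norm_triangle_sub[of "f s x" "f t x"] by linarith
    qed
    then show ?thesis using d(1) by blast
  qed
  then obtain d B where d: "\<And>t. d t > 0" and B: "\<And>t s x. s \<in> ball t (d t) \<Longrightarrow> x \<in> \<Omega> \<Longrightarrow> norm (f s x) \<le> B t"
    by metis
  have cov: "{0..T} \<subseteq> (\<Union>t\<in>{0..T}. ball t (d t))" using d by force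
  obtain I where I: "finite I" "{0..T} \<subseteq> (\<Union>t\<in>I. ball t (d t))"
    by (rule compactE_image[OF compact_Icc _ cov]) (simp, blast)
  have "norm (f s x) \<le> (\<Sum>t\<in>I. \<bar>B t\<bar>)" if "s \<in> {0..T}" "x \<in> \<Omega>" for s x
  proof -
    obtain t where t: "t \<in> I" "s \<in> ball t (d t)" using I(2) \<open>s \<in> {0..T}\<close> by blast
    have "norm (f s x) \<le> \<bar>B t\<bar>" using B[OF t(2) that(2)] by linarith
    also have "\<dots> \<le> (\<Sum>t\<in>I. \<bar>B t\<bar>)" using t(1) I(1) by (intro member_le_sum) auto
    finally show ?thesis .
  qed
  then show ?thesis by (intro exI[of _ "\<Sum>t\<in>I. \<bar>B t\<bar>"]) (auto intro: sum_nonneg)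
qed

text \<open>Each entry obeys
  \<open>((a - b) / 2)\<^sup>2 \<le> a\<^sup>2 / 2 + b\<^sup>2 / 2\<close>. After exchanging the
  indices the two halves have the same sum, so the constant is 1.\<close>

lemma vort_abs_power2_le: "(vort_abs Du t x)\<^sup>2 \<le> (\<Sum>b\<in>Basis. (norm (Du t x b))\<^sup>2)"
proof -
  have nb: "(norm (Du t x j))\<^sup>2 = (\<Sum>i\<in>Basis. (Du t x j \<bullet> i)\<^sup>2)" for j
    unfolding power2_norm_eq_inner by (subst euclidean_inner) (simp add: power2_eq_square)
  let ?a = "\<lambda>i j. Du t x j \<bullet> i"
  have "(vort_abs Du t x)\<^sup>2 = (\<Sum>i\<in>Basis. \<Sum>j\<in>Basis. ((?a i j - ?a j i) / 2)\<^sup>2)"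
    unfolding vort_abs_def by (simp add: sum_nonneg)
  also have "\<dots> \<le> (\<Sum>i\<in>Basis. \<Sum>j\<in>Basis. (?a i j)\<^sup>2 / 2 + (?a j i)\<^sup>2 / 2)"
  proof (intro sum_mono)
    fix i j
    show "((?a i j - ?a j i) / 2)\<^sup>2 \<le> (?a i j)\<^sup>2 / 2 + (?a j i)\<^sup>2 / 2"
      using sum_squares_ge_zero[of "?a i j + ?a j i" 0] by (simp add: power2_eq_square field_simps)
  qed
  also have "\<dots> = (\<Sum>i\<in>Basis. \<Sum>j\<in>Basis. (?a i j)\<^sup>2) / 2 + (\<Sum>i\<in>Basis. \<Sum>j\<in>Basis. (?a j i)\<^sup>2) / 2"
    by (simp add: sum.distrib sum_divide_distrib)
  also have "(\<Sum>i\<in>Basis. \<Sum>j\<in>Basis. (?a i j)\<^sup>2) = (\<Sum>j\<in>Basis. \<Sum>i\<in>Basis. (?a i j)\<^sup>2)" by (rule sum.swap)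
  also have "(\<Sum>j\<in>Basis. \<Sum>i\<in>Basis. (?a i j)\<^sup>2) / 2 + (\<Sum>i\<in>Basis. \<Sum>j\<in>Basis. (?a j i)\<^sup>2) / 2
      = (\<Sum>b\<in>Basis. (norm (Du t x b))\<^sup>2)"
    by (simp add: nb)
  finally show ?thesis .
qed

lemma vort_abs_measurable:
  assumes "\<And>b. b \<in> Basis \<Longrightarrow> (\<lambda>x. Du t x b) \<in> borel_measurable M"
  shows "(\<lambda>x. vort_abs Du t x) \<in> borel_measurable M"
proof -
  have "(\<lambda>x. ((Du t x j \<bullet> i - Du t x i \<bullet> j) / 2)\<^sup>2) \<in> borel_measurable M" if "i \<in> Basis" "j \<in> Basis" for i j
    using assms[OF that(1)] assms[OF that(2)] by measurable
  then have [measurable]: "(\<lambda>x. \<Sum>i\<in>Basis. \<Sum>j\<in>Basis. ((Du t x j \<bullet> i - Du t x i \<bullet> j) / 2)\<^sup>2) \<in> borel_measurable M"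
    by (intro borel_measurable_sum)
  show ?thesis unfolding vort_abs_def by measurable
qed

section \<open>Layer estimate and uniform energy bound for the Navier-Stokes solutions\<close>

abbreviation dissipation :: "'d::euclidean_space set \<Rightarrow> (real \<Rightarrow> 'd \<Rightarrow> 'd \<Rightarrow> 'd) \<Rightarrow> real \<Rightarrow> ennreal" where
  "dissipation \<Omega> Du t \<equiv> (\<Sum>b\<in>Basis. L2sq_enn \<Omega> (\<lambda>x. Du t x b))"

lemma dissipation_measurable:
  fixes \<Omega> :: "'d::euclidean_space set"
  assumes "open \<Omega>" and m: "\<And>b. b \<in> Basis \<Longrightarrow> (\<lambda>z::real \<times> 'd. Du (fst z) (snd z) b) \<in> borel_measurable lebesgue"
  shows "dissipation \<Omega> Du \<in> borel_measurable lebesgue"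
proof (rule borel_measurable_sum)
  fix b :: 'd assume "b \<in> Basis"
  define h where "h z = ennreal ((norm (Du (fst z) (snd z) b))\<^sup>2) * indicator (UNIV \<times> \<Omega>) z" for z :: "real \<times> 'd"
  have "open ((UNIV::real set) \<times> \<Omega>)" using assms(1) by (simp add: open_Times)
  then have [measurable]: "(UNIV::real set) \<times> \<Omega> \<in> sets lebesgue" by auto
  note [measurable] = m[OF \<open>b \<in> Basis\<close>]
  have "h \<in> borel_measurable lebesgue" unfolding h_def by measurable
  from lebesgue_prod_Tonelli(2)[OF this]
  show "(\<lambda>t. L2sq_enn \<Omega> (\<lambda>x. Du t x b)) \<in> borel_measurable lebesgue"
    unfolding L2sq_enn_def by (simp add: h_def indicator_def)
qed

lemma ennsqrt_le: "X \<le> ennreal c \<Longrightarrow> 0 \<le> c \<Longrightarrow> ennsqrt X \<le> ennreal (sqrt c)"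
  by (cases X) (simp_all add: ennsqrt_def top_unique)

lemma vorticity_layer_le:
  fixes \<Omega> :: "'d::euclidean_space set"
  assumes NS: "NS_weak \<Omega> T \<nu> f u0 u Du" and \<Omega>: "open \<Omega>" and S: "S \<in> sets lebesgue" "S \<subseteq> \<Omega>"
    and m: "emeasure lebesgue S \<le> ennreal m" "0 \<le> m"
  shows "L2L1_norm T S (vort_abs Du) \<le> ennreal (sqrt (m * enn2real (\<integral>\<^sup>+t\<in>{0..T}. dissipation \<Omega> Du t \<partial>lebesgue)))"
proof -
  have mDu: "\<And>b. b \<in> Basis \<Longrightarrow> (\<lambda>z::real \<times> 'd. Du (fst z) (snd z) b) \<in> borel_measurable lebesgue"
    and H1: "AE t in lebesgue. t \<in> {0..T} \<longrightarrow> H1_0 \<Omega> (u t) (Du t)"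
    and fin: "(\<integral>\<^sup>+t\<in>{0..T}. dissipation \<Omega> Du t \<partial>lebesgue) < \<infinity>"
    using NS unfolding NS_weak_def by blast+
  have pt: "(\<integral>\<^sup>+x\<in>S. ennreal (vort_abs Du t x) \<partial>lebesgue)\<^sup>2 \<le> ennreal m * dissipation \<Omega> Du t"
    if "H1_0 \<Omega> (u t) (Du t)" for t
  proof -
    \<comment> \<open>Measurability of the slice comes from \<open>H1_0\<close>, hence at almost
      every time; the joint measurability of \<open>Du\<close> is what makes the dissipation
      measurable in time further below.\<close>
    have mb: "(\<lambda>x. Du t x b) \<in> borel_measurable lebesgue" if "b \<in> Basis" for b
      using \<open>H1_0 \<Omega> (u t) (Du t)\<close> that unfolding H1_0_def weak_grad_def in_L2_def by blast
    have mv: "(\<lambda>x. ennreal (vort_abs Du t x)) \<in> borel_measurable lebesgue"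
      using vort_abs_measurable[of Du t lebesgue] mb by (intro measurable_compose[OF _ measurable_ennreal]) blast
    have mn: "(\<lambda>x. ennreal ((norm (Du t x b))\<^sup>2) * indicator \<Omega> x) \<in> borel_measurable lebesgue" if "b \<in> Basis" for b
    proof -
      note [measurable] = mb[OF that]
      have [measurable]: "\<Omega> \<in> sets lebesgue" using \<Omega> by auto
      show ?thesis by measurable
    qed
    have "(\<integral>\<^sup>+x\<in>S. ennreal (vort_abs Du t x) \<partial>lebesgue)\<^sup>2
        \<le> emeasure lebesgue S * (\<integral>\<^sup>+x\<in>S. (ennreal (vort_abs Du t x))\<^sup>2 \<partial>lebesgue)"
      by (rule nn_integral_power2_le[OF mv S(1)])
    also have "\<dots> \<le> ennreal m * dissipation \<Omega> Du t"
    proof (rule mult_mono[OF m(1)])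
      have "(\<integral>\<^sup>+x\<in>S. (ennreal (vort_abs Du t x))\<^sup>2 \<partial>lebesgue)
          \<le> (\<integral>\<^sup>+x. (\<Sum>b\<in>Basis. ennreal ((norm (Du t x b))\<^sup>2) * indicator \<Omega> x) \<partial>lebesgue)"
      proof (rule nn_integral_mono)
        fix x
        have "0 \<le> vort_abs Du t x" by (simp add: vort_abs_def sum_nonneg)
        then have "(ennreal (vort_abs Du t x))\<^sup>2 \<le> ennreal (\<Sum>b\<in>Basis. (norm (Du t x b))\<^sup>2)"
          using vort_abs_power2_le[of Du t x] by (simp add: ennreal_power ennreal_leI)
        also have "\<dots> = (\<Sum>b\<in>Basis. ennreal ((norm (Du t x b))\<^sup>2))" by (rule sum_ennreal[symmetric]) simp
        finally have le: "(ennreal (vort_abs Du t x))\<^sup>2 \<le> (\<Sum>b\<in>Basis. ennreal ((norm (Du t x b))\<^sup>2))" .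
        show "(ennreal (vort_abs Du t x))\<^sup>2 * indicator S x \<le> (\<Sum>b\<in>Basis. ennreal ((norm (Du t x b))\<^sup>2) * indicator \<Omega> x)"
          using le S(2) by (cases "x \<in> S") auto
      qed
      also have "\<dots> = dissipation \<Omega> Du t" unfolding L2sq_enn_def
        by (rule nn_integral_sum[OF mn])
      finally show "(\<integral>\<^sup>+x\<in>S. (ennreal (vort_abs Du t x))\<^sup>2 \<partial>lebesgue) \<le> dissipation \<Omega> Du t" .
    qed auto
    finally show ?thesis .
  qed
  define D where "D = (\<integral>\<^sup>+t\<in>{0..T}. dissipation \<Omega> Du t \<partial>lebesgue)"
  have mg: "(\<lambda>t. dissipation \<Omega> Du t * indicator {0..T} t) \<in> borel_measurable lebesgue"
  proof -
    define g where "g = dissipation \<Omega> Du"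
    have [measurable]: "g \<in> borel_measurable lebesgue"
      unfolding g_def by (rule dissipation_measurable[OF \<Omega> mDu])
    have [measurable]: "{0..T} \<in> sets lebesgue" by simp
    have "(\<lambda>t. g t * indicator {0..T} t) \<in> borel_measurable lebesgue" by measurable
    then show ?thesis by (simp add: g_def)
  qed
  have "(\<integral>\<^sup>+t\<in>{0..T}. (\<integral>\<^sup>+x\<in>S. ennreal (vort_abs Du t x) \<partial>lebesgue)\<^sup>2 \<partial>lebesgue)
      \<le> (\<integral>\<^sup>+t. ennreal m * (dissipation \<Omega> Du t * indicator {0..T} t) \<partial>lebesgue)"
  proof (rule nn_integral_mono_AE)
    show "AE t in lebesgue. (\<integral>\<^sup>+x\<in>S. ennreal (vort_abs Du t x) \<partial>lebesgue)\<^sup>2 * indicator {0..T} t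
        \<le> ennreal m * (dissipation \<Omega> Du t * indicator {0..T} t)"
      using H1
    proof eventually_elim
      case (elim t)
      then show ?case using pt[of t] by (cases "t \<in> {0..T}") auto
    qed
  qed
  also have "\<dots> = ennreal m * D" unfolding D_def by (rule nn_integral_cmult[OF mg])
  \<comment> \<open>The total dissipation of a weak solution is finite, so passing through
    \<open>enn2real\<close>, which sends an infinite value to 0, loses nothing.\<close>
  also have "\<dots> = ennreal (m * enn2real D)"
    using fin m(2) unfolding D_def[symmetric] by (simp add: ennreal_mult)
  finally show ?thesis unfolding L2L1_norm_def D_def[symmetric]
    using m(2) by (intro ennsqrt_le) auto
qed

text \<open>The work of the force is at most \<open>c * sqrt m\<close>, where \<open>m\<close> is
  the supremum over time of \<open>L2sq \<Omega> (u t)\<close>. Being sublinear in \<open>m\<close>,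
  it can be absorbed: the a priori bound contained in \<open>NS_weak\<close> makes \<open>m\<close>
  finite, and the energy inequality then bounds \<open>m\<close> by data that do not involve
  \<nu>.\<close>

lemma NS_weak_energy_bound:
  fixes \<Omega> :: "'d::euclidean_space set"
  assumes NS: "NS_weak \<Omega> T \<nu> f u0 u Du" and \<Omega>: "open \<Omega>" "\<Omega> \<in> lmeasurable" and T: "0 \<le> T" and \<nu>: "0 < \<nu>"
    and F: "0 \<le> F" "\<And>t x. t \<in> {0..T} \<Longrightarrow> x \<in> \<Omega> \<Longrightarrow> norm (f t x) \<le> F"
  shows "\<nu> * enn2real (\<integral>\<^sup>+t\<in>{0..T}. dissipation \<Omega> Du t \<partial>lebesgue)
    \<le> L2sq \<Omega> u0 + 2 * (F * sqrt (measure lebesgue \<Omega>) * T)\<^sup>2"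
proof -
  have mu: "(\<lambda>z::real \<times> 'd. u (fst z) (snd z)) \<in> borel_measurable lebesgue"
    and H: "\<And>t. t \<in> {0..T} \<Longrightarrow> H_space \<Omega> (u t)"
    and bd: "\<exists>M. \<forall>t\<in>{0..T}. L2sq \<Omega> (u t) \<le> M"
    and en: "\<And>t. t \<in> {0..T} \<Longrightarrow> L2sq \<Omega> (u t)
          + 2 * \<nu> * enn2real (\<integral>\<^sup>+s\<in>{0..t}. dissipation \<Omega> Du s \<partial>lebesgue)
        \<le> L2sq \<Omega> u0 + 2 * (LINT z:({0..t} \<times> \<Omega>)|lebesgue. f (fst z) (snd z) \<bullet> u (fst z) (snd z))"
    using NS unfolding NS_weak_def by blast+
  define c where "c = F * sqrt (measure lebesgue \<Omega>) * T"
  define m where "m = (SUP t\<in>{0..T}. L2sq \<Omega> (u t))"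
  have bdd: "bdd_above ((\<lambda>t. L2sq \<Omega> (u t)) ` {0..T})" using bd by (auto simp: bdd_above_def)
  have mge: "L2sq \<Omega> (u t) \<le> m" if "t \<in> {0..T}" for t
    unfolding m_def using that bdd by (intro cSUP_upper)
  have m0: "0 \<le> m" using mge[of 0] L2sq_nonneg[of \<Omega> "u 0"] T by simp
  have c0: "0 \<le> c" using F(1) T by (simp add: c_def)
  have L: "L2_on \<Omega> (u t)" if "t \<in> {0..T}" for t
    using H[OF that] \<Omega> by (intro in_L2_imp_L2_on) (auto simp: H_space_def)
  have work: "\<bar>LINT z:({0..t} \<times> \<Omega>)|lebesgue. f (fst z) (snd z) \<bullet> u (fst z) (snd z)\<bar> \<le> c * sqrt m"
    if t: "t \<in> {0..T}" for t
  proof -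
    have "\<bar>LINT z:({0..t} \<times> \<Omega>)|lebesgue. f (fst z) (snd z) \<bullet> u (fst z) (snd z)\<bar>
        \<le> F * sqrt m * sqrt (measure lebesgue \<Omega>) * t"
    proof (rule abs_LINT_time_space_le[where g = u])
      have "{0..t} \<times> \<Omega> \<in> sets borel" using \<Omega>(1) by (intro borel_Times) auto
      then have [measurable]: "{0..t} \<times> \<Omega> \<in> sets lebesgue" by simp
      note [measurable] = mu
      show "(\<lambda>z. indicator ({0..t} \<times> \<Omega>) z * ennreal (norm (u (fst z) (snd z)))) \<in> borel_measurable lebesgue"
        by measurable
      show "\<bar>f (fst (s, x)) (snd (s, x)) \<bullet> u (fst (s, x)) (snd (s, x))\<bar> \<le> F * norm (u s x)"
        if "s \<in> {0..t}" "x \<in> \<Omega>" for s x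
      proof -
        have "\<bar>f s x \<bullet> u s x\<bar> \<le> norm (f s x) * norm (u s x)" by (rule Cauchy_Schwarz_ineq2)
        also have "\<dots> \<le> F * norm (u s x)" using F(2)[of s x] that t by (intro mult_right_mono) auto
        finally show ?thesis by simp
      qed
      show "AE s in lebesgue. s \<in> {0..t} \<longrightarrow> L2sq_enn \<Omega> (u s) \<le> ennreal ((sqrt m)\<^sup>2)"
        using t mge L m0 by (intro AE_I2) (auto simp: L2_on_enn ennreal_leI)
    qed (use \<Omega> t F m0 in auto)
    also have "\<dots> \<le> F * sqrt m * sqrt (measure lebesgue \<Omega>) * T"
      using t F(1) m0 by (intro mult_left_mono) auto
    finally show ?thesis by (simp add: c_def mult_ac)
  qed
  \<comment> \<open>Young's inequality is weighted so as to leave \<open>m / 2\<close>. The supremum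
    over time of the resulting energy bound gives
    \<open>m \<le> 2 * L2sq \<Omega> u0 + 4 * c\<^sup>2\<close>.\<close>
  have sq: "2 * (c * sqrt m) \<le> 2 * c\<^sup>2 + m / 2"
    using zero_le_power2[of "2 * c - sqrt m"] m0 by (simp add: power2_eq_square algebra_simps)
  have en2: "L2sq \<Omega> (u t) + 2 * \<nu> * enn2real (\<integral>\<^sup>+s\<in>{0..t}. dissipation \<Omega> Du s \<partial>lebesgue)
      \<le> L2sq \<Omega> u0 + 2 * c\<^sup>2 + m / 2" if "t \<in> {0..T}" for t
    using en[OF that] work[OF that] sq by linarith
  have "m \<le> L2sq \<Omega> u0 + 2 * c\<^sup>2 + m / 2"
    unfolding m_def
  proof (rule cSUP_least)
    show "L2sq \<Omega> (u t) \<le> L2sq \<Omega> u0 + 2 * c\<^sup>2 + (SUP t\<in>{0..T}. L2sq \<Omega> (u t)) / 2" if "t \<in> {0..T}" for t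
    proof -
      have "0 \<le> 2 * \<nu> * enn2real (\<integral>\<^sup>+s\<in>{0..t}. dissipation \<Omega> Du s \<partial>lebesgue)" using \<nu> by simp
      then show ?thesis using en2[OF that] unfolding m_def by linarith
    qed
  qed (use T in auto)
  then have "m \<le> 2 * L2sq \<Omega> u0 + 4 * c\<^sup>2" by linarith
  then show ?thesis
    using en2[of T] T L2sq_nonneg[of \<Omega> "u T"] unfolding c_def[symmetric] by simp
qed

section \<open>Energy balance of the Euler solution\<close>

lemma Basis_prod_mem:
  "(1::real, 0::'a::euclidean_space) \<in> Basis" "b \<in> Basis \<Longrightarrow> (0::real, b::'a::euclidean_space) \<in> Basis"
  by (auto simp: Basis_prod_def)

lemma has_derivative_section:
  assumes "v differentiable (at (s, x))"
  shows "((\<lambda>y. v (s, y)) has_derivative (\<lambda>h. frechet_derivative v (at (s, x)) (0, h))) (at x)"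
    and "((\<lambda>r. v (r, x)) has_derivative (\<lambda>h. frechet_derivative v (at (s, x)) (h, 0))) (at s)"
proof -
  have v: "(v has_derivative frechet_derivative v (at (s, x))) (at (s, x))"
    using assms by (simp add: frechet_derivative_works)
  have "((\<lambda>y. (s, y)) has_derivative (\<lambda>h. (0, h))) (at x)" by (auto intro!: derivative_eq_intros)
  from has_derivative_compose[OF this v]
  show "((\<lambda>y. v (s, y)) has_derivative (\<lambda>h. frechet_derivative v (at (s, x)) (0, h))) (at x)" .
  have "((\<lambda>r. (r, x)) has_derivative (\<lambda>h. (h, 0))) (at s)" by (auto intro!: derivative_eq_intros)
  from has_derivative_compose[OF this v]
  show "((\<lambda>r. v (r, x)) has_derivative (\<lambda>h. frechet_derivative v (at (s, x)) (h, 0))) (at s)" .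
qed

text \<open>The convection term and the gradient of half the squared speed have the same scalar
  product with the velocity. Pairing the momentum equation with the velocity therefore equates the
  integrand with the velocity paired with the gradient of the total head, and that integral vanishes
  because the velocity is an L2 limit of the fields \<open>g n\<close>. Time is fixed
  throughout.\<close>

lemma Euler_momentum_orthogonality:
  fixes \<Omega> :: "'d::euclidean_space set" and s :: real
  assumes \<Omega>: "open \<Omega>" "\<Omega> \<in> lmeasurable" "bounded \<Omega>"
    and U: "open U" "{s} \<times> closure \<Omega> \<subseteq> U" and v: "Ck_on 1 U v" and p: "Ck_on 1 \<Omega> p"
    and eq: "\<And>x. x \<in> \<Omega> \<Longrightarrow> pd v (s, x) (1, 0) + (\<Sum>b\<in>Basis. (v (s, x) \<bullet> b) *\<^sub>R pd v (s, x) (0, b)) + grad p x = f x"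
    and F: "\<And>x. x \<in> \<Omega> \<Longrightarrow> norm (f x) \<le> F"
    and H: "\<And>n. H_space \<Omega> (g n)" and H1: "\<And>n. H1_0 \<Omega> (g n) (G n)"
    and lim: "(\<lambda>n::nat. L2sq \<Omega> (\<lambda>x. g n x - v (s, x))) \<longlonglongrightarrow> 0"
  shows "(LINT x:\<Omega>|lebesgue. v (s, x) \<bullet> (f x - pd v (s, x) (1, 0))) = 0"
proof -
  define w where "w = (\<lambda>x. v (s, x))"
  define q where "q = (\<lambda>x. p x + (1 / 2) *\<^sub>R (w x \<bullet> w x))"
  have sub: "(\<lambda>x. (s, x)) ` closure \<Omega> \<subseteq> U" using U(2) by auto
  have inU: "(s, x) \<in> U" if "x \<in> \<Omega>" for x using that closure_subset U(2) by auto
  have cpd: "continuous_on (closure \<Omega>) (\<lambda>x. pd v (s, x) b)" if "b \<in> Basis" for b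
    by (rule continuous_on_compose2[OF Ck_on_1D(2)[OF v U(1) that] _ sub]) (intro continuous_intros)
  have cw: "continuous_on (closure \<Omega>) w" unfolding w_def
    by (rule continuous_on_compose2[OF Ck_on_imp_continuous_on[OF v] _ sub]) (intro continuous_intros)
  have dw: "(w has_derivative (\<lambda>h. frechet_derivative v (at (s, x)) (0, h))) (at x)" if "x \<in> \<Omega>" for x
    using has_derivative_section(1)[OF Ck_on_1D(1)[OF v U(1) inU[OF that]]] unfolding w_def .
  have dq: "(q has_derivative (\<lambda>h. frechet_derivative p (at x) h + w x \<bullet> frechet_derivative v (at (s, x)) (0, h))) (at x)"
    if "x \<in> \<Omega>" for x
  proof -
    have "(p has_derivative frechet_derivative p (at x)) (at x)"
      using Ck_on_1D(1)[OF p \<Omega>(1) that] by (simp add: frechet_derivative_works)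
    from has_derivative_add[OF this has_derivative_scaleR_right[OF has_derivative_inner[OF dw[OF that] dw[OF that]], of "1 / 2"]]
    show ?thesis unfolding q_def by (simp add: inner_commute)
  qed
  have pdq: "pd q x b = pd p x b + w x \<bullet> pd v (s, x) (0, b)" if "x \<in> \<Omega>" for x b
    using frechet_derivative_at[OF dq[OF that], symmetric] by (simp add: pd_def)
  have gq: "grad q x = grad p x + (\<Sum>b\<in>Basis. (w x \<bullet> pd v (s, x) (0, b)) *\<^sub>R b)" if "x \<in> \<Omega>" for x
    by (simp add: grad_def pdq[OF that] scaleR_add_left sum.distrib)
  have qC1: "Ck_on 1 \<Omega> q"
  proof -
    have "q differentiable_on \<Omega>" using dq \<Omega>(1)
      unfolding differentiable_on_eq_differentiable_at[OF \<Omega>(1)] differentiable_def by blast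
    moreover have "continuous_on \<Omega> (\<lambda>x. pd q x b)" if "b \<in> Basis" for b
    proof (rule continuous_on_eq)
      show "continuous_on \<Omega> (\<lambda>x. pd p x b + w x \<bullet> pd v (s, x) (0, b))"
        by (intro continuous_intros Ck_on_1D(2)[OF p \<Omega>(1) that] continuous_on_subset[OF cw closure_subset]
            continuous_on_subset[OF cpd[OF Basis_prod_mem(2)[OF that]] closure_subset])
    qed (simp add: pdq)
    ultimately show ?thesis by simp
  qed
  \<comment> \<open>The momentum equation reads \<open>grad q = f + k\<close>, with \<open>k\<close>
    made of \<open>v\<close> and its first derivatives, which are continuous up to the boundary. So
    \<open>grad q\<close> is bounded although the pressure has no bound assumed near the
    boundary.\<close>
  define k where "k x = (\<Sum>b\<in>Basis. (w x \<bullet> pd v (s, x) (0, b)) *\<^sub>R b)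
      - pd v (s, x) (1, 0) - (\<Sum>b\<in>Basis. (w x \<bullet> b) *\<^sub>R pd v (s, x) (0, b))" for x
  have gk: "grad q x = f x + k x" if "x \<in> \<Omega>" for x
    using eq[OF that] unfolding gq[OF that] k_def w_def by (simp add: algebra_simps)
  have cc: "compact (closure \<Omega>)" using \<Omega>(3) by simp
  have "continuous_on (closure \<Omega>) k" unfolding k_def
    by (intro continuous_intros cw cpd Basis_prod_mem)
  then have "bounded (k ` closure \<Omega>)" using cc by (intro compact_imp_bounded compact_continuous_image)
  then obtain Bk where Bk: "\<And>x. x \<in> \<Omega> \<Longrightarrow> norm (k x) \<le> Bk"
    using closure_subset unfolding bounded_iff by blast
  have "bounded (w ` closure \<Omega>)" using cc cw by (intro compact_imp_bounded compact_continuous_image)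
  then obtain Bw where Bw: "\<And>x. x \<in> \<Omega> \<Longrightarrow> norm (w x) \<le> Bw"
    using closure_subset unfolding bounded_iff by blast
  have gb: "norm (grad q x) \<le> F + Bk" if "x \<in> \<Omega>" for x
    unfolding gk[OF that] using F[OF that] Bk[OF that] norm_triangle_ineq[of "f x" "k x"] by linarith
  have Lw: "L2_on \<Omega> w"
    using \<Omega> Bw by (intro L2_on_bounded[of _ _ Bw] set_borel_measurable_lebesgue_continuous_on
        continuous_on_subset[OF cw closure_subset]) auto
  have lim': "(\<lambda>n::nat. L2sq \<Omega> (\<lambda>x. g n x - w x)) \<longlonglongrightarrow> 0" using lim by (simp add: w_def)
  have "(LINT x:\<Omega>|lebesgue. w x \<bullet> grad q x) = 0"
    by (rule L2_limit_orthogonal_gradient[OF \<Omega>(1,2) H H1 Lw lim' qC1 gb])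
  moreover have "w x \<bullet> grad q x = v (s, x) \<bullet> (f x - pd v (s, x) (1, 0))" if "x \<in> \<Omega>" for x
  proof -
    have "w x \<bullet> (\<Sum>b\<in>Basis. (w x \<bullet> pd v (s, x) (0, b)) *\<^sub>R b) = w x \<bullet> (\<Sum>b\<in>Basis. (w x \<bullet> b) *\<^sub>R pd v (s, x) (0, b))"
      by (simp add: inner_sum_right mult.commute)
    then have "w x \<bullet> k x = - (w x \<bullet> pd v (s, x) (1, 0))"
      unfolding k_def by (simp add: inner_diff_right)
    then show ?thesis unfolding gk[OF that] by (simp add: inner_add_right inner_diff_right w_def)
  qed
  ultimately show ?thesis
    using \<Omega>(2) set_lebesgue_integral_cong[of \<Omega> lebesgue "\<lambda>x. w x \<bullet> grad q x" "\<lambda>x. v (s, x) \<bullet> (f x - pd v (s, x) (1, 0))"]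
    by auto
qed

lemma integrable_indicator_continuous_bounded:
  fixes k :: "'a::euclidean_space \<Rightarrow> real"
  assumes A: "A \<in> sets borel" "bounded A" and c: "continuous_on A k" and B: "\<And>z. z \<in> A \<Longrightarrow> \<bar>k z\<bar> \<le> B"
  shows "integrable lborel (\<lambda>z. indicat_real A z *\<^sub>R k z)"
proof (rule Bochner_Integration.integrable_bound)
  have "emeasure lborel A < \<infinity>" using A(2) by (rule emeasure_bounded_finite)
  then show "integrable lborel (\<lambda>z. indicat_real A z * B)"
    using A(1) by (intro integrable_mult_left integrable_real_indicator) auto
  show "(\<lambda>z. indicat_real A z *\<^sub>R k z) \<in> borel_measurable lborel"
    using borel_measurable_continuous_on_indicator[OF A(1) c] by simp
  show "AE z in lborel. norm (indicat_real A z *\<^sub>R k z) \<le> norm (indicat_real A z * B)"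
    using B by (intro AE_I2) (auto simp: indicator_def intro: order_trans[OF B abs_ge_self])
qed

lemma set_integral_lebesgue_eq_lborel:
  fixes h :: "'a::euclidean_space \<Rightarrow> real"
  assumes "set_borel_measurable lborel S h"
  shows "(LINT x:S|lebesgue. h x) = (LINT x:S|lborel. h x)"
  using assms unfolding set_lebesgue_integral_def set_borel_measurable_def by (rule integral_completion)

text \<open>\<open>k1\<close> is the time derivative of the squared speed and \<open>k2\<close>
  twice the power of the force. By orthogonality their space integrals agree at almost every time.
  Integrating \<open>k1\<close> in time at each point gives the change of energy, integrating it in
  space first gives the work, and Fubini's theorem equates the two. The pressure has left each slice
  before the integration in time, so its dependence on time never enters.\<close>

lemma Euler_energy_balance:
  fixes \<Omega> :: "'d::euclidean_space set"
  assumes \<Omega>: "open \<Omega>" "bounded \<Omega>" and f: "C1_time_C1 \<Omega> f" and E: "Euler_sol \<Omega> T f u0 ub"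
    and approx: "AE s in lebesgue. s \<in> {0..T} \<longrightarrow> (\<exists>g G. (\<forall>n::nat. H_space \<Omega> (g n) \<and> H1_0 \<Omega> (g n) (G n))
      \<and> (\<lambda>n. L2sq \<Omega> (\<lambda>x. g n x - ub s x)) \<longlonglongrightarrow> 0)"
    and t: "t \<in> {0..T}"
  shows "L2sq \<Omega> (ub t) = L2sq \<Omega> u0 + 2 * (LINT z:({0..t} \<times> \<Omega>)|lebesgue. f (fst z) (snd z) \<bullet> ub (fst z) (snd z))"
proof -
  have m\<Omega>: "\<Omega> \<in> lmeasurable" using \<Omega> by (simp add: lmeasurable_open)
  obtain U v p where U: "open U" "{0..T} \<times> closure \<Omega> \<subseteq> U" and v: "Ck_on 1 U v"
    and vub: "\<And>t x. t \<in> {0..T} \<Longrightarrow> x \<in> closure \<Omega> \<Longrightarrow> v (t, x) = ub t x"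
    and p: "\<And>t. t \<in> {0..T} \<Longrightarrow> Ck_on 1 \<Omega> (p t)"
    and eq: "\<And>t x. t \<in> {0..T} \<Longrightarrow> x \<in> \<Omega> \<Longrightarrow> pd v (t, x) (1, 0)
                 + (\<Sum>b\<in>Basis. (ub t x \<bullet> b) *\<^sub>R pd v (t, x) (0, b)) + grad (p t) x = f t x"
    and ini: "\<And>x. x \<in> \<Omega> \<Longrightarrow> ub 0 x = u0 x"
  proof -
    from E obtain U v p where a: "open U" "{0..T} \<times> closure \<Omega> \<subseteq> U" "Ck_on 1 U v"
      and b: "\<forall>t\<in>{0..T}. \<forall>x\<in>closure \<Omega>. v (t, x) = ub t x" "\<forall>t\<in>{0..T}. Ck_on 1 \<Omega> (p t)"
      and c: "\<forall>t\<in>{0..T}. \<forall>x\<in>\<Omega>. pd v (t, x) (1, 0)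
                 + (\<Sum>b\<in>Basis. (ub t x \<bullet> b) *\<^sub>R pd v (t, x) (0, b)) + grad (p t) x = f t x"
      and d: "\<forall>x\<in>\<Omega>. ub 0 x = u0 x"
      unfolding Euler_sol_def by (elim conjE exE)
    show thesis using a b c d by (intro that[of U v p]) simp_all
  qed
  obtain F where F: "F \<ge> 0" "\<And>t x. t \<in> {0..T} \<Longrightarrow> x \<in> \<Omega> \<Longrightarrow> norm (f t x) \<le> F"
    using C1_time_C1_bounded[OF \<Omega>(1) f] by blast
  let ?Z = "{0..T} \<times> closure \<Omega>"
  have cZ: "compact ?Z" using \<Omega>(2) by (intro compact_Times) auto
  have cv: "continuous_on ?Z v" using continuous_on_subset[OF Ck_on_imp_continuous_on[OF v] U(2)] .
  have cpv: "continuous_on ?Z (\<lambda>z. pd v z (1, 0))"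
    using continuous_on_subset[OF Ck_on_1D(2)[OF v U(1) Basis_prod_mem(1)] U(2)] .
  define k1 where "k1 z = 2 * (v z \<bullet> pd v z (1, 0))" for z
  define k2 where "k2 z = 2 * (f (fst z) (snd z) \<bullet> v z)" for z
  have T\<Omega>: "x \<in> closure \<Omega>" if "x \<in> \<Omega>" for x using that closure_subset by blast
  let ?A = "{0..t} \<times> \<Omega>"
  have A: "?A \<in> sets borel" using \<Omega>(1) by (intro borel_Times) auto
  have bA: "bounded ?A" using \<Omega>(2) by (intro bounded_Times) auto
  have AZ: "?A \<subseteq> ?Z" using t T\<Omega> by auto
  have ck1: "continuous_on ?Z k1" unfolding k1_def by (intro continuous_intros cv cpv)
  have "bounded (k1 ` ?Z)" using cZ ck1 by (intro compact_imp_bounded compact_continuous_image)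
  then obtain B1 where B1: "\<And>z. z \<in> ?Z \<Longrightarrow> \<bar>k1 z\<bar> \<le> B1" unfolding bounded_iff real_norm_def by blast
  have "bounded (v ` ?Z)" using cZ cv by (intro compact_imp_bounded compact_continuous_image)
  then obtain Bv where Bv: "\<And>z. z \<in> ?Z \<Longrightarrow> norm (v z) \<le> Bv" unfolding bounded_iff by blast
  have ck2: "continuous_on ?A k2" unfolding k2_def
    by (intro continuous_intros continuous_on_subset[OF cv AZ] continuous_on_subset[OF C1_time_C1_continuous_on[OF \<Omega>(1) f]]) auto
  have B2: "\<bar>k2 z\<bar> \<le> 2 * (F * Bv)" if "z \<in> ?A" for z
  proof -
    have z: "fst z \<in> {0..T}" "snd z \<in> \<Omega>" "z \<in> ?Z" using that t AZ by auto
    have "\<bar>f (fst z) (snd z) \<bullet> v z\<bar> \<le> norm (f (fst z) (snd z)) * norm (v z)" by (rule Cauchy_Schwarz_ineq2)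
    also have "\<dots> \<le> F * Bv" using F(1) F(2)[OF z(1,2)] Bv[OF z(3)] by (intro mult_mono) auto
    finally show ?thesis by (simp add: k2_def abs_mult)
  qed
  have I1: "integrable lborel (\<lambda>z. indicat_real ?A z *\<^sub>R k1 z)"
    using integrable_indicator_continuous_bounded[OF A bA continuous_on_subset[OF ck1 AZ]] B1 AZ by blast
  have I2: "integrable lborel (\<lambda>z. indicat_real ?A z *\<^sub>R k2 z)"
    using integrable_indicator_continuous_bounded[OF A bA ck2 B2] .
  \<comment> \<open>Fubini's theorem is used for the product of the Borel-Lebesgue measures; this is
    possible because the integrands are continuous on the Borel set \<open>?A\<close>. The transfer
    to the completed measure is made only at the end.\<close>
  have I1': "integrable (lborel \<Otimes>\<^sub>M lborel) (\<lambda>z. indicat_real ?A z *\<^sub>R k1 z)"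
    and I2': "integrable (lborel \<Otimes>\<^sub>M lborel) (\<lambda>z. indicat_real ?A z *\<^sub>R k2 z)"
    using I1 I2 unfolding lborel_prod by auto
  have orth: "(\<integral>x. indicat_real ?A (s, x) *\<^sub>R k1 (s, x) \<partial>lborel) = (\<integral>x. indicat_real ?A (s, x) *\<^sub>R k2 (s, x) \<partial>lborel)"
    if app: "s \<in> {0..T} \<longrightarrow> (\<exists>g G. (\<forall>n::nat. H_space \<Omega> (g n) \<and> H1_0 \<Omega> (g n) (G n))
      \<and> (\<lambda>n. L2sq \<Omega> (\<lambda>x. g n x - ub s x)) \<longlonglongrightarrow> 0)" for s
  proof (cases "s \<in> {0..t}")
    case False
    then show ?thesis by (intro Bochner_Integration.integral_cong) (auto simp: indicator_def)
  next
    case True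
    then have s: "s \<in> {0..T}" using t by auto
    obtain g G where H: "\<And>n::nat. H_space \<Omega> (g n)" and H1: "\<And>n. H1_0 \<Omega> (g n) (G n)"
      and lim: "(\<lambda>n. L2sq \<Omega> (\<lambda>x. g n x - ub s x)) \<longlonglongrightarrow> 0" using app s by blast
    have L2eq: "L2sq \<Omega> (\<lambda>x. g n x - v (s, x)) = L2sq \<Omega> (\<lambda>x. g n x - ub s x)" for n
      unfolding L2sq_def L2sq_enn_def using vub[OF s T\<Omega>]
      by (intro arg_cong[where f=enn2real] nn_integral_cong) (auto simp: indicator_def)
    have eq0: "(LINT x:\<Omega>|lebesgue. v (s, x) \<bullet> (f s x - pd v (s, x) (1, 0))) = 0"
    proof (rule Euler_momentum_orthogonality[OF \<Omega>(1) m\<Omega> \<Omega>(2) U(1) _ v p[OF s] _ F(2)[OF s] H H1])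
      show "{s} \<times> closure \<Omega> \<subseteq> U" using U(2) s by auto
      show "pd v (s, x) (1, 0) + (\<Sum>b\<in>Basis. (v (s, x) \<bullet> b) *\<^sub>R pd v (s, x) (0, b)) + grad (p s) x = f s x" if "x \<in> \<Omega>" for x
        using eq[OF s that] vub[OF s T\<Omega>[OF that]] by simp
      show "(\<lambda>n. L2sq \<Omega> (\<lambda>x. g n x - v (s, x))) \<longlonglongrightarrow> 0" using lim unfolding L2eq .
    qed
    have sub: "(\<lambda>x. (s, x)) ` \<Omega> \<subseteq> ?A" "(\<lambda>x. (s, x)) ` \<Omega> \<subseteq> ?Z" using True s T\<Omega> by auto
    have c1: "continuous_on \<Omega> (\<lambda>x. k1 (s, x))"
      by (rule continuous_on_compose2[OF ck1 _ sub(2)]) (intro continuous_intros)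
    have c2: "continuous_on \<Omega> (\<lambda>x. k2 (s, x))"
      by (rule continuous_on_compose2[OF ck2 _ sub(1)]) (intro continuous_intros)
    have b\<Omega>: "\<Omega> \<in> sets borel" using \<Omega>(1) by simp
    have i1: "integrable lborel (\<lambda>x. indicat_real \<Omega> x *\<^sub>R k1 (s, x))"
      using sub(2) by (intro integrable_indicator_continuous_bounded[OF b\<Omega> \<Omega>(2) c1, of B1] B1) auto
    have i2: "integrable lborel (\<lambda>x. indicat_real \<Omega> x *\<^sub>R k2 (s, x))"
      using sub(1) by (intro integrable_indicator_continuous_bounded[OF b\<Omega> \<Omega>(2) c2, of "2 * (F * Bv)"] B2) auto
    have "(\<integral>x. indicat_real \<Omega> x *\<^sub>R k2 (s, x) \<partial>lborel) - (\<integral>x. indicat_real \<Omega> x *\<^sub>R k1 (s, x) \<partial>lborel)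
        = (\<integral>x. indicat_real \<Omega> x *\<^sub>R k2 (s, x) - indicat_real \<Omega> x *\<^sub>R k1 (s, x) \<partial>lborel)"
      using i1 i2 by (intro Bochner_Integration.integral_diff[symmetric])
    also have "\<dots> = (\<integral>x. indicat_real \<Omega> x *\<^sub>R k2 (s, x) - indicat_real \<Omega> x *\<^sub>R k1 (s, x) \<partial>lebesgue)"
      using i1 i2 by (intro integral_completion[symmetric]) auto
    also have "\<dots> = (\<integral>x. 2 * (indicat_real \<Omega> x *\<^sub>R (v (s, x) \<bullet> (f s x - pd v (s, x) (1, 0)))) \<partial>lebesgue)"
      by (intro Bochner_Integration.integral_cong) (auto simp: k1_def k2_def inner_diff_right inner_commute algebra_simps)
    also have "\<dots> = 0" using eq0 unfolding set_lebesgue_integral_def by (subst integral_mult_right_zero) simp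
    finally have "(\<integral>x. indicat_real \<Omega> x *\<^sub>R k1 (s, x) \<partial>lborel) = (\<integral>x. indicat_real \<Omega> x *\<^sub>R k2 (s, x) \<partial>lborel)" by simp
    moreover have "indicat_real ?A (s, x) = indicat_real \<Omega> x" for x using True by (auto simp: indicator_def)
    ultimately show ?thesis by simp
  qed
  have L2ub: "L2_on \<Omega> (ub s)" "set_integrable lborel \<Omega> (\<lambda>x. (norm (v (s, x)))\<^sup>2)"
      "L2sq \<Omega> (ub s) = (LINT x:\<Omega>|lborel. (norm (v (s, x)))\<^sup>2)" if s: "s \<in> {0..T}" for s
  proof -
    have c: "continuous_on \<Omega> (\<lambda>x. v (s, x))"
      by (rule continuous_on_compose2[OF cv]) (use s T\<Omega> in \<open>auto intro!: continuous_intros\<close>)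
    then have cub: "continuous_on \<Omega> (ub s)" by (rule continuous_on_eq) (use vub[OF s T\<Omega>] in auto)
    have bub: "norm (ub s x) \<le> Bv" if "x \<in> \<Omega>" for x using Bv[of "(s, x)"] vub[OF s T\<Omega>[OF that]] s T\<Omega>[OF that] by auto
    show L: "L2_on \<Omega> (ub s)"
      using \<Omega> bub by (intro L2_on_bounded[OF _ m\<Omega>, of _ Bv] set_borel_measurable_lebesgue_continuous_on cub) auto
    have bv2: "\<bar>(norm (v (s, x)))\<^sup>2\<bar> \<le> Bv\<^sup>2" if "x \<in> \<Omega>" for x
      using bub[OF that] vub[OF s T\<Omega>[OF that]] by (simp add: power_mono)
    have cn: "continuous_on \<Omega> (\<lambda>x. (norm (v (s, x)))\<^sup>2)" by (intro continuous_intros c)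
    show i: "set_integrable lborel \<Omega> (\<lambda>x. (norm (v (s, x)))\<^sup>2)"
      unfolding set_integrable_def using \<Omega> by (intro integrable_indicator_continuous_bounded[OF _ _ cn bv2]) auto
    have "L2sq \<Omega> (ub s) = (LINT x:\<Omega>|lebesgue. (norm (ub s x))\<^sup>2)" by (rule L2_on_integrable(2)[OF L])
    also have "\<dots> = (LINT x:\<Omega>|lebesgue. (norm (v (s, x)))\<^sup>2)"
      using m\<Omega> vub[OF s T\<Omega>] by (intro set_lebesgue_integral_cong) auto
    also have "\<dots> = (LINT x:\<Omega>|lborel. (norm (v (s, x)))\<^sup>2)"
      using i by (intro set_integral_lebesgue_eq_lborel) (auto simp: set_integrable_def set_borel_measurable_def)
    finally show "L2sq \<Omega> (ub s) = (LINT x:\<Omega>|lborel. (norm (v (s, x)))\<^sup>2)" .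
  qed
  have t0: "0 \<in> {0..T}" using t by auto
  \<comment> \<open>Outside \<Omega> both sides are 0, so the identity holds for every
    \<open>x\<close> and can be substituted under the space integral.\<close>
  have FTC: "(\<integral>s. indicat_real ?A (s, x) *\<^sub>R k1 (s, x) \<partial>lborel)
      = indicat_real \<Omega> x *\<^sub>R (norm (v (t, x)))\<^sup>2 - indicat_real \<Omega> x *\<^sub>R (norm (v (0, x)))\<^sup>2" for x
  proof (cases "x \<in> \<Omega>")
    case True
    have "(\<integral>s. indicat_real {0..t} s *\<^sub>R k1 (s, x) \<partial>lborel) = (norm (v (t, x)))\<^sup>2 - (norm (v (0, x)))\<^sup>2"
    proof (rule integral_FTC_atLeastAtMost)
      show "0 \<le> t" using t by simp
      show "continuous_on {0..t} (\<lambda>s. k1 (s, x))"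
        by (rule continuous_on_compose2[OF ck1]) (use t True T\<Omega> in \<open>auto intro!: continuous_intros\<close>)
      fix s assume "0 \<le> s" "s \<le> t"
      then have "(s, x) \<in> U" using U(2) t T\<Omega>[OF True] by auto
      then have "v differentiable (at (s, x))" using Ck_on_1D(1)[OF v U(1)] by blast
      then have "((\<lambda>r. v (r, x)) has_derivative (\<lambda>h. frechet_derivative v (at (s, x)) (h, 0))) (at s)"
        and lin: "linear (frechet_derivative v (at (s, x)))"
        by (auto intro: has_derivative_section(2) linear_frechet_derivative)
      from has_derivative_inner[OF this(1) this(1)]
      have "((\<lambda>r. (norm (v (r, x)))\<^sup>2) has_derivative (\<lambda>h. 2 * (v (s, x) \<bullet> frechet_derivative v (at (s, x)) (h, 0)))) (at s)"
        by (simp add: power2_norm_eq_inner inner_commute)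
      moreover have "frechet_derivative v (at (s, x)) (h, 0) = h *\<^sub>R pd v (s, x) (1, 0)" for h
        using linear_cmul[OF lin, of h "(1, 0)"] by (simp add: pd_def)
      ultimately have "((\<lambda>r. (norm (v (r, x)))\<^sup>2) has_vector_derivative k1 (s, x)) (at s)"
        unfolding has_vector_derivative_def k1_def by (simp add: algebra_simps)
      then show "((\<lambda>r. (norm (v (r, x)))\<^sup>2) has_vector_derivative k1 (s, x)) (at s within {0..t})"
        by (rule has_vector_derivative_at_within)
    qed
    moreover have "indicat_real ?A (s, x) = indicat_real {0..t} s" for s using True by (auto simp: indicator_def)
    ultimately show ?thesis using True by simp
  qed simp
  have "L2sq \<Omega> (ub t) - L2sq \<Omega> (ub 0)
      = (\<integral>x. indicat_real \<Omega> x *\<^sub>R (norm (v (t, x)))\<^sup>2 - indicat_real \<Omega> x *\<^sub>R (norm (v (0, x)))\<^sup>2 \<partial>lborel)"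
    unfolding L2ub(3)[OF t] L2ub(3)[OF t0] set_lebesgue_integral_def
    using L2ub(2)[OF t] L2ub(2)[OF t0] unfolding set_integrable_def
    by (intro Bochner_Integration.integral_diff[symmetric])
  also have "\<dots> = (\<integral>x. (\<integral>s. indicat_real ?A (s, x) *\<^sub>R k1 (s, x) \<partial>lborel) \<partial>lborel)" unfolding FTC ..
  also have "\<dots> = (\<integral>s. (\<integral>x. indicat_real ?A (s, x) *\<^sub>R k1 (s, x) \<partial>lborel) \<partial>lborel)"
    using I1' by (intro lborel_pair.Fubini_integral) (simp add: case_prod_beta')
  also have "\<dots> = (\<integral>s. (\<integral>x. indicat_real ?A (s, x) *\<^sub>R k2 (s, x) \<partial>lborel) \<partial>lborel)"
  proof (rule integral_cong_AE)
    have m1: "(\<lambda>z. indicat_real ?A z *\<^sub>R k1 z) \<in> borel_measurable (lborel \<Otimes>\<^sub>M lborel)"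
      and m2: "(\<lambda>z. indicat_real ?A z *\<^sub>R k2 z) \<in> borel_measurable (lborel \<Otimes>\<^sub>M lborel)"
      using I1' I2' by blast+
    show "(\<lambda>s. \<integral>x. indicat_real ?A (s, x) *\<^sub>R k1 (s, x) \<partial>lborel) \<in> borel_measurable lborel"
      using m1 by (intro lborel.borel_measurable_lebesgue_integral) (simp add: case_prod_beta')
    show "(\<lambda>s. \<integral>x. indicat_real ?A (s, x) *\<^sub>R k2 (s, x) \<partial>lborel) \<in> borel_measurable lborel"
      using m2 by (intro lborel.borel_measurable_lebesgue_integral) (simp add: case_prod_beta')
    show "AE s in lborel. (\<integral>x. indicat_real ?A (s, x) *\<^sub>R k1 (s, x) \<partial>lborel) = (\<integral>x. indicat_real ?A (s, x) *\<^sub>R k2 (s, x) \<partial>lborel)"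
      using approx unfolding AE_completion_iff by eventually_elim (rule orth)
  qed
  also have "\<dots> = (\<integral>z. indicat_real ?A z *\<^sub>R k2 z \<partial>(lborel \<Otimes>\<^sub>M lborel))"
    using I2' by (rule lborel_pair.integral_fst')
  also have "\<dots> = (\<integral>z. indicat_real ?A z *\<^sub>R k2 z \<partial>lebesgue)"
    using I2 unfolding lborel_prod by (intro integral_completion[symmetric]) auto
  also have "\<dots> = (\<integral>z. 2 * (indicat_real ?A z *\<^sub>R (f (fst z) (snd z) \<bullet> ub (fst z) (snd z))) \<partial>lebesgue)"
    using vub t T\<Omega> by (intro Bochner_Integration.integral_cong) (auto simp: k2_def indicator_def)
  also have "\<dots> = 2 * (LINT z:?A|lebesgue. f (fst z) (snd z) \<bullet> ub (fst z) (snd z))"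
    unfolding set_lebesgue_integral_def by (rule integral_mult_right_zero)
  finally have "L2sq \<Omega> (ub t) - L2sq \<Omega> (ub 0) = 2 * (LINT z:?A|lebesgue. f (fst z) (snd z) \<bullet> ub (fst z) (snd z))" .
  moreover have "L2sq \<Omega> (ub 0) = L2sq \<Omega> u0"
    unfolding L2sq_def L2sq_enn_def using ini
    by (intro arg_cong[where f=enn2real] nn_integral_cong) (auto simp: indicator_def)
  ultimately show ?thesis by linarith
qed

section \<open>Vanishing dissipation\<close>

lemma AE_lebesgue_ex_in_interval:
  fixes a b :: real
  assumes "AE t in lebesgue. P t" "a < b"
  shows "\<exists>t. a < t \<and> t < b \<and> P t"
proof (rule ccontr)
  assume "\<nexists>t. a < t \<and> t < b \<and> P t"
  then have "AE t in lebesgue. t \<notin> {a<..<b}"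
    using assms(1) by (auto elim!: eventually_mono)
  then have "{a<..<b} \<in> null_sets lebesgue" by (simp add: completion.null_sets_iff_AE)
  then have "emeasure lborel {a<..<b} = 0" by (simp add: null_sets_completion_iff null_sets_def)
  then show False using assms(2) by simp
qed

text \<open>The bound may be unknown at \<open>T\<close> itself. Between each \<open>a n\<close> and
  \<open>T\<close> there is a time at which it holds; monotonicity passes it to
  \<open>{0..a n}\<close>, continuity from below to \<open>{0..<T}\<close>, and the endpoint is a
  null set.\<close>

lemma nn_integral_Icc_le_of_AE:
  fixes g :: "real \<Rightarrow> ennreal"
  assumes g: "g \<in> borel_measurable lebesgue" and T: "0 < T"
    and ae: "AE t in lebesgue. t \<in> {0..T} \<longrightarrow> (\<integral>\<^sup>+s\<in>{0..t}. g s \<partial>lebesgue) \<le> C"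
  shows "(\<integral>\<^sup>+s\<in>{0..T}. g s \<partial>lebesgue) \<le> C"
proof -
  define a where "a n = T - T / (real n + 2)" for n :: nat
  have aT: "a n < T" "0 \<le> a n" for n using T by (auto simp: a_def field_simps)
  have d: "emeasure (density lebesgue g) A = (\<integral>\<^sup>+s\<in>A. g s \<partial>lebesgue)" if "A \<in> sets lebesgue" for A
    using g that by (rule emeasure_density)
  have le: "emeasure (density lebesgue g) {0..a n} \<le> C" for n
  proof -
    obtain t where t: "a n < t" "t < T" "t \<in> {0..T} \<longrightarrow> (\<integral>\<^sup>+s\<in>{0..t}. g s \<partial>lebesgue) \<le> C"
      using AE_lebesgue_ex_in_interval[OF ae aT(1)] by blast
    have "emeasure (density lebesgue g) {0..a n} \<le> emeasure (density lebesgue g) {0..t}"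
      using t by (intro emeasure_mono) auto
    also have "\<dots> \<le> C" using t aT(2)[of n] d[of "{0..t}"] by simp
    finally show ?thesis .
  qed
  have "incseq a" unfolding incseq_def a_def using T by (auto intro!: divide_left_mono)
  then have inc: "incseq (\<lambda>n. {0..a n})" by (auto simp: incseq_def intro: order_trans)
  have un: "(\<Union>n. {0..a n}) = {0..<T}"
  proof (intro equalityI subsetI)
    fix x assume "x \<in> {0..<T}"
    then have x: "0 \<le> x" "x < T" by auto
    obtain n :: nat where "T / (T - x) < real n" using reals_Archimedean2 by blast
    then have "T < real n * (T - x)" using x by (simp add: divide_less_eq)
    also have "\<dots> \<le> (real n + 2) * (T - x)" using x by (intro mult_right_mono) auto
    finally have "T / (real n + 2) < T - x" by (simp add: divide_less_eq mult.commute)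
    then have "x \<in> {0..a n}" using x by (simp add: a_def)
    then show "x \<in> (\<Union>n. {0..a n})" by blast
  next
    fix x assume "x \<in> (\<Union>n. {0..a n})"
    then obtain n where "0 \<le> x" "x \<le> a n" by auto
    then show "x \<in> {0..<T}" using aT(1)[of n] by auto
  qed
  have "AE s in lebesgue. s \<noteq> T" by (rule AE_completion[OF AE_lborel_singleton])
  then have "(\<integral>\<^sup>+s\<in>{0..T}. g s \<partial>lebesgue) = (\<integral>\<^sup>+s\<in>{0..<T}. g s \<partial>lebesgue)"
    by (intro nn_integral_cong_AE) (auto elim!: eventually_mono simp: indicator_def)
  also have "\<dots> = emeasure (density lebesgue g) (\<Union>n. {0..a n})" unfolding un by (subst d) auto
  also have "\<dots> = (SUP n. emeasure (density lebesgue g) {0..a n})"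
    using inc by (intro SUP_emeasure_incseq[symmetric]) auto
  also have "\<dots> \<le> C" using le by (rule SUP_least)
  finally show ?thesis .
qed

lemma Euler_sol_regular:
  fixes \<Omega> :: "'d::euclidean_space set"
  assumes "Euler_sol \<Omega> T f u0 ub" "bounded \<Omega>"
  shows "continuous_on ({0..T} \<times> \<Omega>) (\<lambda>z. ub (fst z) (snd z))"
    and "\<exists>V\<ge>0. \<forall>t\<in>{0..T}. \<forall>x\<in>\<Omega>. norm (ub t x) \<le> V"
proof -
  from assms(1) obtain U v where U: "open U" "{0..T} \<times> closure \<Omega> \<subseteq> U" "Ck_on 1 U v"
      and e: "\<forall>t\<in>{0..T}. \<forall>x\<in>closure \<Omega>. v (t, x) = ub t x"
    unfolding Euler_sol_def by (elim conjE exE)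
  have c: "continuous_on ({0..T} \<times> closure \<Omega>) v"
    using continuous_on_subset[OF Ck_on_imp_continuous_on[OF U(3)] U(2)] .
  have sub: "{0..T} \<times> \<Omega> \<subseteq> {0..T} \<times> closure \<Omega>" using closure_subset by auto
  show "continuous_on ({0..T} \<times> \<Omega>) (\<lambda>z. ub (fst z) (snd z))"
  proof (rule continuous_on_eq[OF continuous_on_subset[OF c sub]])
    fix z assume "z \<in> {0..T} \<times> \<Omega>"
    then have "z \<in> {0..T} \<times> closure \<Omega>" using sub by blast
    then show "v z = ub (fst z) (snd z)" using e by auto
  qed
  have "bounded (v ` ({0..T} \<times> closure \<Omega>))"
    using assms(2) c by (intro compact_imp_bounded compact_continuous_image compact_Times) auto
  then obtain V where V: "V > 0" "\<forall>z\<in>{0..T} \<times> closure \<Omega>. norm (v z) \<le> V" by (auto simp: bounded_pos)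
  have "norm (ub t x) \<le> V" if "t \<in> {0..T}" "x \<in> \<Omega>" for t x
  proof -
    have x: "x \<in> closure \<Omega>" using that(2) closure_subset by blast
    then have "(t, x) \<in> {0..T} \<times> closure \<Omega>" using that(1) by simp
    then have "norm (v (t, x)) \<le> V" using V(2) by blast
    then show ?thesis using e that(1) x by simp
  qed
  then show "\<exists>V\<ge>0. \<forall>t\<in>{0..T}. \<forall>x\<in>\<Omega>. norm (ub t x) \<le> V" using V(1) by (intro exI[of _ V]) auto
qed

text \<open>\<open>L2sq\<close> sends an infinite integral to 0, so a bound on it alone would not
  imply closeness. A finite \<open>L2nrm\<close> excludes that case, and then the real and the
  extended bounds agree.\<close>

lemma L2nrm_le_imp:
  assumes "L2nrm S g \<le> ereal \<epsilon>" "0 \<le> \<epsilon>"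
  shows "L2sq_enn S g \<le> ennreal (\<epsilon>\<^sup>2)" "L2sq S g \<le> \<epsilon>\<^sup>2"
proof -
  have fin: "L2sq_enn S g \<noteq> \<infinity>" using assms(1) unfolding L2nrm_def by (auto split: if_splits)
  then have "sqrt (L2sq S g) \<le> \<epsilon>" using assms(1) unfolding L2nrm_def by simp
  then show L: "L2sq S g \<le> \<epsilon>\<^sup>2" using L2sq_nonneg[of S g] assms(2) real_sqrt_le_iff[of "L2sq S g" "\<epsilon>\<^sup>2"] by simp
  have "L2sq_enn S g = ennreal (L2sq S g)" using fin unfolding L2sq_def by (simp add: less_top)
  then show "L2sq_enn S g \<le> ennreal (\<epsilon>\<^sup>2)" using L by (simp add: ennreal_leI)
qed

text \<open>Subtracting the Euler energy balance from the energy inequality at almost every time leaves only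
  terms linear in the difference of the two velocities.\<close>
lemma NS_dissipation_le_distance:
  fixes \<Omega> :: "'d::euclidean_space set"
  assumes NS: "NS_weak \<Omega> T \<nu> f u0 u Du" and \<Omega>: "open \<Omega>" "bounded \<Omega>" and T: "0 < T" and \<nu>: "0 < \<nu>"
    and f: "C1_time_C1 \<Omega> f" and F: "0 \<le> F" "\<And>t x. t \<in> {0..T} \<Longrightarrow> x \<in> \<Omega> \<Longrightarrow> norm (f t x) \<le> F"
    and E: "Euler_sol \<Omega> T f u0 ub" and V: "0 \<le> V" "\<And>t x. t \<in> {0..T} \<Longrightarrow> x \<in> \<Omega> \<Longrightarrow> norm (ub t x) \<le> V"
    and bal: "\<And>t. t \<in> {0..T} \<Longrightarrow> L2sq \<Omega> (ub t) = L2sq \<Omega> u0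
      + 2 * (LINT z:({0..t} \<times> \<Omega>)|lebesgue. f (fst z) (snd z) \<bullet> ub (fst z) (snd z))"
    and \<epsilon>: "0 \<le> \<epsilon>" and close: "AE t in lebesgue. t \<in> {0..T} \<longrightarrow> L2nrm \<Omega> (\<lambda>x. u t x - ub t x) \<le> ereal \<epsilon>"
  shows "\<nu> * enn2real (\<integral>\<^sup>+t\<in>{0..T}. dissipation \<Omega> Du t \<partial>lebesgue)
    \<le> (V + F * T) * sqrt (measure lebesgue \<Omega>) * \<epsilon>"
proof -
  have m\<Omega>: "\<Omega> \<in> lmeasurable" using \<Omega> by (simp add: lmeasurable_open)
  have mu: "(\<lambda>z::real \<times> 'd. u (fst z) (snd z)) \<in> borel_measurable lebesgue"
    and mDu: "\<And>b. b \<in> Basis \<Longrightarrow> (\<lambda>z::real \<times> 'd. Du (fst z) (snd z) b) \<in> borel_measurable lebesgue"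
    and H: "\<And>t. t \<in> {0..T} \<Longrightarrow> H_space \<Omega> (u t)"
    and bd: "\<exists>M. \<forall>t\<in>{0..T}. L2sq \<Omega> (u t) \<le> M"
    and fin: "(\<integral>\<^sup>+t\<in>{0..T}. dissipation \<Omega> Du t \<partial>lebesgue) < \<infinity>"
    and en: "\<And>t. t \<in> {0..T} \<Longrightarrow> L2sq \<Omega> (u t)
          + 2 * \<nu> * enn2real (\<integral>\<^sup>+s\<in>{0..t}. dissipation \<Omega> Du s \<partial>lebesgue)
        \<le> L2sq \<Omega> u0 + 2 * (LINT z:({0..t} \<times> \<Omega>)|lebesgue. f (fst z) (snd z) \<bullet> u (fst z) (snd z))"
    using NS unfolding NS_weak_def by blast+
  obtain M where M: "\<And>t. t \<in> {0..T} \<Longrightarrow> L2sq \<Omega> (u t) \<le> M" using bd by blast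
  have M0: "0 \<le> M" using M[of 0] L2sq_nonneg[of \<Omega> "u 0"] T by simp
  define c where "c = sqrt (measure lebesgue \<Omega>)"
  define g where "g = dissipation \<Omega> Du"
  have Lu: "L2_on \<Omega> (u t)" if "t \<in> {0..T}" for t
    using H[OF that] m\<Omega> by (intro in_L2_imp_L2_on) (auto simp: H_space_def)
  have cub: "continuous_on ({0..T} \<times> \<Omega>) (\<lambda>z. ub (fst z) (snd z))" by (rule Euler_sol_regular(1)[OF E \<Omega>(2)])
  have Lub: "L2_on \<Omega> (ub t)" "sqrt (L2sq \<Omega> (ub t)) \<le> V * c" if t: "t \<in> {0..T}" for t
  proof -
    have "continuous_on \<Omega> (\<lambda>x. ub (fst (t, x)) (snd (t, x)))"
      by (rule continuous_on_compose2[OF cub]) (use t in \<open>auto intro!: continuous_intros\<close>)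
    then show L: "L2_on \<Omega> (ub t)"
      using \<Omega> V(2)[OF t] by (intro L2_on_bounded[OF _ m\<Omega>, of _ V] set_borel_measurable_lebesgue_continuous_on) auto
    have i: "set_integrable lebesgue \<Omega> (\<lambda>x. V\<^sup>2)"
      using m\<Omega> unfolding set_integrable_def real_scaleR_def
      by (intro integrable_mult_left integrable_real_indicator) (auto simp: fmeasurable_def)
    have "L2sq \<Omega> (ub t) \<le> (LINT x:\<Omega>|lebesgue. V\<^sup>2)"
      unfolding L2_on_integrable(2)[OF L] using V(2)[OF t]
      by (intro set_integral_mono L2_on_integrable(1)[OF L] i power_mono) auto
    also have "\<dots> = (V * c)\<^sup>2"
      using m\<Omega> unfolding set_lebesgue_integral_def c_def by (simp add: power_mult_distrib fmeasurable_def mult.commute)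
    finally show "sqrt (L2sq \<Omega> (ub t)) \<le> V * c"
      using V(1) by (intro real_le_lsqrt) (auto simp: c_def)
  qed
  have main: "2 * \<nu> * enn2real (\<integral>\<^sup>+s\<in>{0..t}. g s \<partial>lebesgue) \<le> 2 * ((V + F * T) * c * \<epsilon>)"
    if t: "t \<in> {0..T}" and cl: "L2nrm \<Omega> (\<lambda>x. u t x - ub t x) \<le> ereal \<epsilon>" for t
  proof -
    let ?A = "{0..t} \<times> \<Omega>"
    have bA: "?A \<in> sets borel" using \<Omega>(1) by (intro borel_Times) auto
    have AT: "?A \<subseteq> {0..T} \<times> \<Omega>" using t by auto
    have [measurable]: "?A \<in> sets lebesgue" using bA by simp
    note [measurable] = mu
    \<comment> \<open>\<open>ub\<close> and \<open>f\<close> are controlled only inside the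
      cylinder, so measurability is available after multiplication by its indicator. The integrands
      below are rewritten to contain the cut-off functions.\<close>
    have [measurable]: "(\<lambda>z. indicat_real ?A z *\<^sub>R ub (fst z) (snd z)) \<in> borel_measurable lebesgue"
      using set_borel_measurable_lebesgue_continuous_on[OF bA continuous_on_subset[OF cub AT]]
      unfolding set_borel_measurable_def .
    have [measurable]: "(\<lambda>z. indicat_real ?A z *\<^sub>R f (fst z) (snd z)) \<in> borel_measurable lebesgue"
      using set_borel_measurable_lebesgue_continuous_on[OF bA continuous_on_subset[OF C1_time_C1_continuous_on[OF \<Omega>(1) f]]]
      unfolding set_borel_measurable_def by auto
    have fle: "\<bar>f s x \<bullet> y\<bar> \<le> F * norm y" if "s \<in> {0..t}" "x \<in> \<Omega>" for s x y
    proof -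
      have "\<bar>f s x \<bullet> y\<bar> \<le> norm (f s x) * norm y" by (rule Cauchy_Schwarz_ineq2)
      also have "\<dots> \<le> F * norm y" using F(2)[of s x] that t by (intro mult_right_mono) auto
      finally show ?thesis .
    qed
    have mw: "(\<lambda>z. indicator ?A z * ennreal (norm (u (fst z) (snd z) - ub (fst z) (snd z)))) \<in> borel_measurable lebesgue"
    proof -
      have "(\<lambda>z. indicator ?A z * ennreal (norm (u (fst z) (snd z) - indicat_real ?A z *\<^sub>R ub (fst z) (snd z)))) \<in> borel_measurable lebesgue"
        by measurable
      moreover have "(\<lambda>z. indicator ?A z * ennreal (norm (u (fst z) (snd z) - indicat_real ?A z *\<^sub>R ub (fst z) (snd z))))
        = (\<lambda>z. indicator ?A z * ennreal (norm (u (fst z) (snd z) - ub (fst z) (snd z))))"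
        by (auto simp: indicator_def)
      ultimately show ?thesis by simp
    qed
    have aew: "AE s in lebesgue. s \<in> {0..t} \<longrightarrow> L2sq_enn \<Omega> (\<lambda>x. u s x - ub s x) \<le> ennreal (\<epsilon>\<^sup>2)"
      using close by eventually_elim (use t L2nrm_le_imp(1)[OF _ \<epsilon>] in auto)
    have work: "\<bar>LINT z:?A|lebesgue. f (fst z) (snd z) \<bullet> (u (fst z) (snd z) - ub (fst z) (snd z))\<bar>
        \<le> F * \<epsilon> * sqrt (measure lebesgue \<Omega>) * t"
      by (rule abs_LINT_time_space_le[where g = "\<lambda>s x. u s x - ub s x", OF mw m\<Omega> _ F(1) \<epsilon> _ aew]) (use t fle in auto)
    have iu: "set_integrable lebesgue ?A (\<lambda>z. f (fst z) (snd z) \<bullet> u (fst z) (snd z))"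
    proof (rule set_integrable_time_space[where g = u, OF _ m\<Omega> _ F(1) _, of _ "sqrt M"])
      show "(\<lambda>z. indicator ?A z * ennreal (norm (u (fst z) (snd z)))) \<in> borel_measurable lebesgue" by measurable
      show "AE s in lebesgue. s \<in> {0..t} \<longrightarrow> L2sq_enn \<Omega> (u s) \<le> ennreal ((sqrt M)\<^sup>2)"
        using t M Lu M0 by (intro AE_I2) (auto simp: L2_on_enn ennreal_leI)
      have "(\<lambda>z. (indicat_real ?A z *\<^sub>R f (fst z) (snd z)) \<bullet> u (fst z) (snd z)) \<in> borel_measurable lebesgue" by measurable
      then show "set_borel_measurable lebesgue ?A (\<lambda>z. f (fst z) (snd z) \<bullet> u (fst z) (snd z))"
        unfolding set_borel_measurable_def by simp
    qed (use t fle M0 in auto)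
    have iw: "set_integrable lebesgue ?A (\<lambda>z. f (fst z) (snd z) \<bullet> (u (fst z) (snd z) - ub (fst z) (snd z)))"
    proof (rule set_integrable_time_space[where g = "\<lambda>s x. u s x - ub s x", OF mw m\<Omega> _ F(1) \<epsilon> _ aew])
      have "(\<lambda>z. (indicat_real ?A z *\<^sub>R f (fst z) (snd z)) \<bullet> (u (fst z) (snd z) - indicat_real ?A z *\<^sub>R ub (fst z) (snd z))) \<in> borel_measurable lebesgue"
        by measurable
      moreover have "(\<lambda>z. (indicat_real ?A z *\<^sub>R f (fst z) (snd z)) \<bullet> (u (fst z) (snd z) - indicat_real ?A z *\<^sub>R ub (fst z) (snd z)))
        = (\<lambda>z. indicat_real ?A z *\<^sub>R (f (fst z) (snd z) \<bullet> (u (fst z) (snd z) - ub (fst z) (snd z))))"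
        by (auto simp: indicator_def)
      ultimately show "set_borel_measurable lebesgue ?A (\<lambda>z. f (fst z) (snd z) \<bullet> (u (fst z) (snd z) - ub (fst z) (snd z)))"
        unfolding set_borel_measurable_def by simp
    qed (use t fle in auto)
    have split: "(LINT z:?A|lebesgue. f (fst z) (snd z) \<bullet> u (fst z) (snd z)) - (LINT z:?A|lebesgue. f (fst z) (snd z) \<bullet> (u (fst z) (snd z) - ub (fst z) (snd z)))
        = (LINT z:?A|lebesgue. f (fst z) (snd z) \<bullet> ub (fst z) (snd z))"
      by (subst set_integral_diff(2)[OF iu iw, symmetric]) (simp add: inner_diff_right)
    \<comment> \<open>With \<open>w = u t x - ub t x\<close>, the difference of the squared norms of
      \<open>ub t x\<close> and \<open>u t x\<close> is
      \<open>- 2 * (ub t x \<bullet> w) - (norm w)\<^sup>2\<close>. Dropping the last term, which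
      has the favourable sign, leaves an expression linear in \<open>w\<close>.\<close>
    have kin: "L2sq \<Omega> (ub t) - L2sq \<Omega> (u t) \<le> 2 * (V * c * \<epsilon>)"
    proof -
      have Lw: "L2_on \<Omega> (\<lambda>x. u t x - ub t x)" by (rule L2_on_diff[OF Lu[OF t] Lub(1)[OF t]])
      note i = L2_on_integrable(1)[OF Lub(1)[OF t]] L2_on_integrable(1)[OF Lu[OF t]] L2_on_inner_integrable[OF Lub(1)[OF t] Lw]
      have "L2sq \<Omega> (ub t) - L2sq \<Omega> (u t) = (LINT x:\<Omega>|lebesgue. (norm (ub t x))\<^sup>2 - (norm (u t x))\<^sup>2)"
        unfolding L2_on_integrable(2)[OF Lub(1)[OF t]] L2_on_integrable(2)[OF Lu[OF t]]
        by (rule set_integral_diff(2)[OF i(1,2), symmetric])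
      also have "\<dots> \<le> (LINT x:\<Omega>|lebesgue. (- 2) * (ub t x \<bullet> (u t x - ub t x)))"
      proof (rule set_integral_mono)
        show "set_integrable lebesgue \<Omega> (\<lambda>x. (norm (ub t x))\<^sup>2 - (norm (u t x))\<^sup>2)" by (rule set_integral_diff(1)[OF i(1,2)])
        show "set_integrable lebesgue \<Omega> (\<lambda>x. (- 2) * (ub t x \<bullet> (u t x - ub t x)))" by (intro set_integrable_mult_right) (rule i(3))
        show "(norm (ub t x))\<^sup>2 - (norm (u t x))\<^sup>2 \<le> (- 2) * (ub t x \<bullet> (u t x - ub t x))" for x
          using inner_ge_zero[of "u t x - ub t x"] unfolding power2_norm_eq_inner
          by (simp add: inner_diff_left inner_diff_right inner_commute)
      qed
      also have "\<dots> \<le> 2 * \<bar>LINT x:\<Omega>|lebesgue. ub t x \<bullet> (u t x - ub t x)\<bar>" by (subst set_integral_mult_right) linarith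
      also have "\<dots> \<le> 2 * (sqrt (L2sq \<Omega> (ub t)) * sqrt (L2sq \<Omega> (\<lambda>x. u t x - ub t x)))"
        using L2_Cauchy_Schwarz[OF Lub(1)[OF t] Lw] by simp
      also have "\<dots> \<le> 2 * (V * c * \<epsilon>)"
      proof -
        have "sqrt (L2sq \<Omega> (\<lambda>x. u t x - ub t x)) \<le> \<epsilon>"
          using L2nrm_le_imp(2)[OF cl \<epsilon>] \<epsilon> by (intro real_le_lsqrt)
        then show ?thesis
          using Lub(2)[OF t] V(1) by (intro mult_left_mono mult_mono) (auto simp: c_def L2sq_nonneg)
      qed
      finally show ?thesis .
    qed
    have "F * \<epsilon> * sqrt (measure lebesgue \<Omega>) * t \<le> F * \<epsilon> * sqrt (measure lebesgue \<Omega>) * T"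
      using t F(1) \<epsilon> by (intro mult_left_mono) auto
    then have work': "(LINT z:?A|lebesgue. f (fst z) (snd z) \<bullet> (u (fst z) (snd z) - ub (fst z) (snd z))) \<le> F * \<epsilon> * c * T"
      using work unfolding c_def by linarith
    \<comment> \<open>In the energy inequality minus the energy balance the initial energies cancel.
      What remains is the difference of the kinetic terms and the work of the force on
      \<open>u - ub\<close>.\<close>
    show ?thesis using en[OF t] bal[OF t] kin work' split unfolding g_def by (simp add: algebra_simps)
  qed
  \<comment> \<open>\<open>main\<close> covers only the times at which the two velocities are close,
    and \<open>T\<close> may not be among them. The bound does not depend on the time, so it extends
    to the whole interval.\<close>
  define C where "C = (V + F * T) * c * \<epsilon>"
  have C0: "0 \<le> C" using V(1) F(1) T \<epsilon> by (simp add: C_def c_def)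
  have "(\<integral>\<^sup>+s\<in>{0..T}. g s \<partial>lebesgue) \<le> ennreal (C / \<nu>)"
  proof (rule nn_integral_Icc_le_of_AE[OF _ T])
    show "g \<in> borel_measurable lebesgue" unfolding g_def by (rule dissipation_measurable[OF \<Omega>(1) mDu])
    show "AE t in lebesgue. t \<in> {0..T} \<longrightarrow> (\<integral>\<^sup>+s\<in>{0..t}. g s \<partial>lebesgue) \<le> ennreal (C / \<nu>)"
      using close
    proof eventually_elim
      case (elim t)
      show ?case
      proof
        assume t: "t \<in> {0..T}"
        have "(\<integral>\<^sup>+s\<in>{0..t}. g s \<partial>lebesgue) \<le> (\<integral>\<^sup>+s\<in>{0..T}. g s \<partial>lebesgue)"
          using t by (intro nn_integral_mono) (auto simp: indicator_def)
        also have "\<dots> < \<infinity>" using fin by (simp add: g_def)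
        finally have fin_t: "(\<integral>\<^sup>+s\<in>{0..t}. g s \<partial>lebesgue) < \<infinity>" .
        have "enn2real (\<integral>\<^sup>+s\<in>{0..t}. g s \<partial>lebesgue) \<le> C / \<nu>"
          using main[OF t] elim t \<nu> unfolding C_def[symmetric] by (simp add: pos_le_divide_eq mult_ac)
        then have "ennreal (enn2real (\<integral>\<^sup>+s\<in>{0..t}. g s \<partial>lebesgue)) \<le> ennreal (C / \<nu>)" by (rule ennreal_leI)
        then show "(\<integral>\<^sup>+s\<in>{0..t}. g s \<partial>lebesgue) \<le> ennreal (C / \<nu>)" using fin_t by simp
      qed
    qed
  qed
  then have "enn2real (\<integral>\<^sup>+s\<in>{0..T}. g s \<partial>lebesgue) \<le> C / \<nu>"
    using C0 \<nu> by (intro enn2real_leI) auto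
  then show ?thesis unfolding g_def C_def c_def[symmetric] using \<nu> by (simp add: pos_le_divide_eq mult.commute)
qed

section \<open>Choice of the constant and passage to the inviscid limit\<close>

theorem theorem5p1:
  fixes \<Omega> :: "'d::euclidean_space set" and T :: real
    and f :: "real \<Rightarrow> 'd \<Rightarrow> 'd" and u0 :: "'d \<Rightarrow> 'd" and ub :: "real \<Rightarrow> 'd \<Rightarrow> 'd"
  assumes "DIM('d) \<ge> 2"
    and "C2_domain \<Omega>"
    and "T > 0"
    and "H_space \<Omega> u0"
    and "\<exists>\<epsilon>>0. \<epsilon> < 1 \<and> Holder_space (if DIM('d) = 2 then 1 else 2) \<epsilon> \<Omega> u0"
    and "C1_time_C1 \<Omega> f"
    and "Euler_sol \<Omega> T f u0 ub"
  shows "(\<exists>C::real. \<forall>\<delta>::real \<Rightarrow> real. (\<forall>\<nu>>0. \<delta> \<nu> > 0) \<longrightarrow>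
            (\<forall>\<nu>>0. \<forall>u Du. NS_weak \<Omega> T \<nu> f u0 u Du \<longrightarrow>
               L2L1_norm T (bl \<Omega> (\<delta> \<nu>)) (vort_abs Du) \<le> ennreal (C * sqrt (\<delta> \<nu> / \<nu>))))
       \<and> (\<forall>(\<delta>::real \<Rightarrow> real) U DU.
            (\<forall>\<nu>>0. \<delta> \<nu> > 0)
            \<and> (\<forall>\<nu>>0. NS_weak \<Omega> T \<nu> f u0 (U \<nu>) (DU \<nu>))
            \<and> ((\<lambda>\<nu>. esssup (restrict_space lebesgue {0..T}) (\<lambda>t. L2nrm \<Omega> (\<lambda>x. U \<nu> t x - ub t x)))
                  \<longlongrightarrow> 0) (at_right 0)
            \<and> Limsup (at_right 0) (\<lambda>\<nu>. ereal (\<delta> \<nu> / \<nu>)) < \<infinity>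
            \<longrightarrow> ((\<lambda>\<nu>. L2L1_norm T (bl \<Omega> (\<delta> \<nu>)) (vort_abs (DU \<nu>))) \<longlongrightarrow> 0) (at_right 0))"
proof (intro conjI allI impI)
  note dom = \<open>C2_domain \<Omega>\<close> and T = \<open>T > 0\<close> and f = \<open>C1_time_C1 \<Omega> f\<close> and E = \<open>Euler_sol \<Omega> T f u0 ub\<close>
  have \<Omega>: "open \<Omega>" "bounded \<Omega>" using dom by (auto simp: C2_domain_def)
  have m\<Omega>: "\<Omega> \<in> lmeasurable" using \<Omega> by (simp add: lmeasurable_open)
  obtain K where K: "0 \<le> K" "\<And>\<delta>. \<delta> > 0 \<Longrightarrow> emeasure lebesgue (bl \<Omega> \<delta>) \<le> ennreal (K * \<delta>)"
    using C2_domain_layer_measure_le[OF dom] by blast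
  obtain F where F: "F \<ge> 0" "\<And>t x. t \<in> {0..T} \<Longrightarrow> x \<in> \<Omega> \<Longrightarrow> norm (f t x) \<le> F"
    using C1_time_C1_bounded[OF \<Omega>(1) f] by blast
  obtain V where V: "V \<ge> 0" "\<And>t x. t \<in> {0..T} \<Longrightarrow> x \<in> \<Omega> \<Longrightarrow> norm (ub t x) \<le> V"
    using Euler_sol_regular(2)[OF E \<Omega>(2)] by blast
  \<comment> \<open>This serves both halves: with \<open>R = d / \<nu>\<close> and the uniform
    energy bound it gives the rate, and with a fixed \<open>R\<close> and arbitrarily small
    \<open>C\<close> it gives the limit.\<close>
  have vort: "L2L1_norm T (bl \<Omega> d) (vort_abs Du) \<le> ennreal (sqrt (K * R * C))"
    if NS: "NS_weak \<Omega> T \<nu> f u0 u Du" and "\<nu> > 0" "d > 0" "d / \<nu> \<le> R"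
      and C: "\<nu> * enn2real (\<integral>\<^sup>+t\<in>{0..T}. dissipation \<Omega> Du t \<partial>lebesgue) \<le> C" for \<nu> d R C u Du
  proof -
    let ?D = "enn2real (\<integral>\<^sup>+t\<in>{0..T}. dissipation \<Omega> Du t \<partial>lebesgue)"
    have "bl \<Omega> d \<in> sets lebesgue" using open_bl[OF \<Omega>(1)] by auto
    moreover have "bl \<Omega> d \<subseteq> \<Omega>" by (auto simp: bl_def)
    ultimately have "L2L1_norm T (bl \<Omega> d) (vort_abs Du) \<le> ennreal (sqrt (K * d * ?D))"
      using K(1) that(3) by (intro vorticity_layer_le[OF NS \<Omega>(1) _ _ K(2)[OF that(3)]]) auto
    also have "K * d * ?D = K * (d / \<nu>) * (\<nu> * ?D)" using that(2) by simp
    also have "\<dots> \<le> K * R * C"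
      using that(2-4) C K(1) order_trans[OF _ C, of 0]
      by (intro mult_mono) (auto intro!: mult_nonneg_nonneg order_trans[OF _ that(4), of 0])
    finally show ?thesis by (simp add: ennreal_leI)
  qed
  define A where "A = L2sq \<Omega> u0 + 2 * (F * sqrt (measure lebesgue \<Omega>) * T)\<^sup>2"
  show "\<exists>C::real. \<forall>\<delta>::real \<Rightarrow> real. (\<forall>\<nu>>0. \<delta> \<nu> > 0) \<longrightarrow>
            (\<forall>\<nu>>0. \<forall>u Du. NS_weak \<Omega> T \<nu> f u0 u Du \<longrightarrow>
               L2L1_norm T (bl \<Omega> (\<delta> \<nu>)) (vort_abs Du) \<le> ennreal (C * sqrt (\<delta> \<nu> / \<nu>)))"
  proof (intro exI[of _ "sqrt (K * A)"] allI impI)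
    fix \<delta> :: "real \<Rightarrow> real" and \<nu> :: real and u Du
    assume \<delta>: "\<forall>\<nu>>0. \<delta> \<nu> > 0" and \<nu>: "0 < \<nu>" and NS: "NS_weak \<Omega> T \<nu> f u0 u Du"
    have "\<nu> * enn2real (\<integral>\<^sup>+t\<in>{0..T}. dissipation \<Omega> Du t \<partial>lebesgue) \<le> A"
      unfolding A_def using T by (intro NS_weak_energy_bound[OF NS \<Omega>(1) m\<Omega> _ \<nu> F]) auto
    from vort[OF NS \<nu> _ order_refl this] \<delta> \<nu>
    have "L2L1_norm T (bl \<Omega> (\<delta> \<nu>)) (vort_abs Du) \<le> ennreal (sqrt (K * (\<delta> \<nu> / \<nu>) * A))" by blast
    also have "sqrt (K * (\<delta> \<nu> / \<nu>) * A) = sqrt (K * A) * sqrt (\<delta> \<nu> / \<nu>)"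
      unfolding real_sqrt_mult by simp
    finally show "L2L1_norm T (bl \<Omega> (\<delta> \<nu>)) (vort_abs Du) \<le> ennreal (sqrt (K * A) * sqrt (\<delta> \<nu> / \<nu>))" .
  qed
  fix \<delta> :: "real \<Rightarrow> real" and U DU
  assume hyp: "(\<forall>\<nu>>0. \<delta> \<nu> > 0)
            \<and> (\<forall>\<nu>>0. NS_weak \<Omega> T \<nu> f u0 (U \<nu>) (DU \<nu>))
            \<and> ((\<lambda>\<nu>. esssup (restrict_space lebesgue {0..T}) (\<lambda>t. L2nrm \<Omega> (\<lambda>x. U \<nu> t x - ub t x)))
                  \<longlongrightarrow> 0) (at_right 0)
            \<and> Limsup (at_right 0) (\<lambda>\<nu>. ereal (\<delta> \<nu> / \<nu>)) < \<infinity>"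
  then have \<delta>: "\<And>\<nu>. \<nu> > 0 \<Longrightarrow> \<delta> \<nu> > 0" and NS: "\<And>\<nu>. \<nu> > 0 \<Longrightarrow> NS_weak \<Omega> T \<nu> f u0 (U \<nu>) (DU \<nu>)"
    and lim: "((\<lambda>\<nu>. esssup (restrict_space lebesgue {0..T}) (\<lambda>t. L2nrm \<Omega> (\<lambda>x. U \<nu> t x - ub t x))) \<longlongrightarrow> 0) (at_right 0)"
    and ls: "Limsup (at_right 0) (\<lambda>\<nu>. ereal (\<delta> \<nu> / \<nu>)) < \<infinity>" by blast+
  have pos: "eventually (\<lambda>\<nu>::real. 0 < \<nu>) (at_right 0)" by (rule eventually_at_right_less)
  have close: "eventually (\<lambda>\<nu>. AE t in lebesgue. t \<in> {0..T} \<longrightarrow> L2nrm \<Omega> (\<lambda>x. U \<nu> t x - ub t x) \<le> ereal \<epsilon>) (at_right 0)"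
    if "\<epsilon> > 0" for \<epsilon>
  proof -
    have "eventually (\<lambda>\<nu>. esssup (restrict_space lebesgue {0..T}) (\<lambda>t. L2nrm \<Omega> (\<lambda>x. U \<nu> t x - ub t x)) < ereal \<epsilon>) (at_right 0)"
      using order_tendstoD(2)[OF lim, of "ereal \<epsilon>"] that by simp
    then show ?thesis
    proof eventually_elim
      case (elim \<nu>)
      have "AE t in restrict_space lebesgue {0..T}. L2nrm \<Omega> (\<lambda>x. U \<nu> t x - ub t x)
          \<le> esssup (restrict_space lebesgue {0..T}) (\<lambda>t. L2nrm \<Omega> (\<lambda>x. U \<nu> t x - ub t x))" by (rule esssup_AE)
      then have "AE t in restrict_space lebesgue {0..T}. L2nrm \<Omega> (\<lambda>x. U \<nu> t x - ub t x) \<le> ereal \<epsilon>"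
        by eventually_elim (use elim in order)
      then show ?case by (subst (asm) AE_restrict_space_iff) auto
    qed
  qed
  \<comment> \<open>These viscosities are selected by the distance to the Euler solution alone,
    since they only supply approximations of it in \<open>H\<close> and in \<open>H1_0\<close>. A
    sequence is chosen so that the exceptional times of all its members form one null set.\<close>
  have "\<exists>\<nu>>0. AE t in lebesgue. t \<in> {0..T} \<longrightarrow> L2nrm \<Omega> (\<lambda>x. U \<nu> t x - ub t x) \<le> ereal (1 / real (Suc n))" for n
    using eventually_happens'[OF _ eventually_conj[OF pos close[of "1 / real (Suc n)"]]] by (auto simp: trivial_limit_at_right_real)
  then have "\<forall>n. \<exists>\<nu>>0. AE t in lebesgue. t \<in> {0..T} \<longrightarrow> L2nrm \<Omega> (\<lambda>x. U \<nu> t x - ub t x) \<le> ereal (1 / real (Suc n))"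
    by (rule allI)
  from choice[OF this] obtain \<mu> where "\<forall>n. 0 < \<mu> n \<and>
      (AE t in lebesgue. t \<in> {0..T} \<longrightarrow> L2nrm \<Omega> (\<lambda>x. U (\<mu> n) t x - ub t x) \<le> ereal (1 / real (Suc n)))"
    by (rule exE)
  then have \<mu>: "\<mu> n > 0"
    and \<mu>c: "AE t in lebesgue. t \<in> {0..T} \<longrightarrow> L2nrm \<Omega> (\<lambda>x. U (\<mu> n) t x - ub t x) \<le> ereal (1 / real (Suc n))" for n
    by (auto dest: spec[of _ n])
  have \<mu>H: "AE t in lebesgue. t \<in> {0..T} \<longrightarrow> H1_0 \<Omega> (U (\<mu> n) t) (DU (\<mu> n) t)" for n
    using NS[OF \<mu>[of n]] unfolding NS_weak_def by blast
  have "AE t in lebesgue. \<forall>n. (t \<in> {0..T} \<longrightarrow> L2nrm \<Omega> (\<lambda>x. U (\<mu> n) t x - ub t x) \<le> ereal (1 / real (Suc n)))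
      \<and> (t \<in> {0..T} \<longrightarrow> H1_0 \<Omega> (U (\<mu> n) t) (DU (\<mu> n) t))"
    unfolding AE_all_countable using \<mu>c \<mu>H by (intro allI AE_conjI)
  then have approx: "AE s in lebesgue. s \<in> {0..T} \<longrightarrow> (\<exists>g G. (\<forall>n::nat. H_space \<Omega> (g n) \<and> H1_0 \<Omega> (g n) (G n))
      \<and> (\<lambda>n. L2sq \<Omega> (\<lambda>x. g n x - ub s x)) \<longlonglongrightarrow> 0)"
  proof eventually_elim
    case (elim s)
    show ?case
    proof
      assume s: "s \<in> {0..T}"
      have H: "H_space \<Omega> (U (\<mu> n) s)" for n using NS[OF \<mu>[of n]] s unfolding NS_weak_def by blast
      have H1: "H1_0 \<Omega> (U (\<mu> n) s) (DU (\<mu> n) s)" for n using elim s by blast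
      have "(\<lambda>n. L2sq \<Omega> (\<lambda>x. U (\<mu> n) s x - ub s x)) \<longlonglongrightarrow> 0"
      proof (rule tendsto_sandwich[OF _ _ tendsto_const])
        show "\<forall>\<^sub>F n in sequentially. L2sq \<Omega> (\<lambda>x. U (\<mu> n) s x - ub s x) \<le> (1 / real (Suc n))\<^sup>2"
          using elim s by (intro always_eventually allI L2nrm_le_imp(2)) auto
        have "(\<lambda>n. (1 / real (Suc n))\<^sup>2) \<longlonglongrightarrow> 0\<^sup>2" by (intro tendsto_power LIMSEQ_Suc[OF lim_1_over_n])
        then show "(\<lambda>n. (1 / real (Suc n))\<^sup>2) \<longlonglongrightarrow> 0" by simp
      qed (simp add: L2sq_nonneg)
      then show "\<exists>g G. (\<forall>n::nat. H_space \<Omega> (g n) \<and> H1_0 \<Omega> (g n) (G n)) \<and> (\<lambda>n. L2sq \<Omega> (\<lambda>x. g n x - ub s x)) \<longlonglongrightarrow> 0"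
        using H H1 by (intro exI[of _ "\<lambda>n. U (\<mu> n) s"] exI[of _ "\<lambda>n. DU (\<mu> n) s"]) blast
    qed
  qed
  note bal = Euler_energy_balance[OF \<Omega> f E approx]
  define c where "c = (V + F * T) * sqrt (measure lebesgue \<Omega>)"
  have c0: "0 \<le> c" using V(1) F(1) T by (simp add: c_def)
  \<comment> \<open>A natural number above the upper limit is automatically nonnegative, as the
    choice of the tolerance below requires.\<close>
  obtain n :: nat where n: "Limsup (at_right 0) (\<lambda>\<nu>. ereal (\<delta> \<nu> / \<nu>)) < ereal (real n)"
    using ls less_PInf_Ex_of_nat by auto
  define R where "R = real n"
  have R: "eventually (\<lambda>\<nu>. \<delta> \<nu> / \<nu> \<le> R) (at_right 0)"
    using Limsup_lessD[OF n] by eventually_elim (simp add: R_def)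
  have small: "eventually (\<lambda>\<nu>. L2L1_norm T (bl \<Omega> (\<delta> \<nu>)) (vort_abs (DU \<nu>)) \<le> ennreal e) (at_right 0)"
    if e: "e > 0" for e
  proof -
    \<comment> \<open>Chosen so that \<open>K * R * (c * \<epsilon>) \<le> e\<^sup>2\<close>, to
      match the square root in \<open>vort\<close>; the added 1 keeps the denominator positive when
      \<open>K * R * c\<close> is 0.\<close>
    define \<epsilon> where "\<epsilon> = e\<^sup>2 / (K * R * c + 1)"
    have KRc: "0 \<le> K * R * c" using K(1) c0 by (simp add: R_def)
    then have \<epsilon>: "\<epsilon> > 0" using e by (simp add: \<epsilon>_def)
    have "K * R * (c * \<epsilon>) \<le> e\<^sup>2"
    proof -
      have "K * R * (c * \<epsilon>) = (K * R * c) * \<epsilon>" by simp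
      also have "\<dots> \<le> (K * R * c + 1) * \<epsilon>" using \<epsilon> by (intro mult_right_mono) auto
      also have "\<dots> = e\<^sup>2" using KRc by (simp add: \<epsilon>_def)
      finally show ?thesis .
    qed
    then have le: "sqrt (K * R * (c * \<epsilon>)) \<le> e" using e by (intro real_le_lsqrt) auto
    show ?thesis using pos R close[OF \<epsilon>]
    proof eventually_elim
      case (elim \<nu>)
      have "\<nu> * enn2real (\<integral>\<^sup>+t\<in>{0..T}. dissipation \<Omega> (DU \<nu>) t \<partial>lebesgue) \<le> c * \<epsilon>"
        unfolding c_def using elim \<epsilon>
        by (intro NS_dissipation_le_distance[OF NS[OF elim(1)] \<Omega> T elim(1) f F E V bal]) auto
      from vort[OF NS[OF elim(1)] elim(1) \<delta>[OF elim(1)] elim(2) this] le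
      show ?case by (meson ennreal_leI order_trans)
    qed
  qed
  show "((\<lambda>\<nu>. L2L1_norm T (bl \<Omega> (\<delta> \<nu>)) (vort_abs (DU \<nu>))) \<longlongrightarrow> 0) (at_right 0)"
  proof (rule order_tendstoI)
    fix a :: ennreal assume "0 < a"
    \<comment> \<open>\<open>a\<close> may be infinite; a positive \<open>b\<close> below it is
      finite and hence comes from a real number.\<close>
    then obtain b where b: "0 < b" "b < a" using dense by blast
    then obtain e where e: "b = ennreal e" "0 < e" by (cases b) auto
    show "\<forall>\<^sub>F \<nu> in at_right 0. L2L1_norm T (bl \<Omega> (\<delta> \<nu>)) (vort_abs (DU \<nu>)) < a"
      using small[OF e(2)] by eventually_elim (use b e in order)
  qed simp
qed

end
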